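(* Let $d\ge2$, let $\Omega$ be a compact subset of $\mathbb R^d$ with smooth boundary, and let $0<m<|\Omega|$. Let $E_0$ be a solution of the constrained isoperimetric problem $$\min\{P(E):\ E\subset\Omega,\ |E|=m\}.$$ Then, for $\alpha\in(0,d-1)$ and $Q>0$, $$\inf_{|E|=m,\ E\subset\Omega}\mathcal F_{\alpha,Q}(E)=\inf_{|E|=m,\ E\subset\Omega}\mathcal G_{\alpha,Q}(E)=P(E_0)+Q^2\,\mathcal I_\alpha(\Omega),$$ where the infima are over open sets $E\subset\Omega$ with $|E|=m$.
   Context: $|E|$ is Lebesgue measure in $\mathbb R^d$. "Compact subset with smooth boundary" means that $\Omega$ is the closure of a bounded open set with smooth boundary. $P(E)$ is the perimeter of $E$ in $\mathbb R^d$ in the sense of De Giorgi (equal to $\mathcal H^{d-1}(\partial E)$ when $E$ has smooth boundary); in the constrained isoperimetric problem $E$ ranges over measurable subsets of $\Omega$. For a Borel set $A\subset\mathbb R^d$, $$\mathcal I_\alpha(A)=\inf\left\{\int_{\mathbb R^d\times\mathbb R^d}\frac{d\mu(x)\,d\mu(y)}{|x-y|^\alpha}:\ \mu \text{ non-negative Borel measure on }\mathbb R^d,\ \mu(A)=1\right\}.$$ For every open set $E\subset\mathbb R^d$, $\mathcal F_{\alpha,Q}(E)=P(E)+Q^2\mathcal I_\alpha(E)$ and $\mathcal G_{\alpha,Q}(E)=P(E)+Q^2\mathcal I_\alpha(\partial E)$. *)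

theory Defs
  imports "HOL-Analysis.Analysis"
begin

text \<open>\<^term>\<open>k\<close> times continuously differentiable on an open set: all iterated directional
  derivatives up to order \<^term>\<open>k\<close> exist and are continuous. In finite dimension this is the
  usual class C^k.\<close>

primrec Ck_on :: "nat \<Rightarrow> 'a::euclidean_space set \<Rightarrow> ('a \<Rightarrow> 'b::real_normed_vector) \<Rightarrow> bool" where
  "Ck_on 0 S f \<longleftrightarrow> continuous_on S f"
| "Ck_on (Suc k) S f \<longleftrightarrow>
     (\<forall>x\<in>S. f differentiable (at x)) \<and> (\<forall>v. Ck_on k S (\<lambda>x. frechet_derivative f (at x) v))"

definition smooth_on :: "'a::euclidean_space set \<Rightarrow> ('a \<Rightarrow> 'b::real_normed_vector) \<Rightarrow> bool" where
  "smooth_on S f \<longleftrightarrow> (\<forall>k. Ck_on k S f)"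

text \<open>An open set has smooth boundary if near each boundary point it is the strict sublevel set of
  a smooth function with non-vanishing derivative there. In particular the set lies locally
  on one side of its boundary only.\<close>

definition open_smooth_boundary :: "'a::euclidean_space set \<Rightarrow> bool" where
  "open_smooth_boundary U \<longleftrightarrow> open U \<and>
     (\<forall>p\<in>frontier U. \<exists>W \<rho>. open W \<and> p \<in> W \<and> smooth_on W (\<rho> :: 'a \<Rightarrow> real) \<and>
        (\<exists>v. frechet_derivative \<rho> (at p) v \<noteq> 0) \<and> U \<inter> W = {x \<in> W. \<rho> x < 0})"

definition compact_smooth_boundary :: "'a::euclidean_space set \<Rightarrow> bool" where
  "compact_smooth_boundary \<Omega> \<longleftrightarrow>
     (\<exists>U. bounded U \<and> open_smooth_boundary U \<and> \<Omega> = closure U)"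

definition divergence :: "('a::euclidean_space \<Rightarrow> 'a) \<Rightarrow> 'a \<Rightarrow> real" where
  "divergence \<phi> x = (\<Sum>b\<in>Basis. frechet_derivative \<phi> (at x) b \<bullet> b)"

definition admissible_fields :: "('a::euclidean_space \<Rightarrow> 'a) set" where
  "admissible_fields =
     {\<phi>. Ck_on 1 UNIV \<phi> \<and> compact (closure {x. \<phi> x \<noteq> 0}) \<and> (\<forall>x. norm (\<phi> x) \<le> 1)}"

text \<open>De Giorgi perimeter. Negative integrals are truncated to 0 by \<^const>\<open>ennreal\<close>; this does not
  change the supremum, because the zero field is admissible.\<close>

definition perimeter :: "'a::euclidean_space set \<Rightarrow> ennreal" where
  "perimeter E = (SUP \<phi>\<in>admissible_fields. ennreal (LINT x:E|lebesgue. divergence \<phi> x))"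

text \<open>The kernel is infinite on the diagonal: there the denominator is 0, and 1 / 0 is the top
  element of \<^typ>\<open>ennreal\<close>. The double integral is written as an iterated integral because
  \<^term>\<open>\<mu>\<close> need not be sigma-finite, and the library's product measure is meaningful only for
  sigma-finite factors, where by Tonelli both integrals agree.\<close>

definition riesz_energy :: "real \<Rightarrow> 'a::euclidean_space measure \<Rightarrow> ennreal" where
  "riesz_energy \<alpha> \<mu> = (\<integral>\<^sup>+ x. (\<integral>\<^sup>+ y. 1 / ennreal (norm (x - y) powr \<alpha>) \<partial>\<mu>) \<partial>\<mu>)"

definition min_riesz_energy :: "real \<Rightarrow> 'a::euclidean_space set \<Rightarrow> ennreal" where
  "min_riesz_energy \<alpha> A = (INF \<mu>\<in>{\<mu>. sets \<mu> = sets borel \<and> emeasure \<mu> A = 1}. riesz_energy \<alpha> \<mu>)"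

definition F_energy :: "real \<Rightarrow> real \<Rightarrow> 'a::euclidean_space set \<Rightarrow> ennreal" where
  "F_energy \<alpha> Q E = perimeter E + ennreal (Q\<^sup>2) * min_riesz_energy \<alpha> E"

definition G_energy :: "real \<Rightarrow> real \<Rightarrow> 'a::euclidean_space set \<Rightarrow> ennreal" where
  "G_energy \<alpha> Q E = perimeter E + ennreal (Q\<^sup>2) * min_riesz_energy \<alpha> (frontier E)"

definition isoperimetric_solution :: "'a::euclidean_space set \<Rightarrow> real \<Rightarrow> 'a set \<Rightarrow> bool" where
  "isoperimetric_solution \<Omega> m E \<longleftrightarrow>
     is_arg_min perimeter
       (\<lambda>E. E \<in> sets lebesgue \<and> E \<subseteq> \<Omega> \<and> emeasure lebesgue E = ennreal m) E"

definition open_competitors :: "'a::euclidean_space set \<Rightarrow> real \<Rightarrow> 'a set set" where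
  "open_competitors \<Omega> m = {E. open E \<and> E \<subseteq> \<Omega> \<and> emeasure lebesgue E = ennreal m}"

end

theory Submission
  imports Defs
begin

text \<open>The lower bound is monotonicity of the Riesz energy in the set. For the upper bound both terms
  decouple, because a charge can be carried by sets of negligible perimeter. An almost optimal measure on
  \<open>\<Omega>\<close> is spread over small balls in the interior and then concentrated on flat cubes of side \<open>r\<close> and dimension
  \<open>d - 1\<close>, one in each cell of a lattice of mesh \<open>\<eta>\<close>, with \<open>r\<close> of order \<open>\<eta> powr (d / \<beta>)\<close> for some \<open>\<alpha> < \<beta> < d - 1\<close>. The
  charge then keeps a Frostman condition of exponent \<open>\<beta> > \<alpha>\<close>, so its energy converges, while balls covering
  the cubes have total perimeter of order \<open>r ^ (d - 1) / \<eta> ^ d\<close>, which tends to 0 as \<open>\<beta> < d - 1\<close>. Adding these balls to an open set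
  puts the cubes inside it; removing the cubes, a null set, changes neither volume nor perimeter and
  puts them on the boundary.

  The isoperimetric set is replaced by open sets inside \<open>\<Omega>\<close> of almost the same perimeter by
  mollification, choice of a good superlevel set, and intersection with the interior of \<open>\<Omega>\<close>, where
  submodularity and lower semicontinuity of the perimeter control the intersection. The volume
  constraint is restored by removing one small ball and adding another.\<close>

section \<open>Integration by parts and bounds for the perimeter\<close>

text \<open>The energy converges because the Frostman bound is scale invariant: its constant does
  not depend on the scale \<delta> of the small balls. Charges coming from points much farther apart
  than \<delta> see a slightly shifted kernel; charges from closer points cost at most a constant
  times \<open>\<delta> powr - \<alpha>\<close>, which the original kernel dominates up to a factor.
  The original finite energy thus provides an integrable majorant, and since it leaves no mass on
  the diagonal, dominated convergence applies. The bound \<open>\<alpha> < d - 1\<close> leaves room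
  for \<beta>: above \<alpha>, so that potentials stay bounded, and below \<open>d - 1\<close>, the
  dimension of sets that can be covered at little cost in perimeter. Smoothness of the boundary
  enters in two ways. A strip of width \<open>h\<close> around it has volume of order
  \<open>h\<close>, which yields a null boundary and finite perimeter of the interior. And every
  point of \<Omega> has, within a distance comparable to \<delta>, a ball of radius \<delta> in the
  interior, which is where its charge goes.\<close>

lemma integrable_bounded_support:
  fixes f :: "'a::euclidean_space \<Rightarrow> 'b::{banach,second_countable_topology}"
  assumes "f \<in> borel_measurable borel" "\<And>x. norm (f x) \<le> B" "\<And>x. x \<notin> cball 0 R \<Longrightarrow> f x = 0"
  shows "integrable lborel f"
  by (rule integrableI_bounded_set[where A="cball 0 R" and B=B])
     (use assms emeasure_lborel_cball_finite[of "0::'a" R] in \<open>auto simp: top.not_eq_extremum\<close>)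

lemma lborel_integral_translate:
  fixes f :: "'a::euclidean_space \<Rightarrow> 'b::{banach,second_countable_topology}"
  assumes "f \<in> borel_measurable borel"
  shows "(\<integral>x. f (x + c) \<partial>lborel) = (\<integral>x. f x \<partial>lborel)"
proof -
  have "(\<integral>x. f x \<partial>lborel) = (\<integral>x. f x \<partial>distr lborel borel ((+) c))"
    by (simp add: lborel_distr_plus)
  also have "\<dots> = (\<integral>x. f (c + x) \<partial>lborel)"
    by (rule integral_distr) (use assms in auto)
  finally show ?thesis by (simp add: add.commute)
qed

lemma emeasure_lborel_translate:
  fixes A :: "'a::euclidean_space set"
  assumes "A \<in> sets borel"
  shows "emeasure lborel ((\<lambda>x. x + c) ` A) = emeasure lborel A"
proof -
  have eq: "(\<lambda>x. x + c) ` A = (+) (-c) -` A"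
    by (auto simp: image_iff intro!: bexI[of _ "_ - c"])
  have "emeasure lborel A = emeasure (distr lborel borel ((+) (-c))) A"
    by (simp add: lborel_distr_plus)
  also have "\<dots> = emeasure lborel ((+) (-c) -` A)"
    by (subst emeasure_distr) (use assms in auto)
  finally show ?thesis using eq by simp
qed

lemma continuous_bounded_support:
  fixes f :: "'a::euclidean_space \<Rightarrow> 'b::real_normed_vector"
  assumes "continuous_on UNIV f" "\<And>x. x \<notin> cball 0 R \<Longrightarrow> f x = 0"
  obtains M where "M \<ge> 0" "\<And>x. norm (f x) \<le> M"
proof -
  have "bounded (f ` cball 0 R)"
    by (intro compact_imp_bounded compact_continuous_image) (use assms in \<open>auto intro: continuous_on_subset\<close>)
  then obtain M where M: "\<And>x. x \<in> cball 0 R \<Longrightarrow> norm (f x) \<le> M"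
    unfolding bounded_iff by blast
  have "norm (f x) \<le> max M 0" for x
    using M[of x] assms(2)[of x] by (cases "x \<in> cball 0 R") (auto simp: le_max_iff_disj)
  then show ?thesis using that[of "max M 0"] by auto
qed

section \<open>Difference quotients and integrals of directional derivatives\<close>

lemma has_real_derivative_along_line:
  fixes f :: "'a::euclidean_space \<Rightarrow> real"
  assumes "(f has_derivative f') (at (x + t *\<^sub>R b))"
  shows "((\<lambda>t. f (x + t *\<^sub>R b)) has_real_derivative f' b) (at t)"
proof -
  have "((\<lambda>t. x + t *\<^sub>R b) has_derivative (\<lambda>s. s *\<^sub>R b)) (at t)"
    by (auto intro!: derivative_eq_intros)
  from has_derivative_compose[OF this assms]
  have "((\<lambda>t. f (x + t *\<^sub>R b)) has_derivative (\<lambda>s. f' (s *\<^sub>R b))) (at t)" .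
  moreover have "f' (s *\<^sub>R b) = f' b * s" for s
    using has_derivative_linear[OF assms] by (simp add: linear_cmul)
  ultimately show ?thesis by (simp add: has_field_derivative_def)
qed

lemma derivative_zero_outside:
  fixes f :: "'a::euclidean_space \<Rightarrow> 'b::real_normed_vector"
  assumes "(f has_derivative f') (at x)" "\<And>x. x \<notin> cball 0 R \<Longrightarrow> f x = 0" "x \<notin> cball 0 R"
  shows "f' = (\<lambda>h. 0)"
proof -
  have "(f has_derivative (\<lambda>h. 0)) (at x)"
    by (rule has_derivative_transform_within_open[where f = "\<lambda>_. 0" and s = "- cball 0 R"])
       (use assms in auto)
  with assms(1) show ?thesis by (rule has_derivative_unique)
qed

text \<open>The weight \<open>g\<close> is merely bounded and measurable. With \<open>g = 1\<close>
  translation invariance evaluates the quotients; with \<open>g\<close> an indicator the shift can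
  be moved onto the set. The mean value theorem supplies the dominating function.\<close>

lemma difference_quotient_integral:
  fixes f g :: "'a::euclidean_space \<Rightarrow> real"
  assumes der: "\<And>x. (f has_derivative f' x) (at x)" and cont: "continuous_on UNIV (\<lambda>x. f' x b)"
    and supp: "\<And>x. x \<notin> cball 0 R \<Longrightarrow> f x = 0"
    and g: "g \<in> borel_measurable borel" "\<And>x. \<bar>g x\<bar> \<le> B"
  shows "(\<lambda>n. \<integral>x. g x * ((f (x + inverse (real (Suc n)) *\<^sub>R b) - f x) * real (Suc n)) \<partial>lborel)
     \<longlonglongrightarrow> (\<integral>x. g x * f' x b \<partial>lborel)"
proof -
  have f'0: "f' x b = 0" if "x \<notin> cball 0 R" for x
    using derivative_zero_outside[OF der supp that] by simp
  from continuous_bounded_support[OF cont f'0] obtain M where M: "M \<ge> 0" "\<And>x. norm (f' x b) \<le> M"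
    by blast
  have B0: "B \<ge> 0" using g(2)[of 0] by linarith
  have contf: "continuous_on UNIV f"
    using der by (meson continuous_at_imp_continuous_on has_derivative_continuous)
  have [measurable]: "f \<in> borel_measurable borel" "(\<lambda>x. f' x b) \<in> borel_measurable borel" "g \<in> borel_measurable borel"
    using contf cont g by (auto intro: borel_measurable_continuous_onI)
  define q where "q = (\<lambda>n x. (f (x + inverse (real (Suc n)) *\<^sub>R b) - f x) * real (Suc n))"
  have qM: "\<bar>q n x\<bar> \<le> M" for n x
  proof -
    define h where "h = inverse (real (Suc n))"
    have h: "h > 0" "h * real (Suc n) = 1" by (auto simp: h_def)
    obtain \<xi> where \<xi>: "f (x + h *\<^sub>R b) - f (x + 0 *\<^sub>R b) = (h - 0) * f' (x + \<xi> *\<^sub>R b) b"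
      using MVT2[of 0 h "\<lambda>t. f (x + t *\<^sub>R b)" "\<lambda>t. f' (x + t *\<^sub>R b) b"] h
        has_real_derivative_along_line[OF der] by blast
    have "q n x = f' (x + \<xi> *\<^sub>R b) b"
      unfolding q_def h_def[symmetric] using \<xi> h by (simp add: mult.commute mult.left_commute)
    with M(2) show ?thesis by simp
  qed
  have q0: "q n x = 0" if "x \<notin> cball 0 (R + norm b)" for n x
  proof -
    have "norm (inverse (real (Suc n)) *\<^sub>R b) \<le> norm b"
      using mult_right_mono[of "inverse (real (Suc n))" 1 "norm b"] by (simp add: inverse_le_1_iff)
    moreover have "norm x \<le> norm (x + inverse (real (Suc n)) *\<^sub>R b) + norm (inverse (real (Suc n)) *\<^sub>R b)"
      by (metis add_diff_cancel_right' norm_triangle_ineq4)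
    ultimately have "x + inverse (real (Suc n)) *\<^sub>R b \<notin> cball 0 R" "x \<notin> cball 0 R"
      using that norm_ge_zero[of b] unfolding mem_cball dist_0_norm by linarith+
    then show ?thesis unfolding q_def using supp by simp
  qed
  have lim: "(\<lambda>n. q n x) \<longlonglongrightarrow> f' x b" for x
  proof -
    have "((\<lambda>t. f (x + t *\<^sub>R b)) has_real_derivative f' x b) (at 0)"
      by (rule has_real_derivative_along_line) (simp add: der)
    then have "(\<lambda>h. (f (x + h *\<^sub>R b) - f x) / h) \<midarrow>0\<rightarrow> f' x b"
      by (simp add: DERIV_def)
    then have "(\<lambda>n. (f (x + inverse (real (Suc n)) *\<^sub>R b) - f x) / inverse (real (Suc n))) \<longlonglongrightarrow> f' x b"
      unfolding LIMSEQ_SEQ_conv[symmetric]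
      by (rule allE[where x = "\<lambda>n. inverse (real (Suc n))"])
         (rule mp, assumption, intro conjI allI LIMSEQ_inverse_real_of_nat, simp)
    then show ?thesis unfolding q_def by (simp add: divide_inverse)
  qed
  have "(\<lambda>n. \<integral>x. g x * q n x \<partial>lborel) \<longlonglongrightarrow> (\<integral>x. g x * f' x b \<partial>lborel)"
  proof (rule integral_dominated_convergence[where w = "\<lambda>x. indicator (cball 0 (R + norm b)) x * (B * M)"])
    show "integrable lborel (\<lambda>x. indicator (cball 0 (R + norm b)) (x::'a) * (B * M))"
      by (rule integrable_bounded_support[where B = "B*M" and R = "R + norm b"])
         (use B0 M in \<open>auto simp: indicator_def\<close>)
    show "(\<lambda>x. g x * q n x) \<in> borel_measurable lborel" for n unfolding q_def by measurable
    show "AE x in lborel. (\<lambda>n. g x * q n x) \<longlonglongrightarrow> g x * f' x b"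
      by (intro AE_I2 tendsto_mult lim tendsto_const)
    show "AE x in lborel. norm (g x * q n x) \<le> indicator (cball 0 (R + norm b)) x * (B * M)" for n
    proof (intro AE_I2)
      fix x
      show "norm (g x * q n x) \<le> indicator (cball 0 (R + norm b)) x * (B * M)"
        using q0[of x n] mult_mono[OF g(2)[of x] qM[of n x]] B0
        by (cases "x \<in> cball 0 (R + norm b)") (auto simp: abs_mult)
    qed
  qed simp
  then show ?thesis unfolding q_def .
qed

text \<open>By translation invariance every difference quotient of \<open>f\<close> has integral
  0.\<close>

lemma integral_derivative_eq_0:
  fixes f :: "'a::euclidean_space \<Rightarrow> real"
  assumes der: "\<And>x. (f has_derivative f' x) (at x)" and cont: "continuous_on UNIV (\<lambda>x. f' x b)"
    and supp: "\<And>x. x \<notin> cball 0 R \<Longrightarrow> f x = 0"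
  shows "(\<integral>x. f' x b \<partial>lborel) = 0"
proof -
  have contf: "continuous_on UNIV f"
    using der by (meson continuous_at_imp_continuous_on has_derivative_continuous)
  then have [measurable]: "f \<in> borel_measurable borel" by (rule borel_measurable_continuous_onI)
  obtain M where M: "\<And>x. norm (f x) \<le> M" using continuous_bounded_support[OF contf supp] by blast
  have int: "integrable lborel f" by (rule integrable_bounded_support[OF _ M supp]) auto
  have eq: "(\<integral>x. 1 * ((f (x + inverse (real (Suc n)) *\<^sub>R b) - f x) * real (Suc n)) \<partial>lborel) = 0" for n
  proof -
    let ?c = "inverse (real (Suc n)) *\<^sub>R b"
    have eqc: "f \<circ> (+) ?c = (\<lambda>x. f (x + ?c))" by (auto simp: add.commute)
    have "integrable (distr lborel borel ((+) ?c)) f" using int by (simp add: lborel_distr_plus)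
    then have "integrable lborel (\<lambda>x. f (?c + x))"
      by (subst (asm) integrable_distr_eq) auto
    then have "integrable lborel (\<lambda>x. f (x + ?c))" by (simp add: add.commute)
    then have "(\<integral>x. f (x + ?c) - f x \<partial>lborel) = 0"
      using int by (simp add: lborel_integral_translate)
    then show ?thesis by simp
  qed
  have "(\<lambda>n. \<integral>x. 1 * ((f (x + inverse (real (Suc n)) *\<^sub>R b) - f x) * real (Suc n)) \<partial>lborel)
     \<longlonglongrightarrow> (\<integral>x. 1 * f' x b \<partial>lborel)"
    by (rule difference_quotient_integral[OF der cont supp, where B = 1]) auto
  then have "(\<lambda>n::nat. 0::real) \<longlonglongrightarrow> (\<integral>x. 1 * f' x b \<partial>lborel)" unfolding eq .
  then show ?thesis using LIMSEQ_unique[OF _ tendsto_const] by force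
qed

section \<open>Admissible fields and integration by parts\<close>

lemma admissible_field_props:
  fixes \<phi> :: "'a::euclidean_space \<Rightarrow> 'a"
  assumes "\<phi> \<in> admissible_fields"
  shows admissible_has_derivative: "(\<phi> has_derivative frechet_derivative \<phi> (at x)) (at x)"
    and admissible_continuous: "continuous_on UNIV \<phi>"
    and admissible_norm: "norm (\<phi> x) \<le> 1"
    and admissible_derivative_continuous: "continuous_on UNIV (\<lambda>x. frechet_derivative \<phi> (at x) v)"
    and continuous_divergence: "continuous_on UNIV (divergence \<phi>)"
    and admissible_support: "\<exists>R. \<forall>x. x \<notin> cball 0 R \<longrightarrow> \<phi> x = 0"
    and divergence_bounded_support: "\<exists>R M. 0 \<le> M \<and> (\<forall>x. \<bar>divergence \<phi> x\<bar> \<le> M) \<and> (\<forall>x. x \<notin> cball 0 R \<longrightarrow> divergence \<phi> x = 0)"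
proof -
  have C1: "\<And>x. \<phi> differentiable (at x)" "\<And>v. continuous_on UNIV (\<lambda>x. frechet_derivative \<phi> (at x) v)"
    and cpt: "compact (closure {x. \<phi> x \<noteq> 0})" and n1: "\<And>x. norm (\<phi> x) \<le> 1"
    using assms by (auto simp: admissible_fields_def)
  show d: "(\<phi> has_derivative frechet_derivative \<phi> (at x)) (at x)" for x
    using C1(1) frechet_derivative_works by blast
  show "continuous_on UNIV \<phi>"
    using d by (meson continuous_at_imp_continuous_on has_derivative_continuous)
  show "norm (\<phi> x) \<le> 1" by (rule n1)
  show cv: "continuous_on UNIV (\<lambda>x. frechet_derivative \<phi> (at x) v)" for v by (rule C1)
  show cd: "continuous_on UNIV (divergence \<phi>)"
    unfolding divergence_def[abs_def] by (intro continuous_intros cv)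
  have "bounded {x. \<phi> x \<noteq> 0}" using compact_imp_bounded[OF cpt] closure_subset by (rule bounded_subset)
  then obtain R where R: "\<And>x. \<phi> x \<noteq> 0 \<Longrightarrow> norm x \<le> R" by (auto simp: bounded_iff)
  then have R': "\<And>x. x \<notin> cball 0 R \<Longrightarrow> \<phi> x = 0" by auto
  then show "\<exists>R. \<forall>x. x \<notin> cball 0 R \<longrightarrow> \<phi> x = 0" by blast
  have div0: "divergence \<phi> x = 0" if "x \<notin> cball 0 R" for x
    unfolding divergence_def using derivative_zero_outside[OF d R' that] by simp
  obtain M where "M \<ge> 0" "\<And>x. norm (divergence \<phi> x) \<le> M"
    using continuous_bounded_support[OF cd div0] by blast
  with div0 show "\<exists>R M. 0 \<le> M \<and> (\<forall>x. \<bar>divergence \<phi> x\<bar> \<le> M) \<and> (\<forall>x. x \<notin> cball 0 R \<longrightarrow> divergence \<phi> x = 0)"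
    by auto
qed

lemma borel_measurable_divergence [measurable]:
  "\<phi> \<in> admissible_fields \<Longrightarrow> divergence \<phi> \<in> borel_measurable borel"
  by (intro borel_measurable_continuous_onI continuous_divergence)

lemma integrable_mult_divergence:
  assumes "\<phi> \<in> admissible_fields" "w \<in> borel_measurable borel" "\<And>x. \<bar>w x\<bar> \<le> (B::real)"
  shows "integrable lborel (\<lambda>x. w x * divergence \<phi> x)"
proof -
  obtain R M where M: "0 \<le> M" "\<And>x. \<bar>divergence \<phi> x\<bar> \<le> M" "\<And>x. x \<notin> cball 0 R \<Longrightarrow> divergence \<phi> x = 0"
    using divergence_bounded_support[OF assms(1)] by blast
  have B0: "B \<ge> 0" using assms(3)[of 0] by linarith
  note [measurable] = assms(1,2)
  show ?thesis
    by (rule integrable_bounded_support[where B = "B * M" and R = R])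
       (use M assms(3) B0 in \<open>auto simp: abs_mult intro!: mult_mono\<close>)
qed

definition C1_grad :: "('a::euclidean_space \<Rightarrow> real) \<Rightarrow> ('a \<Rightarrow> 'a) \<Rightarrow> bool" where
  "C1_grad u G \<longleftrightarrow> (\<forall>x. (u has_derivative (\<lambda>h. G x \<bullet> h)) (at x)) \<and> continuous_on UNIV G"

lemma C1_gradD:
  assumes "C1_grad u G"
  shows C1_grad_has_derivative: "(u has_derivative (\<lambda>h. G x \<bullet> h)) (at x)"
    and C1_grad_continuous_grad: "continuous_on UNIV G"
    and C1_grad_continuous: "continuous_on UNIV u"
    and C1_grad_measurable: "u \<in> borel_measurable borel" "G \<in> borel_measurable borel"
proof -
  show d: "(u has_derivative (\<lambda>h. G x \<bullet> h)) (at x)" for x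
    using assms by (auto simp: C1_grad_def)
  show c: "continuous_on UNIV G"
    using assms by (auto simp: C1_grad_def)
  show cu: "continuous_on UNIV u"
    using d by (meson continuous_at_imp_continuous_on has_derivative_continuous)
  show "u \<in> borel_measurable borel" "G \<in> borel_measurable borel"
    using c cu by (auto intro: borel_measurable_continuous_onI)
qed

text \<open>The support of the field alone kills the boundary terms: each
  \<open>u x * (\<phi> x \<bullet> b)\<close> has compact support, so the integral of its derivative
  in direction \<open>b\<close> vanishes, and summing over the basis gives the identity.\<close>

lemma integral_by_parts_divergence:
  assumes \<phi>: "\<phi> \<in> admissible_fields" and u: "C1_grad u G"
  shows "(\<integral>x. u x * divergence \<phi> x \<partial>lborel) = - (\<integral>x. G x \<bullet> \<phi> x \<partial>lborel)"
    and "integrable lborel (\<lambda>x. G x \<bullet> \<phi> x)" and "integrable lborel (\<lambda>x. u x * divergence \<phi> x)"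
proof -
  obtain R where R: "\<And>x. x \<notin> cball 0 R \<Longrightarrow> \<phi> x = 0" using admissible_support[OF \<phi>] by blast
  note d\<phi> = admissible_has_derivative[OF \<phi>]
  define D where "D x = frechet_derivative \<phi> (at x)" for x
  have D0: "D x = (\<lambda>h. 0)" if "x \<notin> cball 0 R" for x
    unfolding D_def by (rule derivative_zero_outside[OF d\<phi> R that])
  have cD: "continuous_on UNIV (\<lambda>x. D x v)" for v
    unfolding D_def by (rule admissible_derivative_continuous[OF \<phi>])
  note cont = C1_grad_continuous_grad[OF u] C1_grad_continuous[OF u] admissible_continuous[OF \<phi>] cD
    continuous_divergence[OF \<phi>]
  have cint: "integrable lborel f" if "continuous_on UNIV f" "\<And>x. x \<notin> cball 0 R \<Longrightarrow> f x = 0" for f :: "'a \<Rightarrow> real"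
    using continuous_bounded_support[OF that] integrable_bounded_support[OF borel_measurable_continuous_onI[OF that(1)] _ that(2)]
    by metis
  show i1: "integrable lborel (\<lambda>x. G x \<bullet> \<phi> x)"
    by (rule cint) (auto intro!: continuous_intros cont simp: R)
  show i2: "integrable lborel (\<lambda>x. u x * divergence \<phi> x)"
    by (rule cint) (auto intro!: continuous_intros cont simp: divergence_def D_def[symmetric] D0)
  define f' where "f' b x h = u x * (D x h \<bullet> b) + (G x \<bullet> h) * (\<phi> x \<bullet> b)" for b x h
  have z: "(\<integral>x. f' b x b \<partial>lborel) = 0" for b
  proof (rule integral_derivative_eq_0[where f = "\<lambda>x. u x * (\<phi> x \<bullet> b)" and f' = "f' b" and b = b])
    show "((\<lambda>x. u x * (\<phi> x \<bullet> b)) has_derivative f' b x) (at x)" for x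
      unfolding f'_def[abs_def] D_def
      by (rule has_derivative_mult[OF C1_grad_has_derivative[OF u] has_derivative_inner_left[OF d\<phi>]])
    show "continuous_on UNIV (\<lambda>x. f' b x b)" unfolding f'_def by (intro continuous_intros cont)
    show "u x * (\<phi> x \<bullet> b) = 0" if "x \<notin> cball 0 R" for x using R[OF that] by simp
  qed
  have fi: "integrable lborel (\<lambda>x. f' b x b)" for b
    by (rule cint) (auto intro!: continuous_intros cont simp: f'_def R D0)
  have "(\<Sum>b\<in>Basis. f' b x b) = u x * divergence \<phi> x + G x \<bullet> \<phi> x" for x
    unfolding f'_def divergence_def D_def[symmetric]
    by (simp add: sum.distrib sum_distrib_left euclidean_inner[of "G x" "\<phi> x"])
  then have "(\<integral>x. u x * divergence \<phi> x + G x \<bullet> \<phi> x \<partial>lborel) = (\<integral>x. (\<Sum>b\<in>Basis. f' b x b) \<partial>lborel)"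
    by simp
  also have "\<dots> = 0" using fi z by simp
  finally show "(\<integral>x. u x * divergence \<phi> x \<partial>lborel) = - (\<integral>x. G x \<bullet> \<phi> x \<partial>lborel)"
    using i1 i2 by simp
qed

text \<open>Stated with real integrals, to avoid the truncation at 0 in \<^const>\<open>perimeter\<close>.\<close>

definition per_bound :: "'a::euclidean_space set \<Rightarrow> real \<Rightarrow> bool" where
  "per_bound E c \<longleftrightarrow> (\<forall>\<phi>\<in>admissible_fields. (\<integral>x. indicator E x * divergence \<phi> x \<partial>lborel) \<le> c)"

lemma set_lebesgue_integral_divergence:
  assumes "E \<in> sets borel" "\<phi> \<in> admissible_fields"
  shows "(LINT x:E|lebesgue. divergence \<phi> x) = (\<integral>x. indicator E x * divergence \<phi> x \<partial>lborel)"
  unfolding set_lebesgue_integral_def using assms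
  by (subst integral_completion) auto

lemma zero_admissible: "(\<lambda>x. 0) \<in> admissible_fields"
  by (auto simp: admissible_fields_def frechet_derivative_const)

lemma divergence_zero: "divergence (\<lambda>x. 0) x = 0"
  by (simp add: divergence_def frechet_derivative_const)

lemma per_bound_nonneg: "per_bound E c \<Longrightarrow> 0 \<le> c"
  unfolding per_bound_def using zero_admissible by (force simp: divergence_zero)

lemma perimeter_le_iff:
  assumes "E \<in> sets borel" "0 \<le> c"
  shows "perimeter E \<le> ennreal c \<longleftrightarrow> per_bound E c"
  unfolding perimeter_def per_bound_def SUP_le_iff using assms
  by (simp add: set_lebesgue_integral_divergence ennreal_le_iff)

lemma per_bound_mono: "per_bound E c \<Longrightarrow> c \<le> d \<Longrightarrow> per_bound E d"
  unfolding per_bound_def by force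

section \<open>Mollification\<close>

text \<open>This function vanishes on a half-line and is C^1, the regularity asked of admissible
  fields. Both the mollifier and the ramp functions are built from it.\<close>

lemma has_real_derivative_pos_part_square:
  "((\<lambda>t::real. (max 0 t)\<^sup>2) has_real_derivative 2 * max 0 t) (at t)"
proof -
  consider "t < 0" | "t > 0" | "t = 0" by linarith
  then show ?thesis
  proof cases
    case 1
    have "((\<lambda>t::real. 0) has_real_derivative 0) (at t)" by simp
    then show ?thesis
      by (rule DERIV_cong[OF has_field_derivative_transform_within_open[where S = "{..<0}"]])
         (use 1 in auto)
  next
    case 2
    have "((\<lambda>t::real. t\<^sup>2) has_real_derivative 2 * t) (at t)" by (auto intro!: derivative_eq_intros)
    then show ?thesis
      by (rule DERIV_cong[OF has_field_derivative_transform_within_open[where S = "{0<..}"]])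
         (use 2 in auto)
  next
    case 3
    have "(\<lambda>h::real. max 0 h) \<midarrow>0\<rightarrow> max 0 0" by (intro tendsto_intros)
    moreover have "(\<lambda>h::real. (max 0 h)\<^sup>2 / h) = (\<lambda>h. max 0 h)"
      by (auto simp: max_def power2_eq_square)
    ultimately have "(\<lambda>h::real. (max 0 h)\<^sup>2 / h) \<midarrow>0\<rightarrow> 0" by simp
    then show ?thesis using 3 by (simp add: DERIV_def)
  qed
qed

text \<open>\<open>odd\<close> reflects that the kernel is even. It is what allows a test field to
  be moved from one factor of a double integral to the other in the duality argument for the total
  variation.\<close>

locale mollifier =
  fixes \<kappa> :: "'a::euclidean_space \<Rightarrow> real" and K :: "'a \<Rightarrow> 'a" and \<delta> :: real
  assumes C1: "C1_grad \<kappa> K" and nonneg: "\<And>x. 0 \<le> \<kappa> x"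
    and support: "\<And>x. x \<notin> cball 0 \<delta> \<Longrightarrow> \<kappa> x = 0"
    and integral_1: "(\<integral>x. \<kappa> x \<partial>lborel) = 1"
    and odd: "\<And>x. K (- x) = - K x"

lemma mollifier_exists:
  assumes "\<delta> > 0"
  obtains \<kappa> :: "'a::euclidean_space \<Rightarrow> real" and K where "mollifier \<kappa> K \<delta>"
proof -
  \<comment> \<open>A radial squared positive part: radial symmetry gives \<open>odd\<close>, and
    division by the integral \<open>c\<close> normalises.\<close>
  define k where "k x = (max 0 (\<delta>\<^sup>2 - x \<bullet> x))\<^sup>2" for x :: 'a
  define g where "g x = (- 4 * max 0 (\<delta>\<^sup>2 - x \<bullet> x)) *\<^sub>R x" for x :: 'a
  have gk: "C1_grad k g"
    unfolding C1_grad_def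
  proof (intro conjI allI)
    show "continuous_on UNIV g" unfolding g_def by (intro continuous_intros)
    fix x :: 'a
    have "((\<lambda>x. \<delta>\<^sup>2 - x \<bullet> x) has_derivative (\<lambda>h. - 2 * (x \<bullet> h))) (at x)"
      by (auto intro!: derivative_eq_intros simp: inner_commute)
    from has_derivative_compose[OF this, of "\<lambda>t. (max 0 t)\<^sup>2" "\<lambda>s. s * (2 * max 0 (\<delta>\<^sup>2 - x \<bullet> x))"]
    show "(k has_derivative (\<lambda>h. g x \<bullet> h)) (at x)"
      using has_real_derivative_pos_part_square[of "\<delta>\<^sup>2 - x \<bullet> x"]
      by (simp add: k_def[abs_def] g_def has_field_derivative_def mult_commute_abs mult_ac)
  qed
  have k0: "k x = 0" if "x \<notin> cball 0 \<delta>" for x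
  proof -
    have "\<delta>\<^sup>2 \<le> (norm x)\<^sup>2" using that assms by (intro power_mono) auto
    then show ?thesis by (simp add: k_def power2_norm_eq_inner)
  qed
  have mk: "k \<in> borel_measurable borel" by (rule C1_grad_measurable[OF gk])
  obtain B where B: "\<And>x. norm (k x) \<le> B"
    using continuous_bounded_support[OF C1_grad_continuous[OF gk] k0] by blast
  have ik: "integrable lborel k" by (rule integrable_bounded_support[OF mk B k0])
  define c where "c = (\<integral>x. k x \<partial>lborel)"
  have kn: "k x \<ge> 0" for x by (simp add: k_def)
  have "c \<noteq> 0"
  proof
    assume "c = 0"
    then have "AE x in lborel. k x = 0"
      unfolding c_def using integral_nonneg_eq_0_iff_AE[OF ik] kn by auto
    then have "AE x in lborel. x \<notin> ball (0::'a) \<delta>"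
    proof eventually_elim
      case (elim x)
      show ?case
      proof
        assume "x \<in> ball 0 \<delta>"
        then have "(norm x)\<^sup>2 < \<delta>\<^sup>2" using assms by (intro power_strict_mono) auto
        with elim show False by (simp add: k_def power2_norm_eq_inner)
      qed
    qed
    then have "ball (0::'a) \<delta> \<in> null_sets lborel"
      by (subst AE_iff_null_sets) auto
    then have "measure lborel (ball (0::'a) \<delta>) = 0" by (simp add: measure_eq_0_null_sets)
    then show False using content_ball_pos[OF assms, of "0::'a"] by simp
  qed
  moreover have "c \<ge> 0" unfolding c_def using kn by (simp add: integral_nonneg_AE)
  ultimately have c: "c > 0" by simp
  have "mollifier (\<lambda>x. k x / c) (\<lambda>x. (1 / c) *\<^sub>R g x) \<delta>"
  proof
    show "C1_grad (\<lambda>x. k x / c) (\<lambda>x. (1 / c) *\<^sub>R g x)"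
      unfolding C1_grad_def
    proof (intro conjI allI)
      show "continuous_on UNIV (\<lambda>x. (1 / c) *\<^sub>R g x)"
        by (intro continuous_intros C1_grad_continuous_grad[OF gk])
      show "((\<lambda>x. k x / c) has_derivative (\<lambda>h. (1 / c) *\<^sub>R g x \<bullet> h)) (at x)" for x
        using has_derivative_scaleR_right[OF C1_grad_has_derivative[OF gk, of x], of "1 / c"] by simp
    qed
    show "(\<integral>x. k x / c \<partial>lborel) = 1" using c by (simp add: c_def[symmetric])
  qed (use kn c k0 in \<open>auto simp: g_def\<close>)
  then show ?thesis by (rule that)
qed

context mollifier
begin

lemma K_support: "x \<notin> cball 0 \<delta> \<Longrightarrow> K x = 0"
  using derivative_zero_outside[OF C1_grad_has_derivative[OF C1] support]
  by (metis inner_eq_zero_iff)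

lemmas measurable_\<kappa> [measurable] = C1_grad_measurable(1)[OF C1]
lemmas measurable_K [measurable] = C1_grad_measurable(2)[OF C1]

lemma \<kappa>_bounded: "\<exists>B. \<forall>x. norm (\<kappa> x) \<le> B"
  using continuous_bounded_support[OF C1_grad_continuous[OF C1] support] by metis

lemma K_bounded: "\<exists>B\<ge>0. \<forall>x. norm (K x) \<le> B"
  using continuous_bounded_support[OF C1_grad_continuous_grad[OF C1] K_support] by metis

lemma K_uniformly_continuous:
  assumes "\<eta> > 0"
  obtains d where "d > 0" "\<And>x y. norm (x - y) < d \<Longrightarrow> norm (K x - K y) < \<eta>"
proof -
  have "uniformly_continuous_on (cball 0 (\<delta> + 1)) K"
    by (rule compact_uniformly_continuous) (use C1_grad_continuous_grad[OF C1] in \<open>auto intro: continuous_on_subset\<close>)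
  then obtain d where d: "d > 0" "\<And>x y. x \<in> cball 0 (\<delta>+1) \<Longrightarrow> y \<in> cball 0 (\<delta>+1) \<Longrightarrow> dist y x < d \<Longrightarrow> dist (K y) (K x) < \<eta>"
    using assms unfolding uniformly_continuous_on_def by metis
  \<comment> \<open>If one of the points leaves the larger ball, both are outside the support, since
    they are less than 1 apart; both values then vanish.\<close>
  have "norm (K x - K y) < \<eta>" if "norm (x - y) < min d 1" for x y
  proof (cases "x \<in> cball 0 (\<delta>+1) \<and> y \<in> cball 0 (\<delta>+1)")
    case True
    then show ?thesis using d(2)[of y x] that by (simp add: dist_norm)
  next
    case False
    have "\<bar>norm x - norm y\<bar> < 1" using norm_triangle_ineq3[of x y] that by linarith
    then have "x \<notin> cball 0 \<delta>" "y \<notin> cball 0 \<delta>" using False by auto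
    then show ?thesis using K_support assms by simp
  qed
  then show ?thesis using d(1) that[of "min d 1"] by auto
qed

text \<open>The error is uniform in the base point \<open>a\<close>. It can therefore be integrated
  against an arbitrary bounded function of bounded support, which is how differentiation under the
  integral is justified below.\<close>

lemma \<kappa>_linearization:
  assumes "\<And>x y. norm (x - y) < d \<Longrightarrow> norm (K x - K y) < \<eta>" "norm v < d"
  shows "\<bar>\<kappa> (a + v) - \<kappa> a - K a \<bullet> v\<bar> \<le> \<eta> * norm v"
proof -
  obtain \<xi> where \<xi>: "0 < \<xi>" "\<xi> < 1" "\<kappa> (a + 1 *\<^sub>R v) - \<kappa> (a + 0 *\<^sub>R v) = (1 - 0) * (K (a + \<xi> *\<^sub>R v) \<bullet> v)"
    using MVT2[of 0 1 "\<lambda>t. \<kappa> (a + t *\<^sub>R v)" "\<lambda>t. K (a + t *\<^sub>R v) \<bullet> v"]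
        has_real_derivative_along_line[OF C1_grad_has_derivative[OF C1]] by auto
  have "norm ((a + \<xi> *\<^sub>R v) - a) < d"
    using \<xi> assms(2) mult_left_le_one_le[of "norm v" \<xi>] by simp
  then have "norm (K (a + \<xi> *\<^sub>R v) - K a) < \<eta>" by (rule assms(1))
  then have "norm (K (a + \<xi> *\<^sub>R v) - K a) * norm v \<le> \<eta> * norm v"
    by (intro mult_right_mono) auto
  moreover have "\<kappa> (a + v) - \<kappa> a - K a \<bullet> v = (K (a + \<xi> *\<^sub>R v) - K a) \<bullet> v"
    using \<xi>(3) by (simp add: inner_diff_left)
  ultimately show ?thesis using Cauchy_Schwarz_ineq2[of "K (a + \<xi> *\<^sub>R v) - K a" v] by linarith
qed

text \<open>The argument is \<open>y - x\<close>, so differentiating in \<open>x\<close> produces a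
  minus sign in front of \<open>K (y - x)\<close>.\<close>

definition conv :: "('a \<Rightarrow> 'b::euclidean_space) \<Rightarrow> 'a \<Rightarrow> 'b" where
  "conv \<psi> x = (\<integral>y. \<kappa> (y - x) *\<^sub>R \<psi> y \<partial>lborel)"

context
  fixes \<psi> :: "'a \<Rightarrow> 'b::euclidean_space" and R :: real
  assumes \<psi> [measurable]: "\<psi> \<in> borel_measurable borel"
    and \<psi>1: "\<And>x. norm (\<psi> x) \<le> 1" and \<psi>R: "\<And>x. x \<notin> cball 0 R \<Longrightarrow> \<psi> x = 0"
begin

lemma integrable_scaled:
  fixes f :: "'a \<Rightarrow> real"
  assumes "f \<in> borel_measurable borel" "\<And>x. \<bar>f x\<bar> \<le> B"
  shows "integrable lborel (\<lambda>y. f y *\<^sub>R \<psi> y)"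
proof (rule integrable_bounded_support[where B = B and R = R])
  have "norm (f x *\<^sub>R \<psi> x) \<le> B * 1" for x
    unfolding norm_scaleR using assms(2)[of x] \<psi>1[of x]
    by (intro mult_mono) auto
  then show "norm (f x *\<^sub>R \<psi> x) \<le> B" for x by simp
qed (use assms \<psi>R in auto)

lemma norm_integral_scaled_le:
  fixes f :: "'a \<Rightarrow> real"
  assumes "f \<in> borel_measurable borel" "\<And>x. \<bar>f x\<bar> \<le> B"
  shows "norm (\<integral>y. f y *\<^sub>R \<psi> y \<partial>lborel) \<le> B * measure lborel (cball (0::'a) R)"
proof -
  have B0: "B \<ge> 0" using assms(2)[of 0] by linarith
  have "norm (\<integral>y. f y *\<^sub>R \<psi> y \<partial>lborel) \<le> (\<integral>y. B * indicator (cball (0::'a) R) y \<partial>lborel)"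
  proof (rule Bochner_Integration.integral_norm_bound_integral)
    show "integrable lborel (\<lambda>y. f y *\<^sub>R \<psi> y)" by (rule integrable_scaled[OF assms])
    show "integrable lborel (\<lambda>y. B * indicator (cball (0::'a) R) y)"
      by (rule integrable_bounded_support[where B = B and R = R]) (use B0 in \<open>auto simp: indicator_def\<close>)
    fix x :: 'a
    have "norm (f x *\<^sub>R \<psi> x) \<le> B * 1"
      unfolding norm_scaleR using assms(2)[of x] \<psi>1[of x] by (intro mult_mono) auto
    then show "norm (f x *\<^sub>R \<psi> x) \<le> B * indicator (cball 0 R) x"
      using \<psi>R[of x] by (auto simp: indicator_def)
  qed
  also have "\<dots> = B * measure lborel (cball (0::'a) R)" by simp
  finally show ?thesis .
qed

lemma K_inner_bounded: "\<exists>B. \<forall>y. \<bar>K (y - x) \<bullet> h\<bar> \<le> B"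
proof -
  obtain B where B: "\<And>x. norm (K x) \<le> B" using K_bounded by blast
  have "\<bar>K (y - x) \<bullet> h\<bar> \<le> B * norm h" for y
    using Cauchy_Schwarz_ineq2[of "K (y - x)" h] mult_right_mono[OF B[of "y - x"], of "norm h"] by simp
  then show ?thesis by blast
qed

lemma integrable_K_scaled: "integrable lborel (\<lambda>y. (K (y - x) \<bullet> h) *\<^sub>R \<psi> y)"
proof -
  obtain B where "\<And>y. \<bar>K (y - x) \<bullet> h\<bar> \<le> B" using K_inner_bounded by blast
  then show ?thesis by (intro integrable_scaled) auto
qed

lemma integrable_\<kappa>_scaled: "integrable lborel (\<lambda>y. \<kappa> (y - x) *\<^sub>R \<psi> y)"
proof -
  obtain B where "\<And>x. norm (\<kappa> x) \<le> B" using \<kappa>_bounded by blast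
  then show ?thesis by (intro integrable_scaled[where B = B]) auto
qed

lemma conv_has_derivative:
  "(conv \<psi> has_derivative (\<lambda>h. - (\<integral>y. (K (y - x) \<bullet> h) *\<^sub>R \<psi> y \<partial>lborel))) (at x)"
  unfolding has_derivative_at_alt
proof (intro conjI allI impI)
  have "linear (\<lambda>h. - (\<integral>y. (K (y - x) \<bullet> h) *\<^sub>R \<psi> y \<partial>lborel))"
  proof (rule linearI)
    fix h k :: 'a and c :: real
    have "(\<integral>y. (K (y - x) \<bullet> (h + k)) *\<^sub>R \<psi> y \<partial>lborel)
        = (\<integral>y. (K (y - x) \<bullet> h) *\<^sub>R \<psi> y + (K (y - x) \<bullet> k) *\<^sub>R \<psi> y \<partial>lborel)"
      by (simp add: inner_add_right scaleR_add_left)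
    then show "- (\<integral>y. (K (y - x) \<bullet> (h + k)) *\<^sub>R \<psi> y \<partial>lborel) = - (\<integral>y. (K (y - x) \<bullet> h) *\<^sub>R \<psi> y \<partial>lborel)
       + - (\<integral>y. (K (y - x) \<bullet> k) *\<^sub>R \<psi> y \<partial>lborel)"
      using integrable_K_scaled by simp
    have "(\<integral>y. (K (y - x) \<bullet> (c *\<^sub>R h)) *\<^sub>R \<psi> y \<partial>lborel) = (\<integral>y. c *\<^sub>R ((K (y - x) \<bullet> h) *\<^sub>R \<psi> y) \<partial>lborel)"
      by simp
    then show "- (\<integral>y. (K (y - x) \<bullet> (c *\<^sub>R h)) *\<^sub>R \<psi> y \<partial>lborel) = c *\<^sub>R (- (\<integral>y. (K (y - x) \<bullet> h) *\<^sub>R \<psi> y \<partial>lborel))"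
      by (simp only: integral_scaleR_right scaleR_minus_right)
  qed
  then show "bounded_linear (\<lambda>h. - (\<integral>y. (K (y - x) \<bullet> h) *\<^sub>R \<psi> y \<partial>lborel))"
    by (rule linear_conv_bounded_linear[THEN iffD1])
  fix e :: real assume e: "e > 0"
  define C where "C = measure lborel (cball (0::'a) R)"
  have C0: "C \<ge> 0" by (simp add: C_def)
  define \<eta> where "\<eta> = e / (C + 1)"
  have \<eta>: "\<eta> > 0" "\<eta> * C \<le> e" using e C0 by (auto simp: \<eta>_def divide_simps)
  obtain d where d: "d > 0" "\<And>x y. norm (x - y) < d \<Longrightarrow> norm (K x - K y) < \<eta>"
    using K_uniformly_continuous[OF \<eta>(1)] by blast
  show "\<exists>d>0. \<forall>y. norm (y - x) < d \<longrightarrow>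
    norm (conv \<psi> y - conv \<psi> x - - (\<integral>ya. (K (ya - x) \<bullet> (y - x)) *\<^sub>R \<psi> ya \<partial>lborel)) \<le> e * norm (y - x)"
  proof (intro exI[of _ d] conjI allI impI d(1))
    fix x' assume x': "norm (x' - x) < d"
    have lin: "\<bar>\<kappa> (y - x') - \<kappa> (y - x) + K (y - x) \<bullet> (x' - x)\<bar> \<le> \<eta> * norm (x' - x)" for y
    proof -
      have "\<bar>\<kappa> ((y - x) + (x - x')) - \<kappa> (y - x) - K (y - x) \<bullet> (x - x')\<bar> \<le> \<eta> * norm (x - x')"
        by (rule \<kappa>_linearization[where d = d]) (use d(2) x' in \<open>auto simp: norm_minus_commute\<close>)
      then show ?thesis by (simp add: norm_minus_commute inner_diff_right algebra_simps)
    qed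
    have "conv \<psi> x' - conv \<psi> x - - (\<integral>y. (K (y - x) \<bullet> (x' - x)) *\<^sub>R \<psi> y \<partial>lborel)
      = (\<integral>y. (\<kappa> (y - x') - \<kappa> (y - x) + K (y - x) \<bullet> (x' - x)) *\<^sub>R \<psi> y \<partial>lborel)"
      unfolding conv_def using integrable_K_scaled integrable_\<kappa>_scaled
      by (simp add: scaleR_add_left scaleR_diff_left)
    also have "norm \<dots> \<le> (\<eta> * norm (x' - x)) * C"
      unfolding C_def by (rule norm_integral_scaled_le) (use lin in auto)
    also have "\<dots> \<le> e * norm (x' - x)" using mult_right_mono[OF \<eta>(2), of "norm (x' - x)"] by (simp add: mult_ac)
    finally show "norm (conv \<psi> x' - conv \<psi> x - - (\<integral>y. (K (y - x) \<bullet> (x' - x)) *\<^sub>R \<psi> y \<partial>lborel)) \<le> e * norm (x' - x)" .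
  qed
qed

lemma conv_derivative_continuous:
  "continuous_on UNIV (\<lambda>x. - (\<integral>y. (K (y - x) \<bullet> h) *\<^sub>R \<psi> y \<partial>lborel))"
proof (rule continuous_on_minus, unfold continuous_on_iff, intro ballI allI impI)
  fix x :: 'a and e :: real assume e: "e > 0"
  define C where "C = measure lborel (cball (0::'a) R)"
  have C0: "C \<ge> 0" by (simp add: C_def)
  define \<eta> where "\<eta> = e / (C * norm h + 1)"
  have p: "C * norm h + 1 > 0" using C0 by (simp add: add_nonneg_pos)
  have \<eta>: "\<eta> > 0" "\<eta> * norm h * C < e" using e C0 p by (auto simp: \<eta>_def divide_simps algebra_simps)
  obtain d where d: "d > 0" "\<And>x y. norm (x - y) < d \<Longrightarrow> norm (K x - K y) < \<eta>"
    using K_uniformly_continuous[OF \<eta>(1)] by blast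
  show "\<exists>d>0. \<forall>x'\<in>UNIV. dist x' x < d \<longrightarrow>
     dist (\<integral>y. (K (y - x') \<bullet> h) *\<^sub>R \<psi> y \<partial>lborel) (\<integral>y. (K (y - x) \<bullet> h) *\<^sub>R \<psi> y \<partial>lborel) < e"
  proof (intro exI[of _ d] conjI ballI impI d(1))
    fix x' :: 'a assume x': "dist x' x < d"
    have b: "\<bar>K (y - x') \<bullet> h - K (y - x) \<bullet> h\<bar> \<le> \<eta> * norm h" for y
    proof -
      have "norm (K (y - x') - K (y - x)) < \<eta>"
        by (rule d(2)) (use x' in \<open>simp add: dist_norm norm_minus_commute\<close>)
      then have "norm (K (y - x') - K (y - x)) * norm h \<le> \<eta> * norm h" by (intro mult_right_mono) auto
      then show ?thesis using Cauchy_Schwarz_ineq2[of "K (y - x') - K (y - x)" h] by (simp add: inner_diff_left)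
    qed
    have "(\<integral>y. (K (y - x') \<bullet> h) *\<^sub>R \<psi> y \<partial>lborel) - (\<integral>y. (K (y - x) \<bullet> h) *\<^sub>R \<psi> y \<partial>lborel)
       = (\<integral>y. (K (y - x') \<bullet> h - K (y - x) \<bullet> h) *\<^sub>R \<psi> y \<partial>lborel)"
      using integrable_K_scaled by (simp add: scaleR_diff_left)
    also have "norm \<dots> \<le> \<eta> * norm h * C"
      unfolding C_def by (rule norm_integral_scaled_le) (use b in auto)
    finally show "dist (\<integral>y. (K (y - x') \<bullet> h) *\<^sub>R \<psi> y \<partial>lborel) (\<integral>y. (K (y - x) \<bullet> h) *\<^sub>R \<psi> y \<partial>lborel) < e"
      unfolding dist_norm using \<eta>(2) by linarith
  qed
qed

lemma conv_support: "x \<notin> cball 0 (R + \<delta>) \<Longrightarrow> conv \<psi> x = 0"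
proof -
  assume x: "x \<notin> cball 0 (R + \<delta>)"
  have z: "\<kappa> (y - x) *\<^sub>R \<psi> y = 0" for y
  proof (cases "y \<in> cball 0 R")
    case True
    have "norm x \<le> norm (y - x) + norm y" using norm_triangle_sub[of x y] by (simp add: norm_minus_commute add.commute)
    then have "y - x \<notin> cball 0 \<delta>" using True x by (auto simp: not_le)
    then show ?thesis using support by simp
  qed (use \<psi>R in simp)
  then show ?thesis unfolding conv_def z by simp
qed

end

lemma integrable_\<kappa>: "integrable lborel \<kappa>"
  by (rule ccontr) (use not_integrable_integral_eq[of lborel \<kappa>] integral_1 in auto)

lemma integral_\<kappa>_shift: "(\<integral>y. \<kappa> (y - x) \<partial>lborel) = 1" "integrable lborel (\<lambda>y. \<kappa> (y - x))"
proof -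
  show 1: "(\<integral>y. \<kappa> (y - x) \<partial>lborel) = 1"
    using lborel_integral_translate[of \<kappa> "- x"] integral_1 by simp
  show "integrable lborel (\<lambda>y. \<kappa> (y - x))"
    by (rule ccontr) (use not_integrable_integral_eq[of lborel "\<lambda>y. \<kappa> (y - x)"] 1 in auto)
qed

lemma conv_norm_le:
  assumes "\<And>x. norm (\<psi> x) \<le> 1"
  shows "norm (conv \<psi> x) \<le> 1"
proof -
  have "norm (conv \<psi> x) \<le> (\<integral>y. \<kappa> (y - x) \<partial>lborel)"
  proof (cases "integrable lborel (\<lambda>y. \<kappa> (y - x) *\<^sub>R \<psi> y)")
    case True
    then show ?thesis unfolding conv_def
      using assms nonneg mult_left_mono[OF assms nonneg]
      by (intro Bochner_Integration.integral_norm_bound_integral integral_\<kappa>_shift) auto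
  next
    \<comment> \<open>The Bochner integral of a non-integrable function is 0, so the bound still
      holds.\<close>
    case False
    then show ?thesis by (simp add: conv_def not_integrable_integral_eq integral_\<kappa>_shift)
  qed
  then show ?thesis by (simp add: integral_\<kappa>_shift)
qed

lemma conv_admissible:
  fixes \<psi> :: "'a \<Rightarrow> 'a"
  assumes \<psi>: "\<psi> \<in> borel_measurable borel" "\<And>x. norm (\<psi> x) \<le> 1" "\<And>x. x \<notin> cball 0 R \<Longrightarrow> \<psi> x = 0"
  shows "conv \<psi> \<in> admissible_fields"
    and "divergence (conv \<psi>) x = - (\<integral>y. K (y - x) \<bullet> \<psi> y \<partial>lborel)"
proof -
  have fd: "frechet_derivative (conv \<psi>) (at x) = (\<lambda>h. - (\<integral>y. (K (y - x) \<bullet> h) *\<^sub>R \<psi> y \<partial>lborel))" for x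
    by (rule frechet_derivative_at[symmetric, OF conv_has_derivative[OF \<psi>]])
  have "{x. conv \<psi> x \<noteq> 0} \<subseteq> cball 0 (R + \<delta>)" using conv_support[OF \<psi>] by blast
  then have "compact (closure {x. conv \<psi> x \<noteq> 0})"
    by (meson bounded_cball bounded_subset compact_closure)
  moreover have "Ck_on 1 UNIV (conv \<psi>)"
    unfolding One_nat_def Ck_on.simps fd
    using conv_has_derivative[OF \<psi>] conv_derivative_continuous[OF \<psi>] by (auto simp: differentiable_def)
  ultimately show "conv \<psi> \<in> admissible_fields"
    unfolding admissible_fields_def using conv_norm_le[OF \<psi>(2)] by auto
  have "divergence (conv \<psi>) x = (\<Sum>b\<in>Basis. - (\<integral>y. (K (y - x) \<bullet> b) * (\<psi> y \<bullet> b) \<partial>lborel))"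
    unfolding divergence_def fd
  proof (intro sum.cong refl)
    fix b :: 'a
    have "(\<integral>y. ((K (y - x) \<bullet> b) *\<^sub>R \<psi> y) \<bullet> b \<partial>lborel) = (\<integral>y. (K (y - x) \<bullet> b) *\<^sub>R \<psi> y \<partial>lborel) \<bullet> b"
      by (rule integral_inner_left) (rule integrable_K_scaled[OF \<psi>])
    then show "(- (\<integral>y. (K (y - x) \<bullet> b) *\<^sub>R \<psi> y \<partial>lborel)) \<bullet> b = - (\<integral>y. (K (y - x) \<bullet> b) * (\<psi> y \<bullet> b) \<partial>lborel)"
      by simp
  qed
  also have "\<dots> = - (\<integral>y. (\<Sum>b\<in>Basis. (K (y - x) \<bullet> b) * (\<psi> y \<bullet> b)) \<partial>lborel)"
    unfolding sum_negf
    by (subst Bochner_Integration.integral_sum)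
       (use integrable_inner_left[OF integrable_K_scaled[OF \<psi>]] in auto)
  also have "\<dots> = - (\<integral>y. K (y - x) \<bullet> \<psi> y \<partial>lborel)"
    by (subst euclidean_inner) (rule refl)
  finally show "divergence (conv \<psi>) x = - (\<integral>y. K (y - x) \<bullet> \<psi> y \<partial>lborel)" .
qed

end

text \<open>Regularity of the measure gives a compact \<open>C\<close> inside \<open>E\<close> and
  an open \<open>V\<close> around \<open>E\<close>. For shifts shorter than the distance from
  \<open>C\<close> to the complement of \<open>V\<close>, a point that changes membership lies in
  \<open>V - E\<close>, in \<open>E - C\<close>, or in a translate of one of them; each has measure
  at most \<open>e / 4\<close>.\<close>

lemma translate_symmetric_difference_small:
  fixes E :: "'a::euclidean_space set"
  assumes E: "E \<in> sets borel" and e: "e > 0" and bd: "bounded E"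
  obtains d where "d > 0" "\<And>h. norm h < d \<Longrightarrow> emeasure lborel {x. (x + h \<in> E) \<noteq> (x \<in> E)} \<le> ennreal e"
proof -
  have EL: "E \<in> sets lebesgue" using E by auto
  have e4: "e / 4 > 0" using e by simp
  obtain V where V: "open V" "E \<subseteq> V" "emeasure lebesgue (V - E) < ennreal (e / 4)"
    using sets_lebesgue_outer_open[OF EL e4] by metis
  obtain C where C: "closed C" "C \<subseteq> E" "emeasure lebesgue (E - C) < ennreal (e / 4)"
    using sets_lebesgue_inner_closed[OF EL e4] by metis
  have Vm: "emeasure lborel (V - E) \<le> ennreal (e / 4)" and Cm: "emeasure lborel (E - C) \<le> ennreal (e / 4)"
    using V C E by (auto simp: less_imp_le)
  have cC: "compact C" using C(1,2) bd by (meson bounded_subset compact_eq_bounded_closed)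
  obtain d where d: "d > 0" "\<And>x. x \<in> C \<Longrightarrow> ball x d \<subseteq> V"
  proof (cases "C = {}")
    case True then show ?thesis using that[of 1] by auto
  next
    case False
    have "C \<inter> - V = {}" using C V by auto
    from separate_compact_closed[OF cC _ this] V(1)
    obtain d where "d > 0" "\<forall>x\<in>C. \<forall>y\<in>- V. d \<le> dist x y" by auto
    then show ?thesis by (intro that[of d]) force+
  qed
  have main: "emeasure lborel {x. (x + h \<in> E) \<noteq> (x \<in> E)} \<le> ennreal e" if h: "norm h < d" for h
  proof -
    have tr: "emeasure lborel {x. x + h \<in> A} = emeasure lborel A" if "A \<in> sets borel" for A
    proof -
      have "{x. x + h \<in> A} = (\<lambda>x. x + (-h)) ` A" by (auto simp: image_iff intro!: bexI[of _ "_ + h"])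
      then show ?thesis using emeasure_lborel_translate[OF that, of "-h"] by metis
    qed
    have sb: "{x. (x + h \<in> E) \<noteq> (x \<in> E)} \<subseteq> ({x. x + h \<in> E - C} \<union> (V - E)) \<union> ((E - C) \<union> {x. x + h \<in> V - E})"
    proof
      fix x assume x: "x \<in> {x. (x + h \<in> E) \<noteq> (x \<in> E)}"
      show "x \<in> ({x. x + h \<in> E - C} \<union> (V - E)) \<union> ((E - C) \<union> {x. x + h \<in> V - E})"
      proof (cases "x \<in> E")
        case True
        then have "x \<in> C \<Longrightarrow> x + h \<in> V" using d(2)[of x] h by (auto simp: dist_norm)
        then show ?thesis using True x by auto
      next
        case False
        then have "x + h \<in> C \<Longrightarrow> x \<in> V" using d(2)[of "x + h"] h by (auto simp: dist_norm)
        then show ?thesis using False x by auto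
      qed
    qed
    have mb: "E - C \<in> sets borel" "V - E \<in> sets borel" using E C V by auto
    have mb2: "{x. x + h \<in> A} \<in> sets lborel" if [measurable]: "A \<in> sets borel" for A by measurable
    define A1 A2 B1 B2 where "A1 = {x. x + h \<in> E - C}" and "A2 = V - E" and "B1 = E - C" and "B2 = {x. x + h \<in> V - E}"
    have mbs [simp]: "A1 \<in> sets borel" "A2 \<in> sets borel" "B1 \<in> sets borel" "B2 \<in> sets borel"
      using mb mb2[OF mb(1)] mb2[OF mb(2)] by (simp_all only: A1_def A2_def B1_def B2_def sets_lborel)
    have "emeasure lborel {x. (x + h \<in> E) \<noteq> (x \<in> E)} \<le> emeasure lborel ((A1 \<union> A2) \<union> (B1 \<union> B2))"
      by (rule emeasure_mono[OF sb[folded A1_def A2_def B1_def B2_def]]) (simp add: sets.Un)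
    also have "\<dots> \<le> (emeasure lborel A1 + emeasure lborel A2) + (emeasure lborel B1 + emeasure lborel B2)"
      by (intro order_trans[OF emeasure_subadditive] add_mono) auto
    also have "\<dots> \<le> (ennreal (e / 4) + ennreal (e / 4)) + (ennreal (e / 4) + ennreal (e / 4))"
      unfolding A1_def A2_def B1_def B2_def tr[OF mb(1)] tr[OF mb(2)] using Vm Cm by (intro add_mono)
    also have "\<dots> = ennreal e" using e by (simp add: ennreal_plus[symmetric] del: ennreal_plus)
    finally show ?thesis .
  qed
  show ?thesis using that[OF d(1) main] .
qed

context mollifier
begin

context
  fixes E :: "'a set" and R :: real
  assumes E [measurable]: "E \<in> sets borel" and ER: "E \<subseteq> cball 0 R"
begin

definition mollified_gradient :: "'a \<Rightarrow> 'a" where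
  "mollified_gradient x = - (\<integral>y. indicator E y *\<^sub>R K (y - x) \<partial>lborel)"

private lemma ind: "(indicator E :: 'a \<Rightarrow> real) \<in> borel_measurable borel"
    "\<And>x. norm (indicator E x :: real) \<le> 1" "\<And>x. x \<notin> cball 0 R \<Longrightarrow> indicator E x = (0::real)"
  using ER by (auto simp: indicator_def)

private lemma intK: "integrable lborel (\<lambda>y. indicator E y *\<^sub>R K (y - x))"
proof -
  obtain B where "B \<ge> 0" "\<And>x. norm (K x) \<le> B" using K_bounded by blast
  then show ?thesis
    by (intro integrable_bounded_support[where B = B and R = R]) (use ER in \<open>auto simp: indicator_def\<close>)
qed

lemma C1_grad_mollified: "C1_grad (conv (indicator E)) mollified_gradient"
proof -
  have eq: "mollified_gradient x \<bullet> h = - (\<integral>y. (K (y - x) \<bullet> h) *\<^sub>R indicator E y \<partial>lborel)" for x h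
    unfolding mollified_gradient_def using intK
    by (simp add: integral_inner_left[symmetric] mult.commute del: integral_inner_left)
  have "continuous_on UNIV (\<lambda>x. mollified_gradient x \<bullet> h)" for h
    unfolding eq by (rule conv_derivative_continuous[OF ind])
  then have "continuous_on UNIV mollified_gradient"
    by (subst continuous_on_componentwise) auto
  with conv_has_derivative[OF ind] show ?thesis
    unfolding C1_grad_def eq by blast
qed

lemma mollified_range: "(0::real) \<le> conv (indicator E) x" "conv (indicator E) x \<le> (1::real)"
proof -
  show "(0::real) \<le> conv (indicator E) x" unfolding conv_def using nonneg by (intro integral_nonneg_AE) auto
  show "conv (indicator E) x \<le> (1::real)" using conv_norm_le[where \<psi> = "indicator E :: 'a \<Rightarrow> real" and x = x] ind(2) by simp
qed

lemma mollified_support: "x \<notin> cball 0 (R + \<delta>) \<Longrightarrow> conv (indicator E) x = (0::real)"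
  by (rule conv_support[OF ind])

lemma mollified_gradient_support: "x \<notin> cball 0 (R + \<delta>) \<Longrightarrow> mollified_gradient x = 0"
  using derivative_zero_outside[OF C1_grad_has_derivative[OF C1_grad_mollified] mollified_support]
  by (metis inner_eq_zero_iff)

lemma integrable_mollified_gradient: "integrable lborel (\<lambda>x. norm (mollified_gradient x))"
proof -
  note c = C1_grad_continuous_grad[OF C1_grad_mollified]
  obtain B where "\<And>x. norm (mollified_gradient x) \<le> B"
    using continuous_bounded_support[OF c mollified_gradient_support] by blast
  then show ?thesis
    by (intro integrable_bounded_support[where B = B and R = "R + \<delta>"])
       (auto simp: mollified_gradient_support intro!: borel_measurable_continuous_onI continuous_intros c)
qed

text \<open>Duality: testing the perimeter of \<^term>\<open>E\<close> with the mollification of the normalised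
  gradient field gives the total variation of the mollified indicator.\<close>

lemma total_variation_mollified_le:
  assumes "per_bound E a"
  shows "(\<integral>x. norm (mollified_gradient x) \<partial>lborel) \<le> a"
proof -
  let ?G = mollified_gradient
  have mG[measurable]: "?G \<in> borel_measurable borel" by (rule C1_grad_measurable[OF C1_grad_mollified])
  \<comment> \<open>The minus sign cancels the one in the divergence of a convolution, so that
    testing \<open>E\<close> with \<open>conv \<psi>\<close> returns the total variation with a plus
    sign.\<close>
  define \<psi> where "\<psi> x = - sgn (?G x)" for x
  have m\<psi>[measurable]: "\<psi> \<in> borel_measurable borel" unfolding \<psi>_def[abs_def] sgn_div_norm by measurable
  have \<psi>: "\<psi> \<in> borel_measurable borel" "\<And>x. norm (\<psi> x) \<le> 1" "\<And>x. x \<notin> cball 0 (R + \<delta>) \<Longrightarrow> \<psi> x = 0"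
    using mollified_gradient_support by (auto simp: \<psi>_def norm_sgn)
  obtain B where B: "B \<ge> 0" "\<And>x. norm (K x) \<le> B" using K_bounded by blast
  have fub: "integrable (lborel \<Otimes>\<^sub>M lborel) (\<lambda>(x, y). indicator E x * (K (y - x) \<bullet> \<psi> y))"
    unfolding lborel_prod
  proof (rule integrable_bounded_support[where B = B and R = "\<bar>R\<bar> + \<bar>R + \<delta>\<bar>"])
    show "(\<lambda>(x, y). indicator E x * (K (y - x) \<bullet> \<psi> y)) \<in> borel_measurable borel"
      unfolding borel_prod[symmetric] by measurable
    fix z :: "'a \<times> 'a"
    obtain x y where z: "z = (x, y)" by (cases z)
    have "\<bar>K (y - x) \<bullet> \<psi> y\<bar> \<le> B * 1"
      using Cauchy_Schwarz_ineq2[of "K (y - x)" "\<psi> y"] mult_mono[OF B(2)[of "y - x"] \<psi>(2)[of y]] B(1) by simp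
    then show "norm (case z of (x, y) \<Rightarrow> indicator E x * (K (y - x) \<bullet> \<psi> y)) \<le> B"
      using B(1) by (simp add: z indicator_def)
    assume "z \<notin> cball 0 (\<bar>R\<bar> + \<bar>R + \<delta>\<bar>)"
    then have "norm x + norm y > \<bar>R\<bar> + \<bar>R + \<delta>\<bar>" using norm_Pair_le[of x y] by (simp add: z)
    then have "x \<notin> cball 0 R \<or> y \<notin> cball 0 (R + \<delta>)" by auto
    then show "(case z of (x, y) \<Rightarrow> indicator E x * (K (y - x) \<bullet> \<psi> y)) = 0"
      using ER \<psi>(3) by (auto simp: z indicator_def)
  qed
  have inner: "(\<integral>x. indicator E x * (K (y - x) \<bullet> \<psi> y) \<partial>lborel) = - norm (?G y)" for y
  proof -
    \<comment> \<open>Oddness replaces \<open>K (y - x)\<close> by \<open>- K (x - y)\<close>, the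
      kernel in the mollified gradient at \<open>y\<close>.\<close>
    have "(\<integral>x. indicator E x * (K (y - x) \<bullet> \<psi> y) \<partial>lborel) = (\<integral>x. - ((indicator E x *\<^sub>R K (x - y)) \<bullet> \<psi> y) \<partial>lborel)"
      using odd[of "x - y" for x] by (intro Bochner_Integration.integral_cong) auto
    also have "\<dots> = ?G y \<bullet> \<psi> y"
      unfolding mollified_gradient_def
      using integral_inner_left[where c = "\<psi> y", OF intK[of y]] by (simp del: integral_inner_left)
    also have "\<dots> = - norm (?G y)"
      by (simp add: \<psi>_def sgn_div_norm dot_square_norm power2_eq_square field_simps)
    finally show ?thesis .
  qed
  have "(\<integral>x. norm (?G x) \<partial>lborel) = - (\<integral>y. (\<integral>x. indicator E x * (K (y - x) \<bullet> \<psi> y) \<partial>lborel) \<partial>lborel)"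
    unfolding inner by simp
  also have "\<dots> = - (\<integral>x. (\<integral>y. indicator E x * (K (y - x) \<bullet> \<psi> y) \<partial>lborel) \<partial>lborel)"
    using lborel_pair.Fubini_integral[OF fub] by simp
  also have "\<dots> = (\<integral>x. indicator E x * divergence (conv \<psi>) x \<partial>lborel)"
  proof -
    have "divergence (conv \<psi>) x = - (\<integral>y. K (y - x) \<bullet> \<psi> y \<partial>lborel)" for x
      by (rule conv_admissible(2)[OF \<psi>])
    then show ?thesis by simp
  qed
  also have "\<dots> \<le> a"
    using assms conv_admissible(1)[OF \<psi>] unfolding per_bound_def by blast
  finally show ?thesis .
qed

text \<open>The mollification is a \<open>\<kappa>\<close>-weighted average of translates, so its
  distance from the indicator is at most the same average of symmetric differences; Tonelli
  integrates these one shift at a time.\<close>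

lemma mollified_L1_distance:
  assumes "\<And>h. norm h \<le> \<delta> \<Longrightarrow> emeasure lborel {x. (x + h \<in> E) \<noteq> (x \<in> E)} \<le> ennreal e" "e \<ge> 0"
  shows "(\<integral>\<^sup>+x. ennreal \<bar>conv (indicator E) x - indicator E x\<bar> \<partial>lborel) \<le> ennreal e"
proof -
  let ?D = "\<lambda>h. {x. (x + h \<in> E) \<noteq> (x \<in> E)}"
  have [measurable]: "?D h \<in> sets borel" for h
  proof -
    have "Measurable.pred borel (\<lambda>x. (x + h \<in> E) \<noteq> (x \<in> E))" by measurable
    then show ?thesis by simp
  qed
  have 1: "ennreal \<bar>conv (indicator E) x - indicator E x\<bar> \<le> (\<integral>\<^sup>+h. ennreal (\<kappa> h) * indicator (?D h) x \<partial>lborel)" for x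
  proof -
    have [measurable]: "(\<lambda>h. \<kappa> h * indicator E (h + x)) \<in> borel_measurable borel" by measurable
    have i: "integrable lborel (\<lambda>h. \<kappa> h * indicator E (h + x))"
      by (rule Bochner_Integration.integrable_bound[OF integrable_\<kappa>])
         (use nonneg in \<open>auto simp: indicator_def\<close>)
    have i2: "integrable lborel (\<lambda>h. \<kappa> h * indicator E x)" using integrable_\<kappa> by simp
    have "conv (indicator E) x = (\<integral>h. \<kappa> h * indicator E (h + x) \<partial>lborel)"
      unfolding conv_def using lborel_integral_translate[of "\<lambda>y. \<kappa> (y - x) * indicator E y" x] by simp
    then have "conv (indicator E) x - indicator E x = (\<integral>h. \<kappa> h * indicator E (h + x) - \<kappa> h * indicator E x \<partial>lborel)"
      using i i2 integral_1 by simp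
    then have "ennreal \<bar>conv (indicator E) x - indicator E x\<bar>
       \<le> (\<integral>\<^sup>+h. ennreal (norm (\<kappa> h * indicator E (h + x) - \<kappa> h * indicator E x)) \<partial>lborel)"
      using integral_norm_bound_ennreal[OF Bochner_Integration.integrable_diff[OF i i2]] by simp
    also have "\<dots> = (\<integral>\<^sup>+h. ennreal (\<kappa> h) * indicator (?D h) x \<partial>lborel)"
      using nonneg by (intro nn_integral_cong) (auto simp: indicator_def add.commute)
    finally show ?thesis .
  qed
  have "(\<integral>\<^sup>+x. ennreal \<bar>conv (indicator E) x - indicator E x\<bar> \<partial>lborel)
     \<le> (\<integral>\<^sup>+x. \<integral>\<^sup>+h. ennreal (\<kappa> h) * indicator (?D h) x \<partial>lborel \<partial>lborel)"
    by (intro nn_integral_mono 1)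
  also have "\<dots> = (\<integral>\<^sup>+h. \<integral>\<^sup>+x. ennreal (\<kappa> h) * indicator (?D h) x \<partial>lborel \<partial>lborel)"
  proof (rule lborel_pair.Fubini')
    have "(\<lambda>(h, x). ennreal (\<kappa> h) * indicator (?D h) x) = (\<lambda>z. ennreal (\<kappa> (fst z)) * (if (snd z + fst z \<in> E) \<noteq> (snd z \<in> E) then 1 else 0))"
      by (auto simp: indicator_def fun_eq_iff)
    then show "(\<lambda>(h, x). ennreal (\<kappa> h) * indicator (?D h) x) \<in> borel_measurable (lborel \<Otimes>\<^sub>M lborel)"
      by simp
  qed
  also have "\<dots> = (\<integral>\<^sup>+h. ennreal (\<kappa> h) * emeasure lborel (?D h) \<partial>lborel)"
    by (simp add: nn_integral_cmult)
  also have "\<dots> \<le> (\<integral>\<^sup>+h. ennreal (\<kappa> h) * ennreal e \<partial>lborel)"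
  proof (intro nn_integral_mono)
    fix h :: 'a
    show "ennreal (\<kappa> h) * emeasure lborel (?D h) \<le> ennreal (\<kappa> h) * ennreal e"
    proof (cases "norm h \<le> \<delta>")
      case True then show ?thesis using assms(1) by (intro mult_left_mono) auto
    next
      case False then show ?thesis using support[of h] by simp
    qed
  qed
  also have "\<dots> = ennreal e"
    using nn_integral_eq_integral[OF integrable_\<kappa>] nonneg integral_1
    by (simp add: nn_integral_multc)
  finally show ?thesis .
qed

end

end

text \<open>Set operations on \<open>E\<close> become algebra on \<open>u\<close>, where gradients
  can be estimated pointwise. As the total variation stays below the same \<open>a\<close> for every
  \<open>e\<close>, nothing is lost when \<open>e\<close> tends to 0.\<close>

lemma smooth_approximation:
  fixes E :: "'a::euclidean_space set"
  assumes E: "E \<in> sets borel" "bounded E" and a: "per_bound E a" and e: "e > 0"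
  obtains u G R where "C1_grad u G" "\<And>x. 0 \<le> u x" "\<And>x. u x \<le> (1::real)"
    "integrable lborel (\<lambda>x. norm (G x))" "(\<integral>x. norm (G x) \<partial>lborel) \<le> a"
    "integrable lborel (\<lambda>x. \<bar>u x - indicator E x\<bar>)" "(\<integral>x. \<bar>u x - indicator E x\<bar> \<partial>lborel) \<le> e"
    "\<And>x. x \<notin> cball 0 R \<Longrightarrow> u x = 0"
proof -
  obtain d where d: "d > 0" "\<And>h. norm h < d \<Longrightarrow> emeasure lborel {x. (x + h \<in> E) \<noteq> (x \<in> E)} \<le> ennreal e"
    using translate_symmetric_difference_small[OF E(1) e E(2)] by blast
  obtain \<kappa> and K :: "'a \<Rightarrow> 'a" where "mollifier \<kappa> K (d / 2)" using mollifier_exists[of "d / 2"] d(1) by auto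
  then interpret mollifier \<kappa> K "d / 2" .
  obtain R where R: "E \<subseteq> cball 0 R" using E(2) by (auto simp: bounded_iff subset_iff)
  note ER = E(1) R
  let ?u = "conv (indicator E) :: 'a \<Rightarrow> real"
  have C: "C1_grad ?u (mollified_gradient E)" by (rule C1_grad_mollified[OF ER])
  have m[measurable]: "(\<lambda>x. \<bar>?u x - indicator E x\<bar>) \<in> borel_measurable borel"
    using C1_grad_measurable(1)[OF C] E(1) by measurable
  have nn: "(\<integral>\<^sup>+x. ennreal \<bar>?u x - indicator E x\<bar> \<partial>lborel) \<le> ennreal e"
    by (rule mollified_L1_distance[OF ER]) (use d e in auto)
  have i: "integrable lborel (\<lambda>x. \<bar>?u x - indicator E x\<bar>)"
    by (rule integrableI_bounded) (use nn in \<open>auto simp: top.not_eq_extremum le_less_trans\<close>)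
  have "(\<integral>x. \<bar>?u x - indicator E x\<bar> \<partial>lborel) \<le> e"
    using nn e nn_integral_eq_integral[OF i] by simp
  then show ?thesis
    using that[OF C _ _ integrable_mollified_gradient[OF ER] total_variation_mollified_le[OF ER a] i]
      mollified_range[OF ER] mollified_support[OF ER] by blast
qed

section \<open>Set operations, level sets and Minkowski content\<close>

lemma C1_grad_mult:
  assumes "C1_grad u G" "C1_grad v H"
  shows "C1_grad (\<lambda>x. u x * v x) (\<lambda>x. u x *\<^sub>R H x + v x *\<^sub>R G x)"
  unfolding C1_grad_def
proof (intro conjI allI)
  fix x
  show "((\<lambda>x. u x * v x) has_derivative (\<lambda>h. (u x *\<^sub>R H x + v x *\<^sub>R G x) \<bullet> h)) (at x)"
    by (rule has_derivative_eq_rhs[OF has_derivative_mult[OF C1_grad_has_derivative[OF assms(1)] C1_grad_has_derivative[OF assms(2)]]])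
       (auto simp: inner_add_left mult.commute)
  show "continuous_on UNIV (\<lambda>x. u x *\<^sub>R H x + v x *\<^sub>R G x)"
    using assms[THEN C1_grad_continuous] assms[THEN C1_grad_continuous_grad]
    by (intro continuous_intros)
qed

lemma C1_grad_diff:
  assumes "C1_grad u G" "C1_grad v H"
  shows "C1_grad (\<lambda>x. u x - v x) (\<lambda>x. G x - H x)"
  using assms unfolding C1_grad_def
  by (auto intro!: derivative_eq_intros continuous_intros simp: inner_diff_left)

lemma C1_grad_add:
  assumes "C1_grad u G" "C1_grad v H"
  shows "C1_grad (\<lambda>x. u x + v x) (\<lambda>x. G x + H x)"
  using assms unfolding C1_grad_def
  by (auto intro!: derivative_eq_intros continuous_intros simp: inner_add_left)

lemma integral_divergence_le:
  assumes \<phi>: "\<phi> \<in> admissible_fields" and w: "C1_grad w W" and f: "integrable lborel f" "\<And>x. norm (W x) \<le> f x"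
  shows "(\<integral>x. w x * divergence \<phi> x \<partial>lborel) \<le> (\<integral>x. f x \<partial>lborel)"
proof -
  have "(\<integral>x. w x * divergence \<phi> x \<partial>lborel) = (\<integral>x. - (W x \<bullet> \<phi> x) \<partial>lborel)"
    using integral_by_parts_divergence[OF \<phi> w] by simp
  also have "\<dots> \<le> (\<integral>x. f x \<partial>lborel)"
  proof (rule integral_mono)
    fix x
    have "\<bar>W x \<bullet> \<phi> x\<bar> \<le> norm (W x) * norm (\<phi> x)" by (rule Cauchy_Schwarz_ineq2)
    also have "\<dots> \<le> norm (W x) * 1" using admissible_norm[OF \<phi>] by (intro mult_left_mono) auto
    finally show "- (W x \<bullet> \<phi> x) \<le> f x" using f(2)[of x] by linarith
  qed (use f integral_by_parts_divergence(2)[OF \<phi> w] in auto)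
  finally show ?thesis .
qed

text \<open>Quantitative lower semicontinuity: for a fixed field the tested integral depends on the
  function in a Lipschitz way with respect to L1, and the constant is the bound \<open>M\<close> of
  the divergence.\<close>

lemma integral_divergence_perturb:
  assumes \<phi>: "\<phi> \<in> admissible_fields" and M: "\<And>x. \<bar>divergence \<phi> x\<bar> \<le> M"
    and w: "w \<in> borel_measurable borel" "\<And>x. \<bar>w x\<bar> \<le> B"
    and g: "g \<in> borel_measurable borel" "\<And>x. \<bar>g x\<bar> \<le> (B::real)"
    and f: "integrable lborel f" "\<And>x. \<bar>w x - g x\<bar> \<le> f x"
  shows "(\<integral>x. g x * divergence \<phi> x \<partial>lborel) \<le> (\<integral>x. w x * divergence \<phi> x \<partial>lborel) + M * (\<integral>x. f x \<partial>lborel)"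
proof -
  note iw = integrable_mult_divergence[OF \<phi> w] and ig = integrable_mult_divergence[OF \<phi> g]
  have "(\<integral>x. g x * divergence \<phi> x \<partial>lborel) - (\<integral>x. w x * divergence \<phi> x \<partial>lborel)
     = (\<integral>x. g x * divergence \<phi> x - w x * divergence \<phi> x \<partial>lborel)"
    using iw ig by simp
  also have "\<dots> \<le> (\<integral>x. M * f x \<partial>lborel)"
  proof (rule integral_mono)
    fix x
    have "g x * divergence \<phi> x - w x * divergence \<phi> x \<le> \<bar>divergence \<phi> x\<bar> * \<bar>w x - g x\<bar>"
      by (simp add: abs_mult[symmetric] algebra_simps)
    also have "\<dots> \<le> M * f x" using M[of x] f(2)[of x] by (intro mult_mono) auto
    finally show "g x * divergence \<phi> x - w x * divergence \<phi> x \<le> M * f x" .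
  qed (use iw ig f in auto)
  finally show ?thesis by simp
qed

lemma abs_prod_diff_le:
  fixes u v p q :: real
  assumes "0 \<le> u" "u \<le> 1" "\<bar>q\<bar> \<le> 1"
  shows "\<bar>u * v - p * q\<bar> \<le> \<bar>u - p\<bar> + \<bar>v - q\<bar>"
proof -
  have "u * v - p * q = u * (v - q) + q * (u - p)" by (simp add: algebra_simps)
  then have "\<bar>u * v - p * q\<bar> \<le> \<bar>u\<bar> * \<bar>v - q\<bar> + \<bar>q\<bar> * \<bar>u - p\<bar>"
    by (metis abs_mult abs_triangle_ineq)
  also have "\<dots> \<le> 1 * \<bar>v - q\<bar> + 1 * \<bar>u - p\<bar>" using assms by (intro add_mono mult_right_mono) auto
  finally show ?thesis by simp
qed

lemma divergence_bounded_pair: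
  assumes "\<phi> \<in> admissible_fields" "\<psi> \<in> admissible_fields"
  obtains M where "M \<ge> 0" "\<And>x. \<bar>divergence \<phi> x\<bar> \<le> M" "\<And>x. \<bar>divergence \<psi> x\<bar> \<le> M"
proof -
  obtain M1 M2 where "0 \<le> M1" "\<And>x. \<bar>divergence \<phi> x\<bar> \<le> M1" "0 \<le> M2" "\<And>x. \<bar>divergence \<psi> x\<bar> \<le> M2"
    using divergence_bounded_support[OF assms(1)] divergence_bounded_support[OF assms(2)] by metis
  then show ?thesis by (intro that[of "max M1 M2"]) (auto simp: le_max_iff_disj)
qed

text \<open>With smooth approximations \<^term>\<open>u\<close>, \<^term>\<open>v\<close> of the two indicators, the total variations of
  \<^term>\<open>u * v\<close> and \<^term>\<open>u + v - u * v\<close> add up to at most those of \<^term>\<open>u\<close> and \<^term>\<open>v\<close>.\<close>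

lemma perimeter_submodular:
  fixes E F :: "'a::euclidean_space set"
  assumes E: "E \<in> sets borel" "bounded E" "per_bound E a" and F: "F \<in> sets borel" "bounded F" "per_bound F b"
    and \<phi>: "\<phi> \<in> admissible_fields" and \<psi>: "\<psi> \<in> admissible_fields"
  shows "(\<integral>x. indicator (E \<inter> F) x * divergence \<phi> x \<partial>lborel)
       + (\<integral>x. indicator (E \<union> F) x * divergence \<psi> x \<partial>lborel) \<le> a + b"
proof (rule field_le_epsilon)
  fix e :: real assume e: "e > 0"
  obtain M where M: "M \<ge> 0" "\<And>x. \<bar>divergence \<phi> x\<bar> \<le> M" "\<And>x. \<bar>divergence \<psi> x\<bar> \<le> M"
    using divergence_bounded_pair[OF \<phi> \<psi>] by blast
  define \<epsilon> where "\<epsilon> = e / (4 * M + 1)"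
  have \<epsilon>: "\<epsilon> > 0" "4 * M * \<epsilon> \<le> e" using e M(1) by (auto simp: \<epsilon>_def divide_simps algebra_simps)
  obtain u G R where u: "C1_grad u G" "\<And>x. 0 \<le> u x" "\<And>x. u x \<le> (1::real)"
    "integrable lborel (\<lambda>x. norm (G x))" "(\<integral>x. norm (G x) \<partial>lborel) \<le> a"
    "integrable lborel (\<lambda>x. \<bar>u x - indicator E x\<bar>)" "(\<integral>x. \<bar>u x - indicator E x\<bar> \<partial>lborel) \<le> \<epsilon>"
    "\<And>x. x \<notin> cball 0 R \<Longrightarrow> u x = 0"
    by (rule smooth_approximation[OF E \<epsilon>(1)]) (rule that; assumption)
  obtain v H R' where v: "C1_grad v H" "\<And>x. 0 \<le> v x" "\<And>x. v x \<le> (1::real)"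
    "integrable lborel (\<lambda>x. norm (H x))" "(\<integral>x. norm (H x) \<partial>lborel) \<le> b"
    "integrable lborel (\<lambda>x. \<bar>v x - indicator F x\<bar>)" "(\<integral>x. \<bar>v x - indicator F x\<bar> \<partial>lborel) \<le> \<epsilon>"
    "\<And>x. x \<notin> cball 0 R' \<Longrightarrow> v x = 0"
    by (rule smooth_approximation[OF F \<epsilon>(1)]) (rule that; assumption)
  note [measurable] = C1_grad_measurable(1)[OF u(1)] C1_grad_measurable(1)[OF v(1)] E(1) F(1)
  have ci: "integrable lborel (\<lambda>x. c x * norm (D x))"
    if "integrable lborel (\<lambda>x. norm (D x))" "c \<in> borel_measurable borel" "\<And>x. 0 \<le> c x" "\<And>x. c x \<le> 1"
    for c :: "'a \<Rightarrow> real" and D :: "'a \<Rightarrow> 'a"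
    by (rule Bochner_Integration.integrable_bound[OF that(1)])
       (use that borel_measurable_integrable[OF that(1)] in \<open>auto simp: abs_mult mult_left_le_one_le\<close>)
  \<comment> \<open>The weights of \<open>norm (G x)\<close> in \<open>f\<close> and
    \<open>g\<close> add up to 1, and so do those of \<open>norm (H x)\<close>. Hence
    \<open>f + g\<close> is exactly the sum of the two gradient norms.\<close>
  define f g where "f x = v x * norm (G x) + u x * norm (H x)"
    and "g x = (1 - v x) * norm (G x) + (1 - u x) * norm (H x)" for x
  have i1: "integrable lborel (\<lambda>x. v x * norm (G x))" "integrable lborel (\<lambda>x. u x * norm (H x))"
    "integrable lborel (\<lambda>x. (1 - v x) * norm (G x))" "integrable lborel (\<lambda>x. (1 - u x) * norm (H x))"
    using u v by (auto intro!: ci)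
  have ifg: "integrable lborel f" "integrable lborel g" using i1 by (auto simp: f_def[abs_def] g_def[abs_def])
  have "(\<integral>x. f x \<partial>lborel) + (\<integral>x. g x \<partial>lborel) = (\<integral>x. f x + g x \<partial>lborel)" using ifg by simp
  also have "\<dots> = (\<integral>x. norm (G x) + norm (H x) \<partial>lborel)"
    by (intro Bochner_Integration.integral_cong) (auto simp: f_def g_def algebra_simps)
  also have "\<dots> \<le> a + b" using u(4,5) v(4,5) by simp
  finally have fg: "(\<integral>x. f x \<partial>lborel) + (\<integral>x. g x \<partial>lborel) \<le> a + b" .
  define p where "p x = \<bar>u x - indicator E x\<bar> + \<bar>v x - indicator F x\<bar>" for x
  have ip: "integrable lborel p" "(\<integral>x. p x \<partial>lborel) \<le> 2 * \<epsilon>" using u(6,7) v(6,7) by (auto simp: p_def[abs_def])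
  have Mp: "M * (\<integral>x. p x \<partial>lborel) \<le> M * (2 * \<epsilon>)" using ip M by (intro mult_left_mono) auto
  note w2 = C1_grad_mult[OF u(1) v(1)]
  note w1 = C1_grad_diff[OF C1_grad_add[OF u(1) v(1)] w2]
  have "(\<integral>x. indicator (E \<inter> F) x * divergence \<phi> x \<partial>lborel) \<le> (\<integral>x. (u x * v x) * divergence \<phi> x \<partial>lborel) + M * (\<integral>x. p x \<partial>lborel)"
  proof (rule integral_divergence_perturb[OF \<phi> M(2), where B = 1])
    fix x
    show "\<bar>u x * v x\<bar> \<le> 1" using u v by (simp add: mult_le_one)
    show "\<bar>u x * v x - indicator (E \<inter> F) x\<bar> \<le> p x"
      unfolding p_def indicator_inter_arith by (rule abs_prod_diff_le) (use u v in auto)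
  qed (use ip in \<open>auto simp: indicator_def\<close>)
  also have "(\<integral>x. (u x * v x) * divergence \<phi> x \<partial>lborel) \<le> (\<integral>x. f x \<partial>lborel)"
  proof (rule integral_divergence_le[OF \<phi> w2 ifg(1)])
    show "norm (u x *\<^sub>R H x + v x *\<^sub>R G x) \<le> f x" for x
      unfolding f_def using norm_triangle_ineq[of "u x *\<^sub>R H x" "v x *\<^sub>R G x"] u v by simp
  qed
  finally have 1: "(\<integral>x. indicator (E \<inter> F) x * divergence \<phi> x \<partial>lborel) \<le> (\<integral>x. f x \<partial>lborel) + M * (2 * \<epsilon>)"
    using Mp by linarith
  have "(\<integral>x. indicator (E \<union> F) x * divergence \<psi> x \<partial>lborel) \<le> (\<integral>x. (u x + v x - u x * v x) * divergence \<psi> x \<partial>lborel) + M * (\<integral>x. p x \<partial>lborel)"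
  proof (rule integral_divergence_perturb[OF \<psi> M(3), where B = 1])
    fix x
    \<comment> \<open>One minus a product of complements: the distance from the indicator of the
      union reduces to that of a product.\<close>
    have eq: "u x + v x - u x * v x = 1 - (1 - u x) * (1 - v x)" by (simp add: algebra_simps)
    have "0 \<le> (1 - u x) * (1 - v x)" "(1 - u x) * (1 - v x) \<le> 1" using u v by (auto intro: mult_le_one)
    then show "\<bar>u x + v x - u x * v x\<bar> \<le> 1" unfolding eq by linarith
    have "\<bar>(1 - u x) * (1 - v x) - (1 - indicator E x) * (1 - indicator F x)\<bar> \<le> \<bar>(1 - u x) - (1 - indicator E x)\<bar> + \<bar>(1 - v x) - (1 - indicator F x)\<bar>"
      by (rule abs_prod_diff_le) (use u v in \<open>auto simp: indicator_def\<close>)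
    moreover have "indicator (E \<union> F) x = 1 - (1 - indicator E x) * (1 - indicator F x :: real)"
      by (auto simp: indicator_def)
    ultimately show "\<bar>u x + v x - u x * v x - indicator (E \<union> F) x\<bar> \<le> p x"
      unfolding p_def eq by linarith
  qed (use ip in \<open>auto simp: indicator_def\<close>)
  also have "(\<integral>x. (u x + v x - u x * v x) * divergence \<psi> x \<partial>lborel) \<le> (\<integral>x. g x \<partial>lborel)"
  proof (rule integral_divergence_le[OF \<psi> w1 ifg(2)])
    fix x
    have "G x + H x - (u x *\<^sub>R H x + v x *\<^sub>R G x) = (1 - v x) *\<^sub>R G x + (1 - u x) *\<^sub>R H x"
      by (simp add: algebra_simps)
    then show "norm (G x + H x - (u x *\<^sub>R H x + v x *\<^sub>R G x)) \<le> g x"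
      unfolding g_def using norm_triangle_ineq[of "(1 - v x) *\<^sub>R G x" "(1 - u x) *\<^sub>R H x"] u v by simp
  qed
  finally have 2: "(\<integral>x. indicator (E \<union> F) x * divergence \<psi> x \<partial>lborel) \<le> (\<integral>x. g x \<partial>lborel) + M * (2 * \<epsilon>)"
    using Mp by linarith
  show "(\<integral>x. indicator (E \<inter> F) x * divergence \<phi> x \<partial>lborel) + (\<integral>x. indicator (E \<union> F) x * divergence \<psi> x \<partial>lborel) \<le> a + b + e"
    using 1 2 fg \<epsilon>(2) by (simp add: mult.assoc)
qed

text \<open>Testing the intersection with the zero field drops its term from submodularity.\<close>

lemma per_bound_Un:
  fixes E F :: "'a::euclidean_space set"
  assumes "E \<in> sets borel" "bounded E" "per_bound E a" "F \<in> sets borel" "bounded F" "per_bound F b"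
  shows "per_bound (E \<union> F) (a + b)"
  using perimeter_submodular[OF assms zero_admissible] by (simp add: per_bound_def divergence_zero)

lemma per_bound_empty: "per_bound {} 0"
  by (simp add: per_bound_def)

lemma per_bound_UN:
  fixes E :: "'b \<Rightarrow> 'a::euclidean_space set"
  assumes "finite I" "\<And>i. i \<in> I \<Longrightarrow> E i \<in> sets borel" "\<And>i. i \<in> I \<Longrightarrow> bounded (E i)" "\<And>i. i \<in> I \<Longrightarrow> per_bound (E i) c"
  shows "per_bound (\<Union>i\<in>I. E i) (real (card I) * c)"
  using assms
proof (induction I rule: finite_induct)
  case empty
  then show ?case by (simp add: per_bound_empty)
next
  case (insert i I)
  have "per_bound (E i \<union> (\<Union>i\<in>I. E i)) (c + real (card I) * c)"
    using insert by (intro per_bound_Un) (auto intro!: bounded_UN sets.finite_UN)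
  then show ?case using insert by (simp add: algebra_simps)
qed

text \<open>The complement of \<open>F\<close> is unbounded, so submodularity is not applied to it.
  The function \<open>u * (1 - v)\<close> approximates the indicator directly, and the product rule
  with coefficients in \<open>[0, 1]\<close> bounds its gradient by the sum of the two gradient
  norms.\<close>

lemma per_bound_Diff:
  fixes E F :: "'a::euclidean_space set"
  assumes E: "E \<in> sets borel" "bounded E" "per_bound E a" and F: "F \<in> sets borel" "bounded F" "per_bound F b"
  shows "per_bound (E - F) (a + b)"
  unfolding per_bound_def
proof (rule ballI, rule field_le_epsilon)
  fix e :: real and \<phi> :: "'a \<Rightarrow> 'a" assume e: "e > 0" and \<phi>: "\<phi> \<in> admissible_fields"
  obtain M where M: "M \<ge> 0" "\<And>x. \<bar>divergence \<phi> x\<bar> \<le> M"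
    using divergence_bounded_support[OF \<phi>] by metis
  define \<epsilon> where "\<epsilon> = e / (2 * M + 1)"
  have \<epsilon>: "\<epsilon> > 0" "2 * M * \<epsilon> \<le> e" using e M(1) by (auto simp: \<epsilon>_def divide_simps algebra_simps)
  obtain u G R where u: "C1_grad u G" "\<And>x. 0 \<le> u x" "\<And>x. u x \<le> (1::real)"
    "integrable lborel (\<lambda>x. norm (G x))" "(\<integral>x. norm (G x) \<partial>lborel) \<le> a"
    "integrable lborel (\<lambda>x. \<bar>u x - indicator E x\<bar>)" "(\<integral>x. \<bar>u x - indicator E x\<bar> \<partial>lborel) \<le> \<epsilon>"
    "\<And>x. x \<notin> cball 0 R \<Longrightarrow> u x = 0"
    by (rule smooth_approximation[OF E \<epsilon>(1)]) (rule that; assumption)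
  obtain v H R' where v: "C1_grad v H" "\<And>x. 0 \<le> v x" "\<And>x. v x \<le> (1::real)"
    "integrable lborel (\<lambda>x. norm (H x))" "(\<integral>x. norm (H x) \<partial>lborel) \<le> b"
    "integrable lborel (\<lambda>x. \<bar>v x - indicator F x\<bar>)" "(\<integral>x. \<bar>v x - indicator F x\<bar> \<partial>lborel) \<le> \<epsilon>"
    "\<And>x. x \<notin> cball 0 R' \<Longrightarrow> v x = 0"
    by (rule smooth_approximation[OF F \<epsilon>(1)]) (rule that; assumption)
  note [measurable] = C1_grad_measurable(1)[OF u(1)] C1_grad_measurable(1)[OF v(1)] E(1) F(1)
  define p where "p x = \<bar>u x - indicator E x\<bar> + \<bar>v x - indicator F x\<bar>" for x
  have ip: "integrable lborel p" "(\<integral>x. p x \<partial>lborel) \<le> 2 * \<epsilon>" using u(6,7) v(6,7) by (auto simp: p_def[abs_def])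
  have Mp: "M * (\<integral>x. p x \<partial>lborel) \<le> M * (2 * \<epsilon>)" using ip M by (intro mult_left_mono) auto
  note w3 = C1_grad_diff[OF u(1) C1_grad_mult[OF u(1) v(1)]]
  have ind: "indicator (E - F) x = indicator E x * (1 - indicator F x :: real)" for x by (auto simp: indicator_def)
  have "(\<integral>x. indicator (E - F) x * divergence \<phi> x \<partial>lborel) \<le> (\<integral>x. (u x - u x * v x) * divergence \<phi> x \<partial>lborel) + M * (\<integral>x. p x \<partial>lborel)"
  proof (rule integral_divergence_perturb[OF \<phi> M(2), where B = 1])
    fix x
    have eq: "u x - u x * v x = u x * (1 - v x)" by (simp add: algebra_simps)
    show "\<bar>u x - u x * v x\<bar> \<le> 1" unfolding eq using u v by (simp add: abs_mult mult_le_one)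
    have "\<bar>u x * (1 - v x) - indicator E x * (1 - indicator F x)\<bar> \<le> \<bar>u x - indicator E x\<bar> + \<bar>(1 - v x) - (1 - indicator F x)\<bar>"
      by (rule abs_prod_diff_le) (use u v in \<open>auto simp: indicator_def\<close>)
    then show "\<bar>u x - u x * v x - indicator (E - F) x\<bar> \<le> p x"
      unfolding p_def ind eq by linarith
  qed (use ip in \<open>auto simp: indicator_def\<close>)
  also have "(\<integral>x. (u x - u x * v x) * divergence \<phi> x \<partial>lborel) \<le> (\<integral>x. norm (G x) + norm (H x) \<partial>lborel)"
  proof (rule integral_divergence_le[OF \<phi> w3])
    fix x
    have "G x - (u x *\<^sub>R H x + v x *\<^sub>R G x) = (1 - v x) *\<^sub>R G x - u x *\<^sub>R H x"
      by (simp add: algebra_simps)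
    moreover have "norm ((1 - v x) *\<^sub>R G x) \<le> 1 * norm (G x)" "norm (u x *\<^sub>R H x) \<le> 1 * norm (H x)"
      unfolding norm_scaleR using u v by (intro mult_right_mono; simp)+
    ultimately show "norm (G x - (u x *\<^sub>R H x + v x *\<^sub>R G x)) \<le> norm (G x) + norm (H x)"
      using norm_triangle_ineq4[of "(1 - v x) *\<^sub>R G x" "u x *\<^sub>R H x"]
      by (metis add_mono mult_1 order_trans)
  qed (use u v in auto)
  also have "\<dots> \<le> a + b" using u v by simp
  finally show "(\<integral>x. indicator (E - F) x * divergence \<phi> x \<partial>lborel) \<le> a + b + e"
    using Mp \<epsilon>(2) by (simp add: mult.assoc)
qed

text \<open>This plays the role of the coarea formula: applied to the total variation carried by
  sublevel sets, it yields a level where that variation grows at a rate just above the average. If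
  growth were fast to the right of every point, continuous induction along \<open>S\<close> would
  carry it from \<open>a\<close> to \<open>b\<close>, against the assumption on the total
  increment.\<close>

lemma slow_growth_point:
  fixes V :: "real \<Rightarrow> real"
  assumes V: "mono V" and ab: "a < b" and K: "V b - V a < K * (b - a)"
  obtains s where "a \<le> s" "s < b" "\<And>d. d > 0 \<Longrightarrow> \<exists>h. 0 < h \<and> h < d \<and> V (s + h) - V s \<le> K * h"
proof -
  have "V a \<le> V b" using V ab by (simp add: monoD)
  then have "0 < K * (b - a)" using K by linarith
  then have K0: "K > 0" using ab by (simp add: zero_less_mult_iff)
  have "\<exists>s. a \<le> s \<and> s < b \<and> (\<forall>d>0. \<exists>h. 0 < h \<and> h < d \<and> V (s + h) - V s \<le> K * h)"
  proof (rule ccontr)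
    assume "\<not> ?thesis"
    then have fast: "\<And>s. a \<le> s \<Longrightarrow> s < b \<Longrightarrow> \<exists>d>0. \<forall>h. 0 < h \<and> h < d \<longrightarrow> V (s + h) - V s > K * h"
      by (meson not_le)
    define S where "S = {s. a \<le> s \<and> s \<le> b \<and> K * (s - a) \<le> V s - V a}"
    define \<sigma> where "\<sigma> = Sup S"
    have ne: "a \<in> S" using ab by (auto simp: S_def)
    have bd: "bdd_above S" by (auto simp: S_def bdd_above_def)
    have s1: "s \<le> \<sigma>" if "s \<in> S" for s unfolding \<sigma>_def by (rule cSup_upper[OF that bd])
    have \<sigma>b: "\<sigma> \<le> b" unfolding \<sigma>_def by (rule cSup_least) (use ne in \<open>auto simp: S_def\<close>)
    \<comment> \<open>Monotonicity of \<open>V\<close> does the work of continuity when the defining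
      inequality of \<open>S\<close> is passed to its supremum.\<close>
    have "\<sigma> \<le> a + (V \<sigma> - V a) / K"
      unfolding \<sigma>_def
    proof (rule cSup_least, use ne in blast)
      fix s assume s: "s \<in> S"
      have "K * (s - a) \<le> V (Sup S) - V a"
        using s monoD[OF V s1[OF s]] by (auto simp: S_def \<sigma>_def)
      then show "s \<le> a + (V (Sup S) - V a) / K" using K0 by (simp add: field_simps)
    qed
    then have \<sigma>S: "K * (\<sigma> - a) \<le> V \<sigma> - V a" using K0 by (simp add: field_simps)
    have a\<sigma>: "a \<le> \<sigma>" using s1[OF ne] .
    have "\<sigma> \<noteq> b" using \<sigma>S K by auto
    then have lt: "\<sigma> < b" using \<sigma>b by simp
    obtain d where d: "d > 0" "\<And>h. 0 < h \<Longrightarrow> h < d \<Longrightarrow> V (\<sigma> + h) - V \<sigma> > K * h"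
      using fast[OF a\<sigma> lt] by blast
    define h where "h = min (d / 2) (b - \<sigma>)"
    have h: "0 < h" "h < d" "\<sigma> + h \<le> b" using d(1) lt by (auto simp: h_def min_def)
    have "K * (\<sigma> + h - a) = K * (\<sigma> - a) + K * h" by (simp add: algebra_simps)
    then have "\<sigma> + h \<in> S" using d(2)[OF h(1,2)] \<sigma>S h a\<sigma> by (simp add: S_def)
    from s1[OF this] h show False by simp
  qed
  then show ?thesis using that by blast
qed

text \<open>The derivative is the convolution of the indicators of two intervals of lengths
  \<open>h\<close> and \<open>e = H - h\<close>, divided by \<open>e * h\<close>: a trapezoid over
  \<open>{s..s + H}\<close> of integral 1 and height at most \<open>1 / h\<close>. Its
  antiderivative is a combination of four squared positive parts.\<close>

lemma C1_ramp:
  fixes s h H :: real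
  assumes h: "0 < h" "h < H"
  obtains \<eta> \<eta>' where "\<And>t. (\<eta> has_real_derivative \<eta>' t) (at t)" "continuous_on UNIV \<eta>'"
    "\<And>t. t \<le> s \<Longrightarrow> \<eta> t = 0" "\<And>t. s + H \<le> t \<Longrightarrow> \<eta> t = 1" "\<And>t. 0 \<le> \<eta> t" "\<And>t. \<eta> t \<le> 1"
    "\<And>t. 0 \<le> \<eta>' t" "\<And>t. \<eta>' t \<le> 1 / h" "\<And>t. t \<notin> {s<..s + H} \<Longrightarrow> \<eta>' t = 0"
proof -
  define e where "e = H - h"
  have e: "e > 0" using h by (simp add: e_def)
  define p where "p t = (max 0 t)\<^sup>2" for t :: real
  define \<eta> where "\<eta> t = (p (t - s) - p (t - s - e) - p (t - s - h) + p (t - s - H)) / (2 * e * h)" for t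
  define \<eta>' where "\<eta>' t = (max 0 (t - s) - max 0 (t - s - e) - max 0 (t - s - h) + max 0 (t - s - H)) / (e * h)" for t
  have dp: "((\<lambda>t. p (t - c)) has_real_derivative 2 * max 0 (t - c)) (at t)" for c t
    unfolding p_def
    using DERIV_chain2[where f = "\<lambda>t. (max 0 t)\<^sup>2" and g = "\<lambda>t. t - c",
        OF has_real_derivative_pos_part_square DERIV_diff[OF DERIV_ident DERIV_const]]
    by simp
  have d\<eta>: "(\<eta> has_real_derivative \<eta>' t) (at t)" for t
  proof -
    have "((\<lambda>t. (p (t - s) - p (t - (s + e)) - p (t - (s + h)) + p (t - (s + H))) / (2 * e * h)) has_real_derivative
       (2 * max 0 (t - s) - 2 * max 0 (t - (s + e)) - 2 * max 0 (t - (s + h)) + 2 * max 0 (t - (s + H))) / (2 * e * h)) (at t)"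
      by (intro DERIV_cdivide DERIV_add DERIV_diff dp)
    then show ?thesis
      unfolding \<eta>_def[abs_def] \<eta>'_def diff_diff_eq
      by (rule DERIV_cong) (use e h in \<open>simp add: field_simps\<close>)
  qed
  have c: "continuous_on UNIV \<eta>'" unfolding \<eta>'_def using e h by (intro continuous_intros) auto
  have z0: "\<eta> t = 0" if "t \<le> s" for t using that e h by (simp add: \<eta>_def p_def)
  have z1: "\<eta> t = 1" if "s + H \<le> t" for t
  proof -
    have "p (t - s) - p (t - s - e) - p (t - s - h) + p (t - s - H) = 2 * e * h"
      using that e h unfolding p_def e_def by (simp add: power2_eq_square algebra_simps)
    then show ?thesis using e h by (simp add: \<eta>_def)
  qed
  have n: "0 \<le> \<eta>' t" for t
  proof -
    have "0 \<le> max 0 (t - s) - max 0 (t - s - e) - max 0 (t - s - h) + max 0 (t - s - H)"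
      using e h unfolding e_def by linarith
    then show ?thesis unfolding \<eta>'_def using e h by simp
  qed
  have b: "\<eta>' t \<le> 1 / h" for t
  proof -
    have "max 0 (t - s) - max 0 (t - s - e) - max 0 (t - s - h) + max 0 (t - s - H) \<le> e"
      using e h unfolding e_def by linarith
    then show ?thesis unfolding \<eta>'_def using e h by (simp add: divide_simps)
  qed
  have v: "\<eta>' t = 0" if "t \<notin> {s<..s + H}" for t
  proof -
    have "max 0 (t - s) - max 0 (t - s - e) - max 0 (t - s - h) + max 0 (t - s - H) = 0"
      using that e h unfolding e_def by auto
    then show ?thesis unfolding \<eta>'_def by simp
  qed
  have mono: "\<eta> t \<le> \<eta> t'" if "t \<le> t'" for t t'
    using DERIV_nonneg_imp_nondecreasing[OF that] d\<eta> n by blast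
  have "0 \<le> \<eta> t" for t using mono[of "min s t" t] z0[of "min s t"] by simp
  moreover have "\<eta> t \<le> 1" for t using mono[of t "max (s + H) t"] z1[of "max (s + H) t"] by simp
  ultimately show ?thesis using that[OF d\<eta> c z0 z1 _ _ n b v] by blast
qed

text \<open>Composing \<open>u\<close> with ever steeper ramps that start at level \<open>s\<close>
  approximates the indicator of the superlevel set. The total variation of a composition is at most
  that of \<open>u\<close> on the slab \<open>s < u x \<le> s + H n\<close>, divided by
  \<open>h n\<close>, and \<open>s\<close> is a level where the slab variation grows slowly.\<close>

lemma superlevel_per_bound:
  fixes u :: "'a::euclidean_space \<Rightarrow> real"
  assumes u: "C1_grad u G" and G: "integrable lborel (\<lambda>x. norm (G x))" "(\<integral>x. norm (G x) \<partial>lborel) \<le> c"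
    and ab: "a < b" and K: "c < K * (b - a)"
  obtains s where "a \<le> s" "s < b" "per_bound {x. s < u x} K"
proof -
  note [measurable] = C1_grad_measurable[OF u]
  define V where "V t = (\<integral>x. indicator {x. u x \<le> t} x * norm (G x) \<partial>lborel)" for t
  have iV: "integrable lborel (\<lambda>x. indicator A x * norm (G x))" if [measurable]: "A \<in> sets borel" for A
    by (rule Bochner_Integration.integrable_bound[OF G(1)]) (auto simp: indicator_def)
  have ms[measurable]: "{x. u x \<le> t} \<in> sets borel" for t by measurable
  have "mono V"
    unfolding V_def by (intro monoI integral_mono iV ms) (auto simp: indicator_def)
  have Vle: "V t \<le> c" "0 \<le> V t" for t
  proof -
    have "V t \<le> (\<integral>x. norm (G x) \<partial>lborel)"
      unfolding V_def by (intro integral_mono iV ms G) (auto simp: indicator_def)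
    then show "V t \<le> c" using G(2) by simp
    show "0 \<le> V t" unfolding V_def by (intro integral_nonneg_AE) auto
  qed
  have c0: "c \<ge> 0" using Vle[of 0] by linarith
  define q where "q = c / (b - a)"
  have q: "0 \<le> q" "q < K" "c = q * (b - a)"
    using K ab c0 by (auto simp: q_def divide_simps mult.commute)
  define K0 where "K0 = (q + K) / 2"
  have K0: "q < K0" "K0 < K" using q by (auto simp: K0_def)
  have K0p: "0 < K0" using K0(1) q by linarith
  have "V b - V a < K0 * (b - a)"
    using Vle[of b] Vle[of a] mult_strict_right_mono[OF K0(1), of "b - a"] ab q(3) by linarith
  from slow_growth_point[OF \<open>mono V\<close> ab this]
  obtain s where s: "a \<le> s" "s < b" "\<And>d. d > 0 \<Longrightarrow> \<exists>h. 0 < h \<and> h < d \<and> V (s + h) - V s \<le> K0 * h"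
    by metis
  have "\<forall>n. \<exists>h. 0 < h \<and> h < inverse (real (Suc n)) \<and> V (s + h) - V s \<le> K0 * h"
    using s(3) by simp
  then obtain H where H: "\<And>n. 0 < H n" "\<And>n. H n < inverse (real (Suc n))" "\<And>n. V (s + H n) - V s \<le> K0 * H n"
    by metis
  have H0: "H \<longlonglongrightarrow> 0"
    by (rule tendsto_sandwich[OF _ _ tendsto_const LIMSEQ_inverse_real_of_nat])
       (use H(1,2) in \<open>auto intro!: always_eventually less_imp_le\<close>)
  \<comment> \<open>This makes the final bound \<open>K0 * H n / h n\<close> equal to
    \<open>K\<close>; the gap between \<open>K0\<close> and \<open>K\<close> pays for
    \<open>h n < H n\<close>.\<close>
  define h where "h n = K0 * H n / K" for n
  have h: "0 < h n" "h n < H n" for n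
    using H(1)[of n] K0 K0p by (auto simp: h_def divide_simps)
  have "\<forall>n. \<exists>\<eta> \<eta>'. (\<forall>t. (\<eta> has_real_derivative \<eta>' t) (at t)) \<and> continuous_on UNIV \<eta>' \<and>
    (\<forall>t. t \<le> s \<longrightarrow> \<eta> t = 0) \<and> (\<forall>t. s + H n \<le> t \<longrightarrow> \<eta> t = 1) \<and> (\<forall>t. 0 \<le> \<eta> t) \<and> (\<forall>t. \<eta> t \<le> 1) \<and>
    (\<forall>t. 0 \<le> \<eta>' t) \<and> (\<forall>t. \<eta>' t \<le> 1 / h n) \<and> (\<forall>t. t \<notin> {s<..s + H n} \<longrightarrow> \<eta>' t = 0)"
    using C1_ramp[OF h] by (intro allI) metis
  then obtain \<eta> \<eta>' where \<eta>: "\<And>n t. (\<eta> n has_real_derivative \<eta>' n t) (at t)" "\<And>n. continuous_on UNIV (\<eta>' n)"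
    "\<And>n t. t \<le> s \<Longrightarrow> \<eta> n t = 0" "\<And>n t. s + H n \<le> t \<Longrightarrow> \<eta> n t = (1::real)" "\<And>n t. 0 \<le> \<eta> n t" "\<And>n t. \<eta> n t \<le> 1"
    "\<And>n t. 0 \<le> \<eta>' n t" "\<And>n t. \<eta>' n t \<le> 1 / h n" "\<And>n t. t \<notin> {s<..s + H n} \<Longrightarrow> \<eta>' n t = 0"
    by metis
  have "per_bound {x. s < u x} K"
    unfolding per_bound_def
  proof
    fix \<phi> :: "'a \<Rightarrow> 'a" assume \<phi>: "\<phi> \<in> admissible_fields"
    have cg: "C1_grad (\<lambda>x. \<eta> n (u x)) (\<lambda>x. \<eta>' n (u x) *\<^sub>R G x)" for n
      unfolding C1_grad_def
    proof (intro conjI allI)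
      show "continuous_on UNIV (\<lambda>x. \<eta>' n (u x) *\<^sub>R G x)"
        using C1_grad_continuous_grad[OF u] C1_grad_continuous[OF u] \<eta>(2)
        by (intro continuous_intros continuous_on_compose2[OF \<eta>(2)]) auto
      fix x
      show "((\<lambda>x. \<eta> n (u x)) has_derivative (\<lambda>h. (\<eta>' n (u x) *\<^sub>R G x) \<bullet> h)) (at x)"
        using has_derivative_compose[OF C1_grad_has_derivative[OF u] \<eta>(1)[unfolded has_field_derivative_def]]
        by simp
    qed
    have le: "(\<integral>x. \<eta> n (u x) * divergence \<phi> x \<partial>lborel) \<le> K" for n
    proof -
      let ?f = "\<lambda>x. (1 / h n) * (indicator {x. u x \<le> s + H n} x * norm (G x) - indicator {x. u x \<le> s} x * norm (G x))"
      have "(\<integral>x. \<eta> n (u x) * divergence \<phi> x \<partial>lborel) \<le> (\<integral>x. ?f x \<partial>lborel)"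
      proof (rule integral_divergence_le[OF \<phi> cg])
        show "integrable lborel ?f" by (intro integrable_mult_right Bochner_Integration.integrable_diff iV ms)
        fix x
        have "norm (\<eta>' n (u x) *\<^sub>R G x) = \<eta>' n (u x) * norm (G x)" using \<eta>(7) by simp
        also have "\<dots> \<le> (indicator {s<..s + H n} (u x) / h n) * norm (G x)"
          using \<eta>(8,9) by (intro mult_right_mono) (auto simp: indicator_def)
        also have "\<dots> = ?f x" using H(1)[of n] by (auto simp: indicator_def)
        finally show "norm (\<eta>' n (u x) *\<^sub>R G x) \<le> ?f x" .
      qed
      also have "\<dots> = (V (s + H n) - V s) / h n"
        unfolding V_def by (simp add: iV)
      also have "\<dots> \<le> K0 * H n / h n" using H(3)[of n] h[of n] by (simp add: divide_right_mono)
      also have "\<dots> = K" using H(1)[of n] K0 K0p by (simp add: h_def)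
      finally show ?thesis .
    qed
    obtain R M where M: "0 \<le> M" "\<And>x. \<bar>divergence \<phi> x\<bar> \<le> M" "\<And>x. x \<notin> cball 0 R \<Longrightarrow> divergence \<phi> x = 0"
      using divergence_bounded_support[OF \<phi>] by blast
    have "(\<lambda>n. \<integral>x. \<eta> n (u x) * divergence \<phi> x \<partial>lborel) \<longlonglongrightarrow> (\<integral>x. indicator {x. s < u x} x * divergence \<phi> x \<partial>lborel)"
    proof (rule integral_dominated_convergence[where w = "\<lambda>x. \<bar>divergence \<phi> x\<bar>"])
      show "integrable lborel (\<lambda>x. \<bar>divergence \<phi> x\<bar>)"
        using integrable_mult_divergence[OF \<phi>, of "\<lambda>_. 1" 1] by simp
      show "(\<lambda>x. \<eta> n (u x) * divergence \<phi> x) \<in> borel_measurable lborel" for n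
        using C1_grad_measurable(1)[OF cg] \<phi> by simp
      show "(\<lambda>x. indicator {x. s < u x} x * divergence \<phi> x) \<in> borel_measurable lborel"
        using \<phi> by simp
      show "AE x in lborel. norm (\<eta> n (u x) * divergence \<phi> x) \<le> \<bar>divergence \<phi> x\<bar>" for n
        using \<eta>(5,6) by (intro AE_I2) (auto simp: abs_mult intro!: mult_left_le_one_le)
      show "AE x in lborel. (\<lambda>n. \<eta> n (u x) * divergence \<phi> x) \<longlonglongrightarrow> indicator {x. s < u x} x * divergence \<phi> x"
      proof (intro AE_I2 tendsto_mult tendsto_const)
        fix x :: 'a
        show "(\<lambda>n. \<eta> n (u x)) \<longlonglongrightarrow> indicator {x. s < u x} x"
        proof (cases "s < u x")
          case True
          have "eventually (\<lambda>n. H n < u x - s) sequentially"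
            using order_tendstoD(2)[OF H0, of "u x - s"] True by simp
          then have "eventually (\<lambda>n. \<eta> n (u x) = 1) sequentially"
            by eventually_elim (use \<eta>(4) in auto)
          then show ?thesis using True by (simp add: tendsto_eventually)
        next
          case False
          then show ?thesis using \<eta>(3) by simp
        qed
      qed
    qed
    from LIMSEQ_le_const2[OF this] le
    show "(\<integral>x. indicator {x. s < u x} x * divergence \<phi> x \<partial>lborel) \<le> K" by blast
  qed
  then show ?thesis using that s by blast
qed

text \<open>\<open>E\<close> and its translate by \<open>h\<close> in a coordinate direction differ
  only within distance \<open>h\<close> of the frontier, since a segment from a point of
  \<open>E\<close> to a point outside meets it. Each directional difference quotient is thus at most
  \<open>C\<close>. Summing over coordinates gives the factor \<open>DIM('a)\<close>, which is not
  sharp, but later only finiteness and scaling matter.\<close>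

lemma per_bound_Minkowski_content:
  fixes E :: "'a::euclidean_space set"
  assumes E [measurable]: "E \<in> sets borel" and C: "C \<ge> 0" and h0: "h0 > 0"
    and T: "\<And>h. 0 < h \<Longrightarrow> h < h0 \<Longrightarrow> \<exists>T\<in>sets borel. {x. \<exists>y\<in>frontier E. dist x y \<le> h} \<subseteq> T \<and> emeasure lborel T \<le> ennreal (C * h)"
  shows "per_bound E (real DIM('a) * C)"
  unfolding per_bound_def
proof
  fix \<phi> :: "'a \<Rightarrow> 'a" assume \<phi>: "\<phi> \<in> admissible_fields"
  obtain R where R: "\<And>x. x \<notin> cball 0 R \<Longrightarrow> \<phi> x = 0" using admissible_support[OF \<phi>] by blast
  let ?D = "\<lambda>x. frechet_derivative \<phi> (at x)"
  have one: "(\<integral>x. indicator E x * (?D x b \<bullet> b) \<partial>lborel) \<le> C" and oneint: "integrable lborel (\<lambda>x. indicator E x * (?D x b \<bullet> b))"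
    if b: "b \<in> Basis" for b
  proof -
    define f where "f x = \<phi> x \<bullet> b" for x
    have cf: "continuous_on UNIV f" unfolding f_def by (intro continuous_intros admissible_continuous[OF \<phi>])
    have [measurable]: "f \<in> borel_measurable borel" by (rule borel_measurable_continuous_onI[OF cf])
    have f1: "\<bar>f x\<bar> \<le> 1" for x
      unfolding f_def using Cauchy_Schwarz_ineq2[of "\<phi> x" b] admissible_norm[OF \<phi>, of x] b by simp
    have f0: "f x = 0" if "x \<notin> cball 0 R" for x using R[OF that] by (simp add: f_def)
    have df: "(f has_derivative (\<lambda>h. ?D x h \<bullet> b)) (at x)" for x
      unfolding f_def by (rule has_derivative_inner_left[OF admissible_has_derivative[OF \<phi>]])
    have cd: "continuous_on UNIV (\<lambda>x. ?D x b \<bullet> b)"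
      by (intro continuous_intros admissible_derivative_continuous[OF \<phi>])
    have d0: "?D x b \<bullet> b = 0" if "x \<notin> cball 0 R" for x
      using fun_cong[OF derivative_zero_outside[OF df f0 that], of b] by simp
    obtain M where M: "\<And>x. norm (?D x b \<bullet> b) \<le> M" using continuous_bounded_support[OF cd d0] by blast
    show "integrable lborel (\<lambda>x. indicator E x * (?D x b \<bullet> b))"
    proof (rule integrable_bounded_support[where B = "\<bar>M\<bar>" and R = R])
      show "(\<lambda>x. indicator E x * (?D x b \<bullet> b)) \<in> borel_measurable borel"
        using borel_measurable_continuous_onI[OF cd] by measurable
      show "norm (indicator E x * (?D x b \<bullet> b)) \<le> \<bar>M\<bar>" for x
        using M[of x] by (auto simp: indicator_def)
    qed (use d0 in auto)
    define A where "A n = (\<integral>x. indicator E x * ((f (x + inverse (real (Suc n)) *\<^sub>R b) - f x) * real (Suc n)) \<partial>lborel)" for n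
    have "A \<longlonglongrightarrow> (\<integral>x. indicator E x * (?D x b \<bullet> b) \<partial>lborel)"
      unfolding A_def
      by (rule difference_quotient_integral[where f' = "\<lambda>x h. ?D x h \<bullet> b" and B = 1, OF df cd f0]) (auto simp: indicator_def)
    moreover have "eventually (\<lambda>n. A n \<le> C) sequentially"
      using order_tendstoD(2)[OF LIMSEQ_inverse_real_of_nat h0]
    proof eventually_elim
      case (elim n)
      define h where "h = inverse (real (Suc n))"
      have h: "0 < h" "h < h0" "real (Suc n) = 1 / h" using elim by (auto simp: h_def divide_inverse)
      obtain T where T: "T \<in> sets borel" "{x. \<exists>y\<in>frontier E. dist x y \<le> h} \<subseteq> T" "emeasure lborel T \<le> ennreal (C * h)"
        using T[OF h(1,2)] by blast
      note [measurable] = T(1)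
      have shift: "(\<lambda>x. indicator E x * f (x + h *\<^sub>R b)) = (\<lambda>x. indicator E ((x + h *\<^sub>R b) - h *\<^sub>R b) * f (x + h *\<^sub>R b))"
        by simp
      have int: "integrable lborel (\<lambda>x. g x * f x)" if "g \<in> borel_measurable borel" "\<And>x. \<bar>g x\<bar> \<le> 1" for g :: "'a \<Rightarrow> real"
      proof (rule integrable_bounded_support[where B = 1 and R = R])
        show "norm (g x * f x) \<le> 1" for x using mult_mono[OF that(2)[of x] f1[of x]] by (simp add: abs_mult)
      qed (use that f0 in auto)
      have i1: "integrable lborel (\<lambda>x. indicator E (x - h *\<^sub>R b) * f x)" and i2: "integrable lborel (\<lambda>x. indicator E x * f x)"
        by (rule int; auto simp: indicator_def)+
      have i3: "integrable lborel (\<lambda>x. indicator E x * f (x + h *\<^sub>R b))"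
      proof (rule integrable_bounded_support[where B = 1 and R = "R + h"])
        show "norm (indicator E x * f (x + h *\<^sub>R b)) \<le> 1" for x using f1 by (auto simp: indicator_def)
        fix x :: 'a assume x: "x \<notin> cball 0 (R + h)"
        have "norm x \<le> norm (x + h *\<^sub>R b) + norm (h *\<^sub>R b)" by (metis add_diff_cancel_right' norm_triangle_ineq4)
        then have "x + h *\<^sub>R b \<notin> cball 0 R" using x b h by auto
        then show "indicator E x * f (x + h *\<^sub>R b) = 0" using f0 by simp
      qed auto
      have "A n = (1 / h) * ((\<integral>x. indicator E x * f (x + h *\<^sub>R b) \<partial>lborel) - (\<integral>x. indicator E x * f x \<partial>lborel))"
        unfolding A_def h_def[symmetric] h(3) using i2 i3
        by (simp add: algebra_simps diff_divide_distrib)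
      also have "(\<integral>x. indicator E x * f (x + h *\<^sub>R b) \<partial>lborel) = (\<integral>x. indicator E (x - h *\<^sub>R b) * f x \<partial>lborel)"
        unfolding shift by (rule lborel_integral_translate[of "\<lambda>x. indicator E (x - h *\<^sub>R b) * f x"]) measurable
      also have "\<dots> - (\<integral>x. indicator E x * f x \<partial>lborel) = (\<integral>x. indicator E (x - h *\<^sub>R b) * f x - indicator E x * f x \<partial>lborel)"
        using i1 i2 by simp
      also have "\<dots> \<le> (\<integral>x. indicator T x \<partial>lborel)"
      proof (rule integral_mono)
        show "integrable lborel (indicator T :: 'a \<Rightarrow> real)"
          using T(1,3) by (simp add: le_less_trans[OF T(3)])
        fix x
        show "indicator E (x - h *\<^sub>R b) * f x - indicator E x * f x \<le> (indicator T x :: real)"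
        proof (cases "(x - h *\<^sub>R b \<in> E) = (x \<in> E)")
          case True then show ?thesis by (simp add: indicator_def)
        next
          case False
          have "closed_segment (x - h *\<^sub>R b) x \<inter> frontier E \<noteq> {}"
            using False by (intro connected_Int_frontier) auto
          then obtain y where y: "y \<in> closed_segment (x - h *\<^sub>R b) x" "y \<in> frontier E" by blast
          have "dist x y \<le> dist x (x - h *\<^sub>R b)"
            using dist_in_closed_segment[OF y(1)] by (simp add: dist_commute)
          also have "\<dots> = h" using b h by (simp add: dist_norm)
          finally have "x \<in> T" using T(2) y(2) by auto
          then show ?thesis using f1[of x] False by (auto simp: indicator_def)
        qed
      qed (use i1 i2 in auto)
      also have "\<dots> = measure lborel T" using T(1) by simp
      also have "\<dots> \<le> C * h"
        using T(3) C h(1) by (simp add: measure_def enn2real_leI)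
      finally show ?case using h(1) by (simp add: divide_simps mult.commute)
    qed
    ultimately show "(\<integral>x. indicator E x * (?D x b \<bullet> b) \<partial>lborel) \<le> C"
      by (intro tendsto_upperbound) auto
  qed
  have "(\<integral>x. indicator E x * divergence \<phi> x \<partial>lborel) = (\<Sum>b\<in>Basis. \<integral>x. indicator E x * (?D x b \<bullet> b) \<partial>lborel)"
    unfolding divergence_def sum_distrib_left by (rule Bochner_Integration.integral_sum) (rule oneint)
  also have "\<dots> \<le> (\<Sum>b\<in>(Basis::'a set). C)" by (intro sum_mono one)
  finally show "(\<integral>x. indicator E x * divergence \<phi> x \<partial>lborel) \<le> real DIM('a) * C" by simp
qed

lemma power_diff_le:
  fixes x y :: real
  assumes "0 \<le> y" "y \<le> x"
  shows "x ^ n - y ^ n \<le> real n * (x - y) * x ^ (n - 1)"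
proof (cases n)
  case (Suc m)
  have "(\<Sum>i<Suc m. x ^ i * y ^ (m - i)) \<le> (\<Sum>i<Suc m. x ^ i * x ^ (m - i))"
    using assms by (intro sum_mono mult_left_mono power_mono) auto
  also have "\<dots> = (\<Sum>i<Suc m. x ^ m)" by (intro sum.cong) (auto simp: power_add[symmetric])
  also have "\<dots> = real (Suc m) * x ^ m" by simp
  finally have "(x - y) * (\<Sum>i<Suc m. x ^ i * y ^ (m - i)) \<le> (x - y) * (real (Suc m) * x ^ m)"
    using assms by (intro mult_left_mono) auto
  moreover have "x ^ Suc m - y ^ Suc m = (x - y) * (\<Sum>i<Suc m. x ^ i * y ^ (m - i))"
    by (rule diff_power_eq_sum)
  ultimately show ?thesis unfolding Suc by (simp only: diff_Suc_1 mult_ac)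
qed simp

text \<open>The shell of half-width \<open>h\<close> around a sphere of radius \<open>r\<close> in
  dimension \<open>d\<close> has volume of order \<open>h * r ^ (d - 1)\<close>, which feeds the
  Minkowski content bound.\<close>

lemma per_bound_ball:
  obtains C where "C \<ge> 0" "\<And>(x::'a::euclidean_space) r. r > 0 \<Longrightarrow> per_bound (ball x r) (C * r ^ (DIM('a) - 1))"
proof -
  let ?d = "DIM('a)" let ?\<omega> = "unit_ball_vol (real DIM('a))"
  define C where "C = real ?d * (?\<omega> * (real ?d * 2 * 2 ^ (?d - 1)))"
  have "per_bound (ball x r) (C * r ^ (?d - 1))" if r: "r > 0" for x :: 'a and r
  proof -
    let ?C = "?\<omega> * (real ?d * 2 * (2 * r) ^ (?d - 1))"
    have "per_bound (ball x r) (real ?d * ?C)"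
    proof (rule per_bound_Minkowski_content[OF _ _ r])
      fix h assume h: "0 < h" "h < r"
      define T where "T = cball x (r + h) - ball x (r - h)"
      have "{z. \<exists>y\<in>frontier (ball x r). dist z y \<le> h} \<subseteq> T"
      proof safe
        fix z y assume "y \<in> frontier (ball x r)" "dist z y \<le> h"
        then have "dist x y = r" using r by simp
        moreover have "dist x z \<le> dist x y + dist z y" "dist x y \<le> dist x z + dist z y"
          by (metis dist_commute dist_triangle)+
        ultimately show "z \<in> T" using \<open>dist z y \<le> h\<close> by (auto simp: T_def)
      qed
      moreover have "emeasure lborel T \<le> ennreal (?C * h)"
      proof -
        have "emeasure lborel T = emeasure lborel (cball x (r + h)) - emeasure lborel (ball x (r - h))"
          unfolding T_def using h emeasure_lborel_ball_finite[of x "r - h"] by (intro emeasure_Diff) auto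
        also have "\<dots> = ennreal (?\<omega> * (r + h) ^ ?d) - ennreal (?\<omega> * (r - h) ^ ?d)"
          using h by (simp add: emeasure_cball emeasure_ball)
        also have "\<dots> = ennreal (?\<omega> * (r + h) ^ ?d - ?\<omega> * (r - h) ^ ?d)"
          using h by (intro ennreal_minus) (simp add: unit_ball_vol_nonneg)
        also have "\<dots> \<le> ennreal (?C * h)"
        proof (rule ennreal_leI)
          have "(r + h) ^ ?d - (r - h) ^ ?d \<le> real ?d * (2 * h) * (r + h) ^ (?d - 1)"
            using power_diff_le[of "r - h" "r + h" ?d] h by simp
          also have "\<dots> \<le> real ?d * (2 * h) * (2 * r) ^ (?d - 1)"
            using h by (intro mult_left_mono power_mono) auto
          finally have "?\<omega> * ((r + h) ^ ?d - (r - h) ^ ?d) \<le> ?\<omega> * (real ?d * (2 * h) * (2 * r) ^ (?d - 1))"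
            by (intro mult_left_mono) (simp_all add: unit_ball_vol_nonneg)
          then show "?\<omega> * (r + h) ^ ?d - ?\<omega> * (r - h) ^ ?d \<le> ?C * h" by (simp add: algebra_simps)
        qed
        finally show ?thesis .
      qed
      ultimately show "\<exists>T\<in>sets borel. {z. \<exists>y\<in>frontier (ball x r). dist z y \<le> h} \<subseteq> T \<and> emeasure lborel T \<le> ennreal (?C * h)"
        by (intro bexI[of _ T]) (auto simp: T_def)
    qed (use r in \<open>auto simp: unit_ball_vol_nonneg\<close>)
    then show ?thesis by (simp add: C_def power_mult_distrib mult_ac)
  qed
  moreover have "C \<ge> 0" unfolding C_def by (simp add: unit_ball_vol_nonneg)
  ultimately show ?thesis using that by blast
qed

section \<open>Domains with smooth boundary\<close>

text \<open>Only first order information is kept from the defining function: by continuity of the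
  derivative, \<rho> is Lipschitz near \<open>p\<close> and decreases at a fixed rate in one fixed
  direction \<open>v\<close>. Both the inner balls and the strip estimate follow from these two
  bounds.\<close>

lemma smooth_boundary_chart:
  fixes U :: "'a::euclidean_space set"
  assumes U: "open_smooth_boundary U" and p: "p \<in> frontier U"
  obtains R c L v \<rho> where "R > 0" "c > 0" "L > 0" "(v::'a) \<noteq> 0"
    "\<And>x. x \<in> ball p R \<Longrightarrow> x \<in> U \<longleftrightarrow> \<rho> x < (0::real)"
    "continuous_on (ball p R) \<rho>"
    "\<And>x y. x \<in> ball p R \<Longrightarrow> y \<in> ball p R \<Longrightarrow> \<bar>\<rho> x - \<rho> y\<bar> \<le> L * norm (x - y)"
    "\<And>x t. 0 \<le> t \<Longrightarrow> x \<in> ball p R \<Longrightarrow> x + t *\<^sub>R v \<in> ball p R \<Longrightarrow> \<rho> (x + t *\<^sub>R v) \<le> \<rho> x - c * t"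
proof -
  obtain W \<rho> v0 where W: "open W" "p \<in> W" and sm: "smooth_on W (\<rho> :: 'a \<Rightarrow> real)"
    and v0: "frechet_derivative \<rho> (at p) v0 \<noteq> 0" and UW: "U \<inter> W = {x \<in> W. \<rho> x < 0}"
    using U p unfolding open_smooth_boundary_def by blast
  define D where "D x = frechet_derivative \<rho> (at x)" for x
  have "Ck_on (Suc 0) W \<rho>" using sm by (simp add: smooth_on_def)
  then have dif: "\<And>x. x \<in> W \<Longrightarrow> \<rho> differentiable (at x)" and cD: "\<And>v. continuous_on W (\<lambda>x. D x v)"
    by (auto simp: D_def)
  have hd: "(\<rho> has_derivative D x) (at x)" if "x \<in> W" for x
    using dif[OF that] frechet_derivative_works unfolding D_def by blast
  have lin: "linear (D x)" if "x \<in> W" for x using hd[OF that] by (rule has_derivative_linear)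
  define v where "v = (if D p v0 < 0 then v0 else - v0)"
  have Dv: "D p v < 0" using v0 linear_neg[OF lin[OF W(2)], of v0] by (auto simp: v_def D_def)
  have v: "v \<noteq> 0" using Dv linear_0[OF lin[OF W(2)]] by auto
  \<comment> \<open>Half of the slope at \<open>p\<close>, so that by continuity the slope stays
    below \<open>- c\<close> on a whole neighbourhood.\<close>
  define c where "c = - D p v / 2"
  have c: "c > 0" "D p v < - c" using Dv by (auto simp: c_def)
  define L where "L = (\<Sum>b\<in>Basis. \<bar>D p b\<bar> + 1)"
  have L: "L > 0" unfolding L_def by (intro sum_pos) (auto intro: add_nonneg_pos)
  have tend: "((\<lambda>x. D x w) \<longlongrightarrow> D p w) (nhds p)" for w
  proof -
    have "(\<lambda>x. D x w) \<midarrow>p\<rightarrow> D p w"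
      using cD[of w] W(2) unfolding continuous_on_eq_continuous_at[OF W(1)] isCont_def by blast
    then show ?thesis using tendsto_at_iff_tendsto_nhds[of "\<lambda>x. D x w" p] by simp
  qed
  have ev1: "eventually (\<lambda>x. D x v < - c) (nhds p)"
    by (rule order_tendstoD(2)[OF tend c(2)])
  have ev2: "eventually (\<lambda>x. \<forall>b\<in>Basis. \<bar>D x b\<bar> < \<bar>D p b\<bar> + 1) (nhds p)"
    by (intro eventually_ball_finite ballI order_tendstoD(2)[OF tendsto_rabs[OF tend]]) auto
  have "eventually (\<lambda>x. x \<in> W \<and> D x v < - c \<and> (\<forall>b\<in>Basis. \<bar>D x b\<bar> < \<bar>D p b\<bar> + 1)) (nhds p)"
    using eventually_nhds_in_open[OF W] ev1 ev2 by eventually_elim auto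
  then obtain R where R: "R > 0" "\<And>x. x \<in> ball p R \<Longrightarrow> x \<in> W" "\<And>x. x \<in> ball p R \<Longrightarrow> D x v < - c"
    "\<And>x b. x \<in> ball p R \<Longrightarrow> b \<in> Basis \<Longrightarrow> \<bar>D x b\<bar> < \<bar>D p b\<bar> + 1"
    unfolding eventually_nhds_metric by (auto simp: dist_commute)
  have Dle: "\<bar>D x w\<bar> \<le> L * norm w" if x: "x \<in> ball p R" for x w
  proof -
    have "D x w = D x (\<Sum>b\<in>Basis. (w \<bullet> b) *\<^sub>R b)" by (simp add: euclidean_representation)
    also have "\<dots> = (\<Sum>b\<in>Basis. (w \<bullet> b) * D x b)"
      using lin[OF R(2)[OF x]] by (simp add: linear_sum linear_cmul)
    finally have "\<bar>D x w\<bar> \<le> (\<Sum>b\<in>Basis. \<bar>(w \<bullet> b) * D x b\<bar>)" by simp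
    also have "\<dots> \<le> (\<Sum>b\<in>Basis. norm w * (\<bar>D p b\<bar> + 1))"
      unfolding abs_mult using R(4)[OF x] by (intro sum_mono mult_mono Basis_le_norm) (auto intro: less_imp_le)
    finally show ?thesis by (simp add: L_def sum_distrib_left[symmetric] mult.commute)
  qed
  have lip: "\<bar>\<rho> x - \<rho> y\<bar> \<le> L * norm (x - y)" if "x \<in> ball p R" "y \<in> ball p R" for x y
  proof -
    have "norm (\<rho> x - \<rho> y) \<le> L * norm (x - y)"
    proof (rule differentiable_bound[where S = "ball p R" and f' = D])
      show "(\<rho> has_derivative D x) (at x within ball p R)" if "x \<in> ball p R" for x
        using hd[OF R(2)[OF that]] by (rule has_derivative_at_withinI)
      show "onorm (D x) \<le> L" if "x \<in> ball p R" for x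
        by (rule onorm_bound) (use Dle[OF that] L in auto)
    qed (use that in auto)
    then show ?thesis by simp
  qed
  have dec: "\<rho> (x + t *\<^sub>R v) \<le> \<rho> x - c * t" if t: "0 \<le> t" and x: "x \<in> ball p R" and xt: "x + t *\<^sub>R v \<in> ball p R" for x t
  proof (cases "t = 0")
    case False
    have seg: "x + s *\<^sub>R v \<in> ball p R" if "0 \<le> s" "s \<le> t" for s
    proof -
      have eq: "x + s *\<^sub>R v = (1 - s / t) *\<^sub>R x + (s / t) *\<^sub>R (x + t *\<^sub>R v)"
        using False by (simp add: algebra_simps)
      show ?thesis unfolding eq
        by (rule convexD[OF convex_ball x xt]) (use that t False in \<open>auto simp: divide_simps\<close>)
    qed
    have "\<exists>z. 0 < z \<and> z < t \<and> \<rho> (x + t *\<^sub>R v) - \<rho> (x + 0 *\<^sub>R v) = (t - 0) * D (x + z *\<^sub>R v) v"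
    proof (rule MVT2)
      show "0 < t" using t False by simp
      show "((\<lambda>t. \<rho> (x + t *\<^sub>R v)) has_real_derivative D (x + s *\<^sub>R v) v) (at s)" if "0 \<le> s" "s \<le> t" for s
        by (rule has_real_derivative_along_line) (rule hd[OF R(2)[OF seg[OF that]]])
    qed
    then obtain z where z: "0 < z" "z < t" "\<rho> (x + t *\<^sub>R v) - \<rho> x = t * D (x + z *\<^sub>R v) v" by auto
    have "t * D (x + z *\<^sub>R v) v \<le> t * (- c)"
      using R(3)[OF seg, of z] z t by (intro mult_left_mono) auto
    then show ?thesis using z(3) by (simp add: mult.commute)
  qed simp
  have cont: "continuous_on (ball p R) \<rho>"
    using hd R(2) by (meson continuous_at_imp_continuous_on has_derivative_continuous)
  have mem: "x \<in> U \<longleftrightarrow> \<rho> x < 0" if "x \<in> ball p R" for x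
    using UW R(2)[OF that] by blast
  show ?thesis by (rule that[OF R(1) c(1) L v mem cont lip dec])
qed

text \<open>Where \<rho> is positive, a whole neighbourhood misses \<open>U\<close>.\<close>

lemma closure_subset_sublevel:
  fixes U :: "'a::euclidean_space set"
  assumes mem: "\<And>x. x \<in> ball p R \<Longrightarrow> x \<in> U \<longleftrightarrow> \<rho> x < (0::real)" and cont: "continuous_on (ball p R) \<rho>"
    and x: "x \<in> ball p R" "x \<in> closure U"
  shows "\<rho> x \<le> 0"
proof (rule ccontr)
  assume "\<not> \<rho> x \<le> 0"
  then have "0 < \<rho> x" by simp
  have "open {y \<in> ball p R. 0 < \<rho> y}"
    using continuous_open_preimage[OF cont open_ball, of "{0<..}"] by (simp add: vimage_def Int_def)
  then have "{y \<in> ball p R. 0 < \<rho> y} \<inter> U \<noteq> {}"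
    using x \<open>0 < \<rho> x\<close> open_Int_closure_eq_empty by blast
  then show False using mem by force
qed

text \<open>Moving \<open>x\<close> by \<open>a * \<delta>\<close> along \<open>v\<close> lowers
  \<rho> by at least \<open>c * a * \<delta>\<close>. As \<open>c * a > L\<close>, this exceeds the
  variation \<open>L * \<delta>\<close> of \<rho> from the centre of a ball of radius \<delta>, so
  that ball stays in \<open>U\<close>.\<close>

lemma interior_corkscrew_local:
  fixes U :: "'a::euclidean_space set"
  assumes U: "open_smooth_boundary U" and p: "p \<in> closure U"
  obtains r A d where "r > 0" "A > 0" "d > 0"
    "\<And>x \<delta>. 0 < \<delta> \<Longrightarrow> \<delta> < d \<Longrightarrow> x \<in> closure U \<Longrightarrow> x \<in> ball p r \<Longrightarrow> \<exists>q. norm (q - x) \<le> A * \<delta> \<and> cball q \<delta> \<subseteq> U"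
proof (cases "p \<in> U")
  case True
  have "open U" using U by (simp add: open_smooth_boundary_def)
  then obtain e where e: "e > 0" "ball p e \<subseteq> U" using True openE by blast
  show ?thesis
  proof (rule that[of "e / 2" 1 "e / 2"])
    fix x \<delta> assume x: "0 < \<delta>" "\<delta> < e / 2" "x \<in> ball p (e / 2)"
    have "cball x \<delta> \<subseteq> ball p e"
    proof
      fix y assume "y \<in> cball x \<delta>"
      then show "y \<in> ball p e" using x dist_triangle[of p y x] by auto
    qed
    then show "\<exists>q. norm (q - x) \<le> 1 * \<delta> \<and> cball q \<delta> \<subseteq> U" using e(2) x(1) by (intro exI[of _ x]) auto
  qed (use e in auto)
next
  case False
  have "open U" using U by (simp add: open_smooth_boundary_def)
  then have "p \<in> frontier U" using p False by (simp add: frontier_def interior_open)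
  from smooth_boundary_chart[OF U this]
  obtain R c L v \<rho> where R: "R > 0" "c > 0" "L > 0" "v \<noteq> 0"
    and mem: "\<And>x. x \<in> ball p R \<Longrightarrow> x \<in> U \<longleftrightarrow> \<rho> x < (0::real)"
    and cont: "continuous_on (ball p R) \<rho>"
    and lip: "\<And>x y. x \<in> ball p R \<Longrightarrow> y \<in> ball p R \<Longrightarrow> \<bar>\<rho> x - \<rho> y\<bar> \<le> L * norm (x - y)"
    and dec: "\<And>x t. 0 \<le> t \<Longrightarrow> x \<in> ball p R \<Longrightarrow> x + t *\<^sub>R v \<in> ball p R \<Longrightarrow> \<rho> (x + t *\<^sub>R v) \<le> \<rho> x - c * t"
    by metis
  define a where "a = 2 * L / c"
  have a: "a > 0" "c * a > L" using R by (auto simp: a_def)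
  have nv: "norm v > 0" using R by simp
  \<comment> \<open>Chosen so that shift and radius together stay below \<open>R / 2\<close>, which
    keeps everything inside the chart.\<close>
  define d where "d = R / (2 * (a * norm v + 1))"
  have pos: "a * norm v + 1 > 0" using a nv by (simp add: add_pos_pos)
  show ?thesis
  proof (rule that[of "R / 2" "a * norm v" d])
    show "d > 0" unfolding d_def using R pos by simp
    fix x \<delta> assume \<delta>: "0 < \<delta>" "\<delta> < d" and x: "x \<in> closure U" "x \<in> ball p (R / 2)"
    define q where "q = x + (a * \<delta>) *\<^sub>R v"
    have small: "a * \<delta> * norm v + \<delta> < R / 2"
    proof -
      have "\<delta> * (a * norm v + 1) < d * (a * norm v + 1)" using \<delta> pos by (intro mult_strict_right_mono)
      also have "\<dots> = R / 2" using pos less_imp_neq[OF pos] unfolding d_def by (metis divide_divide_eq_left nonzero_eq_divide_eq mult.commute)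
      finally show ?thesis by (simp add: algebra_simps)
    qed
    have qx: "norm (q - x) = a * norm v * \<delta>" using a \<delta> by (simp add: q_def)
    have xR: "x \<in> ball p R" using x(2) R(1) by auto
    have dqx: "dist x q = a * norm v * \<delta>" using qx by (simp add: dist_norm norm_minus_commute)
    have qR: "q \<in> ball p R" using dist_triangle[of p q x] dqx small x(2) \<delta> by (simp add: mult_ac)
    have "\<rho> q \<le> \<rho> x - c * (a * \<delta>)" unfolding q_def
      by (rule dec) (use a \<delta> xR qR q_def in auto)
    moreover have "\<rho> x \<le> 0" by (rule closure_subset_sublevel[OF mem cont xR x(1)])
    ultimately have \<rho>q: "\<rho> q \<le> - (c * a) * \<delta>" by (simp add: mult.assoc)
    have "cball q \<delta> \<subseteq> U"
    proof
      fix y assume y: "y \<in> cball q \<delta>"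
      have yR: "y \<in> ball p R"
        using dist_triangle[of p y x] dist_triangle[of x y q] dqx small x(2) y by (simp add: mult_ac)
      have "\<bar>\<rho> y - \<rho> q\<bar> \<le> L * norm (y - q)" by (rule lip[OF yR qR])
      also have "\<dots> \<le> L * \<delta>" using y R by (intro mult_left_mono) (auto simp: dist_norm norm_minus_commute)
      finally have "\<rho> y \<le> (L - c * a) * \<delta>" using \<rho>q by (simp add: algebra_simps)
      also have "\<dots> < 0" using a \<delta> by (simp add: mult_neg_pos)
      finally show "y \<in> U" using mem[OF yR] by simp
    qed
    then show "\<exists>q. norm (q - x) \<le> a * norm v * \<delta> \<and> cball q \<delta> \<subseteq> U" using qx by (intro exI[of _ q]) simp
  qed (use R a nv in auto)
qed

text \<open>A finite cover makes the constants uniform: the largest factor and the smallest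
  threshold. The inserted 1 keeps \<open>Max\<close> and \<open>Min\<close> meaningful for an empty
  cover.\<close>

lemma interior_corkscrew:
  fixes U :: "'a::euclidean_space set"
  assumes U: "open_smooth_boundary U" "bounded U"
  obtains A d where "A > 0" "d > 0"
    "\<And>x \<delta>. 0 < \<delta> \<Longrightarrow> \<delta> < d \<Longrightarrow> x \<in> closure U \<Longrightarrow> \<exists>q. norm (q - x) \<le> A * \<delta> \<and> cball q \<delta> \<subseteq> U"
proof -
  have "\<exists>r A d. r > 0 \<and> A > 0 \<and> d > 0 \<and> (\<forall>x \<delta>. 0 < \<delta> \<longrightarrow> \<delta> < d \<longrightarrow> x \<in> closure U \<longrightarrow> x \<in> ball p r \<longrightarrow> (\<exists>q. norm (q - x) \<le> A * \<delta> \<and> cball q \<delta> \<subseteq> U))"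
    if "p \<in> closure U" for p
    using interior_corkscrew_local[OF U(1) that] by metis
  then obtain r A d where loc: "\<And>p. p \<in> closure U \<Longrightarrow> r p > 0 \<and> A p > 0 \<and> d p > (0::real)"
    "\<And>p x \<delta>. p \<in> closure U \<Longrightarrow> 0 < \<delta> \<Longrightarrow> \<delta> < d p \<Longrightarrow> x \<in> closure U \<Longrightarrow> x \<in> ball p (r p) \<Longrightarrow> \<exists>q. norm (q - x) \<le> A p * \<delta> \<and> cball q \<delta> \<subseteq> U"
    by metis
  have "compact (closure U)" using U(2) by (simp add: compact_closure)
  moreover have "closure U \<subseteq> (\<Union>p\<in>closure U. ball p (r p))" using loc(1) by force
  ultimately obtain P where P: "P \<subseteq> closure U" "finite P" "closure U \<subseteq> (\<Union>p\<in>P. ball p (r p))"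
    using compactE_image[of "closure U" "closure U" "\<lambda>p. ball p (r p)"] by (metis open_ball)
  show ?thesis
  proof (rule that[of "Max (insert 1 (A ` P))" "Min (insert 1 (d ` P))"])
    show "0 < Max (insert 1 (A ` P))" using P(2) by (subst Max_gr_iff) auto
    show "0 < Min (insert 1 (d ` P))" using P(1,2) loc(1) by (subst Min_gr_iff) auto
    fix x \<delta> assume \<delta>: "0 < \<delta>" "\<delta> < Min (insert 1 (d ` P))" and x: "x \<in> closure U"
    obtain p where p: "p \<in> P" "x \<in> ball p (r p)" using P(3) x by blast
    have "\<delta> < d p" using \<delta>(2) P(2) p(1) by (subst (asm) Min_gr_iff) auto
    then obtain q where q: "norm (q - x) \<le> A p * \<delta>" "cball q \<delta> \<subseteq> U" using loc(2)[of p \<delta> x] p P(1) \<delta> x by blast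
    have "A p \<le> Max (insert 1 (A ` P))" using P(2) p(1) by (intro Max_ge) auto
    then have "A p * \<delta> \<le> Max (insert 1 (A ` P)) * \<delta>" using \<delta> by (intro mult_right_mono) auto
    then show "\<exists>q. norm (q - x) \<le> Max (insert 1 (A ` P)) * \<delta> \<and> cball q \<delta> \<subseteq> U" using q by force
  qed
qed

text \<open>Disjoint translates of the strip around the boundary, along the direction of the chart,
  bound its volume.\<close>

lemma boundary_strip_local:
  fixes U :: "'a::euclidean_space set"
  assumes U: "open_smooth_boundary U" and p: "p \<in> frontier U"
  obtains r C h0 where "r > 0" "C \<ge> 0" "h0 > 0"
    "\<And>h. 0 < h \<Longrightarrow> h < h0 \<Longrightarrow> \<exists>T\<in>sets borel. {x \<in> ball p r. \<exists>y\<in>frontier U. dist x y \<le> h} \<subseteq> T \<and> emeasure lborel T \<le> ennreal (C * h)"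
proof -
  from smooth_boundary_chart[OF U p]
  obtain R c L v \<rho> where R: "R > 0" "c > 0" "L > 0" "v \<noteq> 0"
    and mem: "\<And>x. x \<in> ball p R \<Longrightarrow> x \<in> U \<longleftrightarrow> \<rho> x < (0::real)"
    and cont: "continuous_on (ball p R) \<rho>"
    and lip: "\<And>x y. x \<in> ball p R \<Longrightarrow> y \<in> ball p R \<Longrightarrow> \<bar>\<rho> x - \<rho> y\<bar> \<le> L * norm (x - y)"
    and dec: "\<And>x t. 0 \<le> t \<Longrightarrow> x \<in> ball p R \<Longrightarrow> x + t *\<^sub>R v \<in> ball p R \<Longrightarrow> \<rho> (x + t *\<^sub>R v) \<le> \<rho> x - c * t"
    by metis
  have oU: "open U" using U by (simp add: open_smooth_boundary_def)
  have nv: "norm v > 0" using R by simp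
  define k where "k = 3 * L * norm v / c"
  have k: "k > 0" using R nv by (simp add: k_def)
  define B where "B = measure lborel (ball p R)"
  define C where "C = B * (4 * k / R)"
  have fr0: "\<rho> y = 0" if "y \<in> frontier U" "y \<in> ball p R" for y
  proof -
    have "y \<in> closure U" "y \<notin> U" using that oU by (auto simp: frontier_def interior_open)
    then show ?thesis using closure_subset_sublevel[OF mem cont that(2)] mem[OF that(2)] by auto
  qed
  show ?thesis
  proof (rule that[of "R / 2" C "min (R / 2) (R / (4 * k))"])
    show "0 < min (R / 2) (R / (4 * k))" using R k by simp
    show "0 \<le> C" using R k by (simp add: C_def B_def)
    fix h assume h: "0 < h" "h < min (R / 2) (R / (4 * k))"
    \<comment> \<open>One step along \<open>v\<close> lowers \<rho> by at least
      \<open>3 * L * h\<close>, more than the oscillation \<open>2 * L * h\<close> allowed on the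
      strip; hence the translates are disjoint.\<close>
    define s where "s = 3 * L * h / c"
    have s: "s > 0" "s * norm v = k * h" using R h by (auto simp: s_def k_def)
    define T where "T = {x \<in> cball p (R / 2). \<bar>\<rho> x\<bar> \<le> L * h}"
    have sub: "{x \<in> ball p (R / 2). \<exists>y\<in>frontier U. dist x y \<le> h} \<subseteq> T"
    proof safe
      fix x y assume x: "x \<in> ball p (R / 2)" and y: "y \<in> frontier U" "dist x y \<le> h"
      have yR: "y \<in> ball p R" using dist_triangle[of p y x] x y h by simp
      have "\<bar>\<rho> x - \<rho> y\<bar> \<le> L * norm (x - y)" using x R by (intro lip yR) auto
      also have "\<dots> \<le> L * h" using y R by (intro mult_left_mono) (auto simp: dist_norm)
      finally show "x \<in> T" using fr0[OF y(1) yR] x by (simp add: T_def)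
    qed
    have TR: "T \<subseteq> ball p R" using R by (auto simp: T_def)
    have "closed T"
    proof -
      have "continuous_on (cball p (R / 2)) (\<lambda>x. \<bar>\<rho> x\<bar>)"
        using R by (intro continuous_intros continuous_on_subset[OF cont]) auto
      from continuous_closed_preimage[OF this closed_cball, of "{..L * h}"]
      show ?thesis by (simp add: T_def vimage_def Int_def)
    qed
    then have Tb: "T \<in> sets borel" by simp
    \<comment> \<open>The number of steps of length \<open>k * h\<close> that fit into
      \<open>R / 2\<close>.\<close>
    define n where "n = nat \<lfloor>R / (2 * k * h)\<rfloor>"
    have nn: "real n * (k * h) \<le> R / 2" "R / (4 * k * h) \<le> real n"
    proof -
      \<comment> \<open>A number that is at least 2 loses at most half of itself when rounded down,
        which gives the second bound.\<close>
      have big: "R / (2 * k * h) \<ge> 2" using h k by (simp add: field_simps)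
      then have rn: "real n = of_int \<lfloor>R / (2 * k * h)\<rfloor>" by (simp add: n_def)
      have "real n \<le> R / (2 * k * h)" unfolding rn by simp
      then show "real n * (k * h) \<le> R / 2" using k h by (simp add: field_simps)
      have "R / (2 * k * h) - 1 \<le> real n" unfolding rn by linarith
      then show "R / (4 * k * h) \<le> real n" using big by (simp add: field_simps)
    qed
    define Ti where "Ti i = (\<lambda>x. x + (real i * s) *\<^sub>R v) ` T" for i :: nat
    have TiE: "emeasure lborel (Ti i) = emeasure lborel T" for i
      unfolding Ti_def by (rule emeasure_lborel_translate[OF Tb])
    have Tim: "Ti i \<in> sets lborel" for i
    proof -
      have "Ti i = (\<lambda>x. x - (real i * s) *\<^sub>R v) -` T"
        by (auto simp: Ti_def image_iff intro!: bexI[of _ "_ - (real i * s) *\<^sub>R v"])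
      moreover have "(\<lambda>x. x - (real i * s) *\<^sub>R v) -` T \<in> sets borel"
        by (rule measurable_sets_borel[OF _ Tb]) simp
      ultimately show ?thesis by simp
    qed
    have Tisub: "Ti i \<subseteq> ball p R" if "i < n" for i
    proof
      fix x assume "x \<in> Ti i"
      then obtain y where y: "y \<in> T" "x = y + (real i * s) *\<^sub>R v" by (auto simp: Ti_def)
      have "norm ((real i * s) *\<^sub>R v) = real i * (k * h)" using s by (simp add: abs_mult mult.assoc)
      also have "\<dots> < real n * (k * h)" using that k h by simp
      finally have "norm ((real i * s) *\<^sub>R v) < R / 2" using nn(1) by linarith
      then have "dist y x < R / 2" using y(2) by (simp add: dist_norm)
      moreover have "dist p y \<le> R / 2" using y(1) by (simp add: T_def)
      ultimately show "x \<in> ball p R" using dist_triangle[of p x y] by simp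
    qed
    have apart: False if "i < j" "x \<in> T" "y \<in> T" "x + (real i * s) *\<^sub>R v = y + (real j * s) *\<^sub>R v" for i j :: nat and x y
    proof -
      have ij: "real j - real i \<ge> 1" using that(1) by linarith
      have x: "x = y + ((real j - real i) * s) *\<^sub>R v"
        using that(4) by (simp add: algebra_simps)
      have "\<rho> x \<le> \<rho> y - c * ((real j - real i) * s)"
        unfolding x by (rule dec) (use that TR s ij x in auto)
      moreover have "1 * (c * s) \<le> (real j - real i) * (c * s)" using ij R s by (intro mult_right_mono) auto
      moreover have "c * s = 3 * (L * h)" using R by (simp add: s_def)
      moreover have "c * ((real j - real i) * s) = (real j - real i) * (c * s)" by simp
      ultimately have "\<rho> x \<le> \<rho> y - 3 * (L * h)" by linarith
      moreover have "L * h > 0" using R h by simp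
      ultimately show False using that(2,3) by (auto simp: T_def)
    qed
    have disj: "disjoint_family_on Ti {..<n}"
      unfolding disjoint_family_on_def Ti_def
    proof (intro ballI impI equals0I)
      fix i j z assume "i \<noteq> j" "z \<in> (\<lambda>x. x + (real i * s) *\<^sub>R v) ` T \<inter> (\<lambda>x. x + (real j * s) *\<^sub>R v) ` T"
      then obtain x y where "x \<in> T" "y \<in> T" "x + (real i * s) *\<^sub>R v = y + (real j * s) *\<^sub>R v" by blast
      then show False using \<open>i \<noteq> j\<close> apart[of i j x y] apart[of j i y x] by (metis linorder_neqE_nat)
    qed
    have "of_nat n * emeasure lborel T = (\<Sum>i<n. emeasure lborel (Ti i))" by (simp add: TiE)
    also have "\<dots> = emeasure lborel (\<Union>i<n. Ti i)"
      by (rule sum_emeasure) (use Tim disj in auto)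
    also have "\<dots> \<le> emeasure lborel (ball p R)"
      by (rule emeasure_mono) (use Tisub in auto)
    also have "\<dots> = ennreal B"
      unfolding B_def using emeasure_lborel_ball_finite[of p R] by (simp add: emeasure_eq_ennreal_measure)
    finally have nT: "of_nat n * emeasure lborel T \<le> ennreal B" by simp
    have Tfin: "emeasure lborel T = ennreal (measure lborel T)"
    proof -
      have "emeasure lborel T \<le> emeasure lborel (ball p R)" by (rule emeasure_mono[OF TR]) simp
      then show ?thesis using emeasure_lborel_ball_finite[of p R]
        by (intro emeasure_eq_ennreal_measure) auto
    qed
    have "real n * measure lborel T \<le> B"
      using nT unfolding Tfin ennreal_of_nat_eq_real_of_nat by (simp add: ennreal_mult[symmetric] B_def ennreal_le_iff)
    moreover have "R / (4 * k * h) * measure lborel T \<le> real n * measure lborel T"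
      using nn(2) by (intro mult_right_mono) auto
    ultimately have "R / (4 * k * h) * measure lborel T \<le> B" by linarith
    then have "measure lborel T \<le> C * h" using R k h by (simp add: C_def field_simps)
    then have "emeasure lborel T \<le> ennreal (C * h)" unfolding Tfin by (rule ennreal_leI)
    with sub Tb show "\<exists>T\<in>sets borel. {x \<in> ball p (R / 2). \<exists>y\<in>frontier U. dist x y \<le> h} \<subseteq> T \<and> emeasure lborel T \<le> ennreal (C * h)"
      by blast
  qed (use R in auto)
qed

lemma boundary_strip:
  fixes U :: "'a::euclidean_space set"
  assumes U: "open_smooth_boundary U" "bounded U"
  obtains C h0 where "C \<ge> 0" "h0 > 0"
    "\<And>h. 0 < h \<Longrightarrow> h < h0 \<Longrightarrow> \<exists>T\<in>sets borel. {x. \<exists>y\<in>frontier U. dist x y \<le> h} \<subseteq> T \<and> emeasure lborel T \<le> ennreal (C * h)"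
proof -
  define Q where "Q p r C h0 \<longleftrightarrow> r > 0 \<and> C \<ge> 0 \<and> h0 > 0 \<and> (\<forall>h. 0 < h \<longrightarrow> h < h0 \<longrightarrow> (\<exists>T\<in>sets borel. {x \<in> ball p r. \<exists>y\<in>frontier U. dist x y \<le> h} \<subseteq> T \<and> emeasure lborel T \<le> ennreal (C * h)))"
    for p r C and h0 :: real
  have "\<exists>r C h0. Q p r C h0" if "p \<in> frontier U" for p
    unfolding Q_def by (rule boundary_strip_local[OF U(1) that]) blast
  then obtain r C h0 where Q: "\<And>p. p \<in> frontier U \<Longrightarrow> Q p (r p) (C p) (h0 p)" by metis
  have loc: "p \<in> frontier U \<Longrightarrow> r p > 0 \<and> C p \<ge> 0 \<and> h0 p > (0::real)"
    "p \<in> frontier U \<Longrightarrow> 0 < h \<Longrightarrow> h < h0 p \<Longrightarrow> \<exists>T\<in>sets borel. {x \<in> ball p (r p). \<exists>y\<in>frontier U. dist x y \<le> h} \<subseteq> T \<and> emeasure lborel T \<le> ennreal (C p * h)" for p h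
    using Q[of p] unfolding Q_def by blast+
  have "compact (frontier U)" using U(2) by (simp add: compact_frontier_bounded)
  \<comment> \<open>Balls of half the radius already cover, and \<open>H\<close> is at most half of
    every radius, so the \<open>H\<close>-neighbourhood of the boundary stays in the full
    balls.\<close>
  moreover have "frontier U \<subseteq> (\<Union>p\<in>frontier U. ball p (r p / 2))" using loc(1) by force
  ultimately obtain P where P: "P \<subseteq> frontier U" "finite P" "frontier U \<subseteq> (\<Union>p\<in>P. ball p (r p / 2))"
    using compactE_image[of "frontier U" "frontier U" "\<lambda>p. ball p (r p / 2)"] by (metis open_ball)
  define H where "H = Min (insert 1 ((\<lambda>p. min (h0 p) (r p / 2)) ` P))"
  have H: "H \<le> h0 p" "H \<le> r p / 2" if "p \<in> P" for p
    using P(2) that Min_le[of "insert 1 ((\<lambda>p. min (h0 p) (r p / 2)) ` P)" "min (h0 p) (r p / 2)"] by (auto simp: H_def)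
  show ?thesis
  proof (rule that[of "\<Sum>p\<in>P. C p" H])
    show "0 \<le> (\<Sum>p\<in>P. C p)" using P(1) loc(1) by (intro sum_nonneg) auto
    show "0 < H" unfolding H_def using P(1,2) loc(1) by (subst Min_gr_iff) auto
    fix h assume h: "0 < h" "h < H"
    define X where "X p T \<longleftrightarrow> T \<in> sets borel \<and> {x \<in> ball p (r p). \<exists>y\<in>frontier U. dist x y \<le> h} \<subseteq> T \<and> emeasure lborel T \<le> ennreal (C p * h)" for p T
    have "\<forall>p\<in>P. \<exists>T. X p T"
    proof
      fix p assume "p \<in> P"
      then have "p \<in> frontier U" "h < h0 p" using P(1) H(1)[of p] h(2) by auto
      from loc(2)[OF this(1) h(1) this(2)] show "\<exists>T. X p T" unfolding X_def by blast
    qed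
    then obtain T where "\<forall>p\<in>P. X p (T p)" by (rule bchoice[THEN exE])
    then have T: "\<And>p. p \<in> P \<Longrightarrow> T p \<in> sets borel"
      "\<And>p. p \<in> P \<Longrightarrow> {x \<in> ball p (r p). \<exists>y\<in>frontier U. dist x y \<le> h} \<subseteq> T p"
      "\<And>p. p \<in> P \<Longrightarrow> emeasure lborel (T p) \<le> ennreal (C p * h)"
      unfolding X_def by auto
    have "{x. \<exists>y\<in>frontier U. dist x y \<le> h} \<subseteq> (\<Union>p\<in>P. T p)"
    proof safe
      fix x y assume y: "y \<in> frontier U" "dist x y \<le> h"
      obtain p where p: "p \<in> P" "y \<in> ball p (r p / 2)" using P(3) y(1) by blast
      have "dist p x < r p" using dist_triangle[of p x y] p y(2) h(2) H(2)[OF p(1)] by (simp add: dist_commute)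
      then show "x \<in> (\<Union>p\<in>P. T p)" using T(2)[OF p(1)] y p(1) by auto
    qed
    moreover have "emeasure lborel (\<Union>p\<in>P. T p) \<le> ennreal ((\<Sum>p\<in>P. C p) * h)"
    proof -
      have "emeasure lborel (\<Union>p\<in>P. T p) \<le> (\<Sum>p\<in>P. emeasure lborel (T p))"
        by (rule emeasure_subadditive_finite) (use P(2) T(1) in auto)
      also have "\<dots> \<le> (\<Sum>p\<in>P. ennreal (C p * h))" by (intro sum_mono T)
      also have "\<dots> = ennreal ((\<Sum>p\<in>P. C p) * h)"
        using P(1) loc(1) h unfolding sum_distrib_right by (intro sum_ennreal) auto
      finally show ?thesis .
    qed
    ultimately show "\<exists>T\<in>sets borel. {x. \<exists>y\<in>frontier U. dist x y \<le> h} \<subseteq> T \<and> emeasure lborel T \<le> ennreal ((\<Sum>p\<in>P. C p) * h)"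
      using T(1) P(2) by (intro bexI[of _ "\<Union>p\<in>P. T p"]) auto
  qed
qed

lemma frontier_null:
  fixes U :: "'a::euclidean_space set"
  assumes U: "open_smooth_boundary U" "bounded U"
  shows "frontier U \<in> null_sets lborel"
proof -
  obtain C h0 where C: "C \<ge> 0" "h0 > 0"
    "\<And>h. 0 < h \<Longrightarrow> h < h0 \<Longrightarrow> \<exists>T\<in>sets borel. {x. \<exists>y\<in>frontier U. dist x y \<le> h} \<subseteq> T \<and> emeasure lborel T \<le> ennreal (C * h)"
    by (rule boundary_strip[OF U]) (rule that; assumption)
  have "emeasure lborel (frontier U) \<le> ennreal e" if e: "e > 0" for e
  proof -
    define h where "h = min (h0 / 2) (e / (C + 1))"
    have h: "0 < h" "h < h0" using C e by (auto simp: h_def)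
    have "C * h \<le> C * (e / (C + 1))" using C by (intro mult_left_mono) (auto simp: h_def)
    also have "\<dots> \<le> e" using C e by (simp add: divide_simps)
    finally have Ch: "C * h \<le> e" .
    obtain T where T: "T \<in> sets borel" "{x. \<exists>y\<in>frontier U. dist x y \<le> h} \<subseteq> T" "emeasure lborel T \<le> ennreal (C * h)"
      using C(3)[OF h] by blast
    have "frontier U \<subseteq> T" using T(2) h by force
    then have "emeasure lborel (frontier U) \<le> emeasure lborel T" using T(1) by (intro emeasure_mono) auto
    then show ?thesis using T(3) Ch by (meson ennreal_leI order_trans)
  qed
  then have "emeasure lborel (frontier U) \<le> 0"
    by (rule_tac ennreal_le_epsilon) simp
  then show ?thesis by (simp add: null_sets_def)
qed

lemma finite_perimeter:
  fixes U :: "'a::euclidean_space set"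
  assumes U: "open_smooth_boundary U" "bounded U"
  obtains c where "per_bound U c"
proof -
  obtain C h0 where C: "C \<ge> 0" "h0 > 0"
    "\<And>h. 0 < h \<Longrightarrow> h < h0 \<Longrightarrow> \<exists>T\<in>sets borel. {x. \<exists>y\<in>frontier U. dist x y \<le> h} \<subseteq> T \<and> emeasure lborel T \<le> ennreal (C * h)"
    by (rule boundary_strip[OF U]) (rule that; assumption)
  have "U \<in> sets borel" using U by (simp add: open_smooth_boundary_def)
  from per_bound_Minkowski_content[OF this C] that show ?thesis by blast
qed

text \<open>Submodularity confines an open set close to \<^term>\<open>E \<subseteq> closure U\<close> to \<^term>\<open>U\<close>: since the union of the
  open set with \<^term>\<open>U\<close> is close to \<^term>\<open>U\<close>, lower semicontinuity makes the perimeter of that union almost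
  as large as that of \<^term>\<open>U\<close>.\<close>

lemma open_approximation:
  fixes U E :: "'a::euclidean_space set"
  assumes U: "open_smooth_boundary U" "bounded U" and E: "E \<in> sets borel" "E \<subseteq> closure U" "per_bound E c"
    and e: "e > 0"
  obtains G where "open G" "G \<subseteq> U" "per_bound G (c + e)"
    "emeasure lborel ((G - E) \<union> (E - G)) \<le> ennreal e"
proof -
  have oU: "open U" using U by (simp add: open_smooth_boundary_def)
  have Ub: "U \<in> sets borel" using oU by simp
  have Ebd: "bounded E" using E(2) U(2) by (meson bounded_closure bounded_subset)
  have c0: "c \<ge> 0" by (rule per_bound_nonneg[OF E(3)])
  obtain cU where cU: "per_bound U cU" by (rule finite_perimeter[OF U])
  \<comment> \<open>\<open>P\<close> will be the perimeter of \<open>U\<close> as a real number. One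
    fixed field \<open>\<psi>\<close> attains it up to \<open>e / 4\<close>, and the union is tested
    against that field.\<close>
  define SU where "SU = {\<integral>x. indicator U x * divergence \<psi> x \<partial>lborel |\<psi>. \<psi> \<in> admissible_fields}"
  define P where "P = Sup SU"
  have SU: "SU \<noteq> {}" "bdd_above SU"
    using zero_admissible cU unfolding SU_def per_bound_def bdd_above_def by blast+
  have UP: "per_bound U P"
    unfolding per_bound_def P_def using cSup_upper[OF _ SU(2)] by (auto simp: SU_def)
  have "P - e / 4 < Sup SU" using e by (simp add: P_def)
  then obtain z where z: "z \<in> SU" "P - e / 4 < z" using less_cSup_iff[OF SU] by blast
  then obtain \<psi> where \<psi>: "\<psi> \<in> admissible_fields" "P - e / 4 < (\<integral>x. indicator U x * divergence \<psi> x \<partial>lborel)"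
    by (auto simp: SU_def)
  obtain M where M: "M \<ge> 0" "\<And>x. \<bar>divergence \<psi> x\<bar> \<le> M" using divergence_bounded_support[OF \<psi>(1)] by metis
  \<comment> \<open>Levels are taken between \<theta> and \<open>1 - \<theta>\<close>. The shorter
    interval costs a factor in the perimeter of the level set, so \<theta> is small relative to
    \<open>e / (c + e)\<close>. The distance \<theta> from the values 0 and 1 turns an L1 error
    \<open>\<theta> * e1\<close> into a volume error \<open>e1\<close>.\<close>
  define \<theta> where "\<theta> = min (1/4) (e / (8 * (c + e)))"
  have \<theta>: "0 < \<theta>" "\<theta> \<le> 1/4" using c0 e by (auto simp: \<theta>_def)
  have K: "c < (c + e / 2) * ((1 - \<theta>) - \<theta>)"
  proof -
    have "\<theta> \<le> e / (8 * (c + e))" by (simp add: \<theta>_def)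
    then have "8 * (c + e) * \<theta> \<le> e" using c0 e by (simp add: field_simps)
    moreover have "(c + e / 2) * \<theta> \<le> (c + e) * \<theta>" using \<theta> e by (intro mult_right_mono) auto
    moreover have "(c + e / 2) * ((1 - \<theta>) - \<theta>) = c + e / 2 - 2 * ((c + e / 2) * \<theta>)" by (simp add: algebra_simps)
    ultimately show ?thesis using e by linarith
  qed
  define e1 where "e1 = min e (e / (4 * M + 1))"
  have e1: "0 < e1" "e1 \<le> e" "M * e1 \<le> e / 4"
  proof -
    show "0 < e1" "e1 \<le> e" using e M(1) by (auto simp: e1_def)
    have "M * e1 \<le> M * (e / (4 * M + 1))" using M(1) by (intro mult_left_mono) (auto simp: e1_def)
    also have "\<dots> \<le> e / 4" using M(1) e by (simp add: divide_simps algebra_simps)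
    finally show "M * e1 \<le> e / 4" .
  qed
  have te: "\<theta> * e1 > 0" using \<theta> e1 by simp
  obtain u D R where u: "C1_grad u D" "\<And>x. 0 \<le> u x" "\<And>x. u x \<le> (1::real)"
    "integrable lborel (\<lambda>x. norm (D x))" "(\<integral>x. norm (D x) \<partial>lborel) \<le> c"
    "integrable lborel (\<lambda>x. \<bar>u x - indicator E x\<bar>)" "(\<integral>x. \<bar>u x - indicator E x\<bar> \<partial>lborel) \<le> \<theta> * e1"
    "\<And>x. x \<notin> cball 0 R \<Longrightarrow> u x = 0"
    by (rule smooth_approximation[OF E(1) Ebd E(3) te]) (rule that; assumption)
  obtain s where s: "\<theta> \<le> s" "s < 1 - \<theta>" "per_bound {x. s < u x} (c + e / 2)"
    by (rule superlevel_per_bound[OF u(1,4,5) _ K]) (use \<theta> in auto)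
  define F where "F = {x. s < u x}"
  have oF: "open F" unfolding F_def using C1_grad_continuous[OF u(1)] by (intro open_Collect_less continuous_intros)
  have Fb: "F \<in> sets borel" using oF by simp
  have "F \<subseteq> cball 0 R" using u(8) s(1) \<theta>(1) by (force simp: F_def)
  then have Fbd: "bounded F" by (rule bounded_subset[OF bounded_cball])
  define \<Delta> where "\<Delta> = (F - E) \<union> (E - F)"
  have \<Delta>b[measurable]: "\<Delta> \<in> sets borel" unfolding \<Delta>_def using Fb E(1) by auto
  have "(\<integral>\<^sup>+x. ennreal \<theta> * indicator \<Delta> x \<partial>lborel) \<le> (\<integral>\<^sup>+x. ennreal \<bar>u x - indicator E x\<bar> \<partial>lborel)"
  proof (intro nn_integral_mono)
    fix x
    show "ennreal \<theta> * indicator \<Delta> x \<le> ennreal \<bar>u x - indicator E x\<bar>"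
      using s(1,2) \<theta> by (auto simp: \<Delta>_def F_def indicator_def intro!: ennreal_leI)
  qed
  also have "\<dots> = ennreal (\<integral>x. \<bar>u x - indicator E x\<bar> \<partial>lborel)"
    by (rule nn_integral_eq_integral[OF u(6)]) simp
  also have "\<dots> \<le> ennreal (\<theta> * e1)" by (rule ennreal_leI[OF u(7)])
  finally have "ennreal \<theta> * emeasure lborel \<Delta> \<le> ennreal \<theta> * ennreal e1"
    using \<theta> e1 by (simp add: nn_integral_cmult ennreal_mult)
  then have \<Delta>e: "emeasure lborel \<Delta> \<le> ennreal e1"
    using \<theta> by (subst (asm) ennreal_mult_le_mult_iff) auto
  have fr: "frontier U \<in> null_sets lborel" by (rule frontier_null[OF U])
  have EU: "E - U \<subseteq> frontier U" using E(2) oU by (auto simp: frontier_def interior_open)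
  \<comment> \<open>\<open>F \<union> U\<close> and \<open>U\<close> differ only inside
    \<open>N\<close>: a point of \<open>F - U\<close> is either outside \<open>E\<close> or in
    \<open>E - U\<close>, which lies in the null frontier.\<close>
  define N where "N = \<Delta> \<union> frontier U"
  have Nb[measurable]: "N \<in> sets borel" unfolding N_def by auto
  have Ne: "emeasure lborel N \<le> ennreal e1"
  proof -
    have "emeasure lborel N = emeasure lborel \<Delta>" unfolding N_def by (rule emeasure_Un_null_set) (use fr in auto)
    then show ?thesis using \<Delta>e by simp
  qed
  define G where "G = F \<inter> U"
  show ?thesis
  proof (rule that[of G])
    show "open G" "G \<subseteq> U" using oF oU by (auto simp: G_def)
    have "(G - E) \<union> (E - G) \<subseteq> N" using EU by (auto simp: G_def N_def \<Delta>_def)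
    then have "emeasure lborel ((G - E) \<union> (E - G)) \<le> emeasure lborel N" by (rule emeasure_mono) simp
    then show "emeasure lborel ((G - E) \<union> (E - G)) \<le> ennreal e" using Ne e1(2) by (meson ennreal_leI order_trans)
    have Nfin: "emeasure lborel N < \<infinity>" using Ne by (simp add: le_less_trans)
    have iN: "integrable lborel (indicator N :: 'a \<Rightarrow> real)" using Nfin by simp
    have mN: "(\<integral>x. indicator N x \<partial>lborel) \<le> e1"
      using Ne e1(1) by (simp add: measure_def enn2real_leI)
    have "(\<integral>x. indicator U x * divergence \<psi> x \<partial>lborel)
       \<le> (\<integral>x. indicator (F \<union> U) x * divergence \<psi> x \<partial>lborel) + M * (\<integral>x. indicator N x \<partial>lborel)"
    proof (rule integral_divergence_perturb[OF \<psi>(1) M(2), where B = 1])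
      show "\<bar>indicator A x\<bar> \<le> (1::real)" for A :: "'a set" and x by (auto simp: indicator_def)
      then show "\<bar>indicator A x\<bar> \<le> (1::real)" for A :: "'a set" and x .
      fix x
      show "\<bar>indicator (F \<union> U) x - indicator U x\<bar> \<le> (indicator N x :: real)"
        using EU by (auto simp: N_def \<Delta>_def indicator_def)
    qed (use Fb Ub iN in auto)
    also have "M * (\<integral>x. indicator N x \<partial>lborel) \<le> e / 4"
      using mult_left_mono[OF mN M(1)] e1(3) by linarith
    finally have low: "P - e / 2 \<le> (\<integral>x. indicator (F \<union> U) x * divergence \<psi> x \<partial>lborel)"
      using \<psi>(2) by linarith
    show "per_bound G (c + e)"
      unfolding per_bound_def
    proof
      fix \<phi> :: "'a \<Rightarrow> 'a" assume \<phi>: "\<phi> \<in> admissible_fields"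
      show "(\<integral>x. indicator G x * divergence \<phi> x \<partial>lborel) \<le> c + e"
        using perimeter_submodular[OF Fb Fbd s(3)[folded F_def] Ub U(2) UP \<phi> \<psi>(1)] low
        unfolding G_def by linarith
    qed
  qed
qed

section \<open>Riesz potentials and compressed lattice cells\<close>

definition riesz_kernel :: "real \<Rightarrow> 'a::euclidean_space \<Rightarrow> ennreal" where
  "riesz_kernel \<alpha> z = 1 / ennreal (norm z powr \<alpha>)"

lemma riesz_energy_eq: "riesz_energy \<alpha> \<mu> = (\<integral>\<^sup>+x. (\<integral>\<^sup>+y. riesz_kernel \<alpha> (x - y) \<partial>\<mu>) \<partial>\<mu>)"
  by (simp add: riesz_energy_def riesz_kernel_def)

lemma measurable_riesz_kernel [measurable]: "riesz_kernel \<alpha> \<in> borel_measurable borel"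
  unfolding riesz_kernel_def[abs_def] by measurable

lemma riesz_kernel_0: "riesz_kernel \<alpha> 0 = \<infinity>"
  by (simp add: riesz_kernel_def ennreal_divide_zero)

lemma riesz_kernel_eq: "z \<noteq> 0 \<Longrightarrow> riesz_kernel \<alpha> z = ennreal (norm z powr - \<alpha>)"
  using divide_ennreal[of 1 "norm z powr \<alpha>"]
  by (simp add: riesz_kernel_def powr_minus inverse_eq_divide)

lemma riesz_kernel_le:
  assumes "0 < t" "t \<le> norm z" "0 < \<alpha>"
  shows "riesz_kernel \<alpha> z \<le> ennreal (t powr - \<alpha>)"
proof -
  have "z \<noteq> 0" using assms by auto
  then show ?thesis using assms by (simp add: riesz_kernel_eq ennreal_leI powr_mono2')
qed

lemma dyadic_shell:
  fixes n \<delta> :: real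
  assumes "0 < n" "n \<le> \<delta>"
  obtains k where "\<delta> / 2 ^ Suc k < n" "n \<le> \<delta> / 2 ^ k"
proof -
  have \<delta>: "\<delta> > 0" using assms by simp
  obtain j where "(1 / 2) ^ j < n / \<delta>" using real_arch_pow_inv[of "n / \<delta>" "1 / 2"] assms \<delta> by auto
  then have j: "\<delta> / 2 ^ j < n" using \<delta> by (simp add: power_divide field_simps)
  define j0 where "j0 = (LEAST j. \<delta> / 2 ^ j < n)"
  have 1: "\<delta> / 2 ^ j0 < n" unfolding j0_def by (rule LeastI[of "\<lambda>j. \<delta> / 2 ^ j < n", OF j])
  then have "j0 \<noteq> 0" using assms(2) by (intro notI) simp
  then obtain k where k: "j0 = Suc k" using not0_implies_Suc by blast
  have "\<not> \<delta> / 2 ^ k < n" using not_less_Least[of k "\<lambda>j. \<delta> / 2 ^ j < n"] k j0_def by auto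
  then show ?thesis using that[of k] 1 k by auto
qed

text \<open>On each dyadic shell a single summand dominates the kernel. At \<open>x = y\<close>
  every summand is at least \<open>\<delta> powr - \<alpha>\<close>, so the series diverges and the
  bound holds with both sides infinite.\<close>

lemma riesz_kernel_dyadic:
  fixes x y :: "'a::euclidean_space"
  assumes "0 < \<alpha>" "0 < \<delta>"
  shows "riesz_kernel \<alpha> (y - x) \<le> ennreal (\<delta> powr - \<alpha>) +
     (\<Sum>k. ennreal ((\<delta> / 2 ^ Suc k) powr - \<alpha>) * indicator (cball y (\<delta> / 2 ^ k)) x)" (is "_ \<le> _ + (\<Sum>k. ?f k)")
proof -
  have gen: "g k \<le> (\<Sum>k. g k)" for g :: "nat \<Rightarrow> ennreal" and k
    using sum_le_suminf[of g "{k}"] by (simp add: summableI)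
  have fk: "?f k \<le> (\<Sum>k. ?f k)" for k by (rule gen)
  consider "norm (y - x) \<ge> \<delta>" | "0 < norm (y - x)" "norm (y - x) \<le> \<delta>" | "x = y"
    by (cases "x = y") (auto simp: not_le less_imp_le intro: le_cases[of \<delta> "norm (y - x)"])
  then show ?thesis
  proof cases
    case 1
    have "riesz_kernel \<alpha> (y - x) \<le> ennreal (\<delta> powr - \<alpha>)" by (rule riesz_kernel_le) (use assms 1 in auto)
    then show ?thesis by (rule order_trans) simp
  next
    case 2
    obtain k where k: "\<delta> / 2 ^ Suc k < norm (y - x)" "norm (y - x) \<le> \<delta> / 2 ^ k" by (rule dyadic_shell[OF 2])
    have "riesz_kernel \<alpha> (y - x) \<le> ennreal ((\<delta> / 2 ^ Suc k) powr - \<alpha>)"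
      by (rule riesz_kernel_le) (use assms k in auto)
    also have "\<dots> = ?f k" using k(2) by (simp add: dist_norm)
    finally have "riesz_kernel \<alpha> (y - x) \<le> (\<Sum>k. ?f k)" using fk[of k] by (rule order_trans)
    then show ?thesis by (rule order_trans) simp
  next
    case 3
    define c where "c = \<delta> powr - \<alpha>"
    have c: "c > 0" using assms by (simp add: c_def)
    have ge: "ennreal c \<le> ?f k" for k
    proof -
      have "\<delta> / 2 ^ Suc k \<le> \<delta> / 1"
        using assms by (intro divide_left_mono one_le_power) auto
      then have "\<delta> powr - \<alpha> \<le> (\<delta> / 2 ^ Suc k) powr - \<alpha>"
        using assms by (intro powr_mono2') auto
      then show ?thesis using 3 assms by (simp add: c_def ennreal_leI)
    qed
    have "(\<Sum>k. ?f k) = top"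
    proof (rule ccontr)
      assume "(\<Sum>k. ?f k) \<noteq> top"
      then obtain r where r: "r \<ge> 0" "(\<Sum>k. ?f k) = ennreal r" by (cases "\<Sum>k. ?f k") auto
      obtain n :: nat where n: "r < real n * c" using reals_Archimedean3[OF c] by blast
      have "ennreal (real n * c) = (\<Sum>k<n. ennreal c)" using c by (simp add: ennreal_mult ennreal_of_nat_eq_real_of_nat)
      also have "\<dots> \<le> (\<Sum>k<n. ?f k)" by (intro sum_mono ge)
      also have "\<dots> \<le> (\<Sum>k. ?f k)" by (rule sum_le_suminf) (auto intro: summableI)
      finally show False using r n c by (simp add: ennreal_le_iff)
    qed
    then show ?thesis by simp
  qed
qed

text \<open>Integrated term by term, the dyadic bound and the Frostman condition leave a geometric
  series of ratio \<open>2 powr (\<alpha> - \<beta>)\<close>, convergent as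
  \<open>\<alpha> < \<beta>\<close>. The normalisation by \<open>t / \<delta>\<close> makes the
  factor in front of \<open>\<delta> powr - \<alpha>\<close> independent of the scale.\<close>

lemma potential_le:
  fixes s :: "'a::euclidean_space measure"
  assumes s: "emeasure s (space s) = 1" "sets s = sets borel" and \<alpha>: "0 < \<alpha>" "\<alpha> < \<beta>" and \<delta>: "0 < \<delta>" and C: "0 \<le> C"
    and frost: "\<And>t. 0 < t \<Longrightarrow> t \<le> \<delta> \<Longrightarrow> emeasure s (cball y t) \<le> ennreal (C * (t / \<delta>) powr \<beta>)"
  shows "(\<integral>\<^sup>+x. riesz_kernel \<alpha> (y - x) \<partial>s) \<le> ennreal ((1 + C * 2 powr \<alpha> / (1 - 2 powr (\<alpha> - \<beta>))) * \<delta> powr - \<alpha>)"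
proof -
  have m: "(\<lambda>x. c * indicator (cball y t) x) \<in> borel_measurable s" for c :: ennreal and t
    by (intro borel_measurable_times_ennreal borel_measurable_const borel_measurable_indicator) (simp add: s(2))
  define q where "q = 2 powr (\<alpha> - \<beta>)"
  have q: "0 < q" "q < 1" using \<alpha> by (auto simp: q_def powr_less_one)
  define a where "a = \<delta> powr - \<alpha> * C * 2 powr \<alpha>"
  have a: "a \<ge> 0" using C by (simp add: a_def)
  have "(\<integral>\<^sup>+x. riesz_kernel \<alpha> (y - x) \<partial>s) \<le> (\<integral>\<^sup>+x. ennreal (\<delta> powr - \<alpha>) +
     (\<Sum>k. ennreal ((\<delta> / 2 ^ Suc k) powr - \<alpha>) * indicator (cball y (\<delta> / 2 ^ k)) x) \<partial>s)"
    by (intro nn_integral_mono riesz_kernel_dyadic \<alpha> \<delta>)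
  also have "\<dots> = ennreal (\<delta> powr - \<alpha>) * emeasure s (space s) + (\<Sum>k. ennreal ((\<delta> / 2 ^ Suc k) powr - \<alpha>) * emeasure s (cball y (\<delta> / 2 ^ k)))"
  proof -
    define g where "g x = (\<Sum>k. ennreal ((\<delta> / 2 ^ Suc k) powr - \<alpha>) * indicator (cball y (\<delta> / 2 ^ k)) x)" for x
    have gm: "g \<in> borel_measurable s" unfolding g_def by (intro borel_measurable_suminf_order m)
    have "(\<integral>\<^sup>+x. (\<Sum>k. ennreal ((\<delta> / 2 ^ Suc k) powr - \<alpha>) * indicator (cball y (\<delta> / 2 ^ k)) x) \<partial>s)
        = (\<Sum>k. \<integral>\<^sup>+x. ennreal ((\<delta> / 2 ^ Suc k) powr - \<alpha>) * indicator (cball y (\<delta> / 2 ^ k)) x \<partial>s)"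
      by (rule nn_integral_suminf) (rule m)
    also have "\<dots> = (\<Sum>k. ennreal ((\<delta> / 2 ^ Suc k) powr - \<alpha>) * emeasure s (cball y (\<delta> / 2 ^ k)))"
      by (intro suminf_cong nn_integral_cmult_indicator) (simp add: s(2))
    finally have "(\<integral>\<^sup>+x. g x \<partial>s) = (\<Sum>k. ennreal ((\<delta> / 2 ^ Suc k) powr - \<alpha>) * emeasure s (cball y (\<delta> / 2 ^ k)))"
      unfolding g_def .
    moreover have "(\<integral>\<^sup>+x. ennreal (\<delta> powr - \<alpha>) + g x \<partial>s) = ennreal (\<delta> powr - \<alpha>) * emeasure s (space s) + (\<integral>\<^sup>+x. g x \<partial>s)"
      using gm by (simp add: nn_integral_add)
    ultimately show ?thesis unfolding g_def by (simp only:)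
  qed
  also have "\<dots> \<le> ennreal (\<delta> powr - \<alpha>) + (\<Sum>k. ennreal (a * q ^ k))"
  proof (intro add_mono suminf_le summableI)
    show "ennreal (\<delta> powr - \<alpha>) * emeasure s (space s) \<le> ennreal (\<delta> powr - \<alpha>)"
      by (simp add: s(1))
    fix k
    have "ennreal ((\<delta> / 2 ^ Suc k) powr - \<alpha>) * emeasure s (cball y (\<delta> / 2 ^ k))
       \<le> ennreal ((\<delta> / 2 ^ Suc k) powr - \<alpha>) * ennreal (C * ((\<delta> / 2 ^ k) / \<delta>) powr \<beta>)"
      by (intro mult_left_mono frost) (use \<delta> in \<open>auto simp: field_simps\<close>)
    also have "\<dots> = ennreal ((\<delta> / 2 ^ Suc k) powr - \<alpha> * (C * ((\<delta> / 2 ^ k) / \<delta>) powr \<beta>))"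
      using C by (simp add: ennreal_mult)
    also have "(\<delta> / 2 ^ Suc k) powr - \<alpha> * (C * ((\<delta> / 2 ^ k) / \<delta>) powr \<beta>) = a * q ^ k"
    proof -
      have p: "(2::real) ^ j = 2 powr real j" for j by (simp add: powr_realpow)
      have 1: "(\<delta> / 2 ^ Suc k) powr - \<alpha> = \<delta> powr - \<alpha> * 2 powr (\<alpha> * real (Suc k))"
      proof -
        have "\<delta> / 2 ^ Suc k = \<delta> * 2 powr (- real (Suc k))" unfolding p by (simp only: powr_minus divide_inverse)
        then have "(\<delta> / 2 ^ Suc k) powr - \<alpha> = \<delta> powr - \<alpha> * (2 powr (- real (Suc k))) powr - \<alpha>"
          using \<delta> by (simp only: powr_mult)
        also have "(2 powr (- real (Suc k))) powr - \<alpha> = 2 powr (\<alpha> * real (Suc k))"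
          unfolding powr_powr by (rule arg_cong[where f = "\<lambda>z. 2 powr z"]) (simp add: algebra_simps)
        finally show ?thesis .
      qed
      have 2: "((\<delta> / 2 ^ k) / \<delta>) powr \<beta> = 2 powr (- \<beta> * real k)"
      proof -
        have "(\<delta> / 2 ^ k) / \<delta> = inverse (2 ^ k)" using \<delta> by (simp add: divide_inverse)
        also have "\<dots> = 2 powr (- real k)" unfolding p by (simp only: powr_minus)
        finally show ?thesis by (simp only: powr_powr) (simp add: mult.commute)
      qed
      have "2 powr ((\<alpha> - \<beta>) * real k) = (2 powr (\<alpha> - \<beta>)) powr real k" by (simp only: powr_powr)
      then have 3: "q ^ k = 2 powr ((\<alpha> - \<beta>) * real k)" by (simp add: q_def powr_realpow)
      have e: "\<alpha> * real (Suc k) + - \<beta> * real k = \<alpha> + (\<alpha> - \<beta>) * real k" by (simp add: algebra_simps)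
      have "(2::real) powr (\<alpha> * real (Suc k)) * 2 powr (- \<beta> * real k) = 2 powr \<alpha> * 2 powr ((\<alpha> - \<beta>) * real k)"
        unfolding powr_add[symmetric] e ..
      moreover have "p * X * (c * Y) = p * c * T * Q" if "X * Y = T * Q" for p c X Y T Q :: real
      proof -
        have "p * X * (c * Y) = p * c * (X * Y)" by (simp only: mult_ac)
        then show ?thesis using that by (simp only: mult.assoc)
      qed
      ultimately show ?thesis unfolding 1 2 3 a_def by blast
    qed
    finally show "ennreal ((\<delta> / 2 ^ Suc k) powr - \<alpha>) * emeasure s (cball y (\<delta> / 2 ^ k)) \<le> ennreal (a * q ^ k)" .
  qed
  also have "(\<Sum>k. ennreal (a * q ^ k)) = ennreal (a / (1 - q))"
  proof -
    have "(\<lambda>k. a * q ^ k) sums (a * (1 / (1 - q)))"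
      using q by (intro sums_mult geometric_sums) auto
    then show ?thesis using a q by (subst suminf_ennreal_eq) auto
  qed
  also have "ennreal (\<delta> powr - \<alpha>) + ennreal (a / (1 - q)) = ennreal (\<delta> powr - \<alpha> + a / (1 - q))"
    using a q by (intro ennreal_plus[symmetric]) auto
  also have "\<delta> powr - \<alpha> + a / (1 - q) = (1 + C * 2 powr \<alpha> / (1 - q)) * \<delta> powr - \<alpha>"
  proof -
    have "p + (p * C * t) / s = (1 + C * t / s) * p" for p t s :: real by (simp add: distrib_right)
    then show ?thesis unfolding a_def .
  qed
  finally show ?thesis unfolding q_def .
qed

section \<open>Lattice cells and their compression to flat cubes\<close>

definition cell_corner :: "real \<Rightarrow> 'a::euclidean_space \<Rightarrow> 'a" where
  "cell_corner \<eta> x = (\<Sum>b\<in>Basis. (\<eta> * of_int \<lfloor>(x \<bullet> b) / \<eta>\<rfloor>) *\<^sub>R b)"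

text \<open>Maps every lattice cell of side \<^term>\<open>\<eta>\<close> onto a flat cube of side \<^term>\<open>r\<close> orthogonal to \<^term>\<open>e\<close>, with the
  same corner.\<close>

definition compress :: "real \<Rightarrow> real \<Rightarrow> 'a::euclidean_space \<Rightarrow> 'a \<Rightarrow> 'a" where
  "compress \<eta> r e x = (\<Sum>b\<in>Basis. (if b = e then \<eta> * of_int \<lfloor>(x \<bullet> b) / \<eta>\<rfloor>
     else \<eta> * of_int \<lfloor>(x \<bullet> b) / \<eta>\<rfloor> + (r / \<eta>) * (x \<bullet> b - \<eta> * of_int \<lfloor>(x \<bullet> b) / \<eta>\<rfloor>)) *\<^sub>R b)"

lemma cell_corner_inner: "b \<in> Basis \<Longrightarrow> cell_corner \<eta> x \<bullet> b = \<eta> * of_int \<lfloor>(x \<bullet> b) / \<eta>\<rfloor>"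
  by (simp add: cell_corner_def)

lemma compress_inner:
  "b \<in> Basis \<Longrightarrow> compress \<eta> r e x \<bullet> b = (if b = e then \<eta> * of_int \<lfloor>(x \<bullet> b) / \<eta>\<rfloor>
     else \<eta> * of_int \<lfloor>(x \<bullet> b) / \<eta>\<rfloor> + (r / \<eta>) * (x \<bullet> b - \<eta> * of_int \<lfloor>(x \<bullet> b) / \<eta>\<rfloor>))"
  by (simp add: compress_def)

lemma measurable_compress [measurable]: "compress \<eta> r e \<in> borel_measurable borel"
  unfolding compress_def[abs_def]
proof (intro borel_measurable_sum borel_measurable_scaleR borel_measurable_const)
  fix b :: 'a
  show "(\<lambda>x. if b = e then \<eta> * of_int \<lfloor>(x \<bullet> b) / \<eta>\<rfloor>
     else \<eta> * of_int \<lfloor>(x \<bullet> b) / \<eta>\<rfloor> + (r / \<eta>) * (x \<bullet> b - \<eta> * of_int \<lfloor>(x \<bullet> b) / \<eta>\<rfloor>)) \<in> borel_measurable borel"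
    by (cases "b = e") simp_all
qed

lemma floor_cell:
  assumes "0 < (\<eta>::real)"
  shows "\<eta> * of_int \<lfloor>s / \<eta>\<rfloor> \<le> s" "s < \<eta> * of_int \<lfloor>s / \<eta>\<rfloor> + \<eta>"
proof -
  have "\<eta> * of_int \<lfloor>s / \<eta>\<rfloor> \<le> \<eta> * (s / \<eta>)" using assms by (intro mult_left_mono) auto
  then show "\<eta> * of_int \<lfloor>s / \<eta>\<rfloor> \<le> s" using assms by simp
  have "\<eta> * (s / \<eta>) < \<eta> * (of_int \<lfloor>s / \<eta>\<rfloor> + 1)" using assms by (intro mult_strict_left_mono) linarith+
  then show "s < \<eta> * of_int \<lfloor>s / \<eta>\<rfloor> + \<eta>" using assms by (simp add: algebra_simps)
qed

lemma norm_le_DIM_mult: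
  fixes z :: "'a::euclidean_space"
  assumes "\<And>b. b \<in> Basis \<Longrightarrow> \<bar>z \<bullet> b\<bar> \<le> c"
  shows "norm z \<le> real DIM('a) * c"
proof -
  have "norm z \<le> (\<Sum>b\<in>Basis. \<bar>z \<bullet> b\<bar>)" by (rule norm_le_l1)
  also have "\<dots> \<le> (\<Sum>b\<in>(Basis::'a set). c)" by (intro sum_mono assms)
  finally show ?thesis by simp
qed

lemma compress_inner_bounds:
  assumes "b \<in> Basis" "0 < \<eta>" "0 < r"
  shows "\<eta> * of_int \<lfloor>(x \<bullet> b) / \<eta>\<rfloor> \<le> compress \<eta> r e x \<bullet> b" "compress \<eta> r e x \<bullet> b \<le> \<eta> * of_int \<lfloor>(x \<bullet> b) / \<eta>\<rfloor> + r"
proof -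
  define f where "f = \<eta> * of_int \<lfloor>(x \<bullet> b) / \<eta>\<rfloor>"
  have f: "f \<le> x \<bullet> b" "x \<bullet> b < f + \<eta>" using floor_cell[OF assms(2), of "x \<bullet> b"] by (auto simp: f_def)
  have "0 \<le> (r / \<eta>) * (x \<bullet> b - f)" using f assms by simp
  moreover have "(r / \<eta>) * (x \<bullet> b - f) \<le> (r / \<eta>) * \<eta>" using f assms by (intro mult_left_mono) auto
  ultimately show "\<eta> * of_int \<lfloor>(x \<bullet> b) / \<eta>\<rfloor> \<le> compress \<eta> r e x \<bullet> b" "compress \<eta> r e x \<bullet> b \<le> \<eta> * of_int \<lfloor>(x \<bullet> b) / \<eta>\<rfloor> + r"
    unfolding compress_inner[OF assms(1)] f_def[symmetric] using assms by auto
qed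

lemma norm_cell_corner_diff:
  fixes x :: "'a::euclidean_space"
  assumes "0 < \<eta>"
  shows "norm (cell_corner \<eta> x - x) \<le> real DIM('a) * \<eta>"
proof (rule norm_le_DIM_mult)
  fix b :: 'a assume b: "b \<in> Basis"
  show "\<bar>(cell_corner \<eta> x - x) \<bullet> b\<bar> \<le> \<eta>"
    using floor_cell[OF assms, of "x \<bullet> b"] by (simp add: inner_diff_left cell_corner_inner[OF b] abs_le_iff)
qed

lemma norm_compress_diff:
  fixes x :: "'a::euclidean_space"
  assumes "0 < r" "r \<le> \<eta>"
  shows "norm (compress \<eta> r e x - x) \<le> real DIM('a) * \<eta>"
proof (rule norm_le_DIM_mult)
  fix b :: 'a assume b: "b \<in> Basis"
  show "\<bar>(compress \<eta> r e x - x) \<bullet> b\<bar> \<le> \<eta>"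
    using floor_cell[of \<eta> "x \<bullet> b"] compress_inner_bounds[OF b, where \<eta> = \<eta> and r = r and x = x and e = e] assms
    by (simp add: inner_diff_left abs_le_iff)
qed

lemma compress_mem_flat_cube:
  fixes x e :: "'a::euclidean_space"
  assumes "0 < r" "0 < \<eta>" "e \<in> Basis"
  shows "compress \<eta> r e x \<in> cbox (cell_corner \<eta> x) (cell_corner \<eta> x + r *\<^sub>R (One - e))"
  unfolding mem_box
proof
  fix b :: 'a assume b: "b \<in> Basis"
  have "(One - e) \<bullet> b = (if b = e then 0 else 1)"
    using b assms by (auto simp: inner_diff_left inner_Basis)
  then show "cell_corner \<eta> x \<bullet> b \<le> compress \<eta> r e x \<bullet> b \<and> compress \<eta> r e x \<bullet> b \<le> (cell_corner \<eta> x + r *\<^sub>R (One - e)) \<bullet> b"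
    using compress_inner_bounds[OF b assms(2,1), where x = x and e = e]
    by (auto simp: inner_add_left cell_corner_inner[OF b] compress_inner[OF b])
qed

text \<open>If the two points had different cell indices in coordinate \<open>b\<close>, their
  images would be at least \<open>\<eta> - r \<ge> \<eta> / 2 > 2 * t\<close> apart. With equal
  indices the map is affine with slope \<open>r / \<eta>\<close> in that coordinate, unless
  \<open>b = e\<close>, where only the cell size bounds the difference.\<close>

lemma compress_fiber_box:
  fixes x x' e :: "'a::euclidean_space"
  assumes "0 < r" "r \<le> \<eta> / 2" "t < \<eta> / 4" and b: "b \<in> Basis"
    and near: "norm (compress \<eta> r e x - y) \<le> t" "norm (compress \<eta> r e x' - y) \<le> t"
  shows "\<bar>x \<bullet> b - x' \<bullet> b\<bar> \<le> (if b = e then \<eta> else min \<eta> (2 * t * \<eta> / r))"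
proof -
  let ?n = "\<lfloor>(x \<bullet> b) / \<eta>\<rfloor>" and ?m = "\<lfloor>(x' \<bullet> b) / \<eta>\<rfloor>"
  have \<eta>: "\<eta> > 0" using assms by linarith
  have "\<bar>(compress \<eta> r e x - compress \<eta> r e x') \<bullet> b\<bar> \<le> norm (compress \<eta> r e x - compress \<eta> r e x')"
    by (rule Basis_le_norm[OF b])
  also have "\<dots> \<le> 2 * t"
    using norm_triangle_ineq4[of "compress \<eta> r e x - y" "compress \<eta> r e x' - y"] near by simp
  finally have d: "\<bar>compress \<eta> r e x \<bullet> b - compress \<eta> r e x' \<bullet> b\<bar> \<le> 2 * t" by (simp add: inner_diff_left)
  have nm: "?n = ?m"
  proof (rule ccontr)
    assume "?n \<noteq> ?m"
    then have "?n \<ge> ?m + 1 \<or> ?m \<ge> ?n + 1" by linarith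
    then have "\<eta> * of_int ?n \<ge> \<eta> * of_int ?m + \<eta> \<or> \<eta> * of_int ?m \<ge> \<eta> * of_int ?n + \<eta>"
    proof
      assume "?n \<ge> ?m + 1"
      then have "of_int ?n \<ge> (of_int ?m + 1 :: real)" by linarith
      then have "\<eta> * of_int ?n \<ge> \<eta> * (of_int ?m + 1)" using \<eta> by (intro mult_left_mono) auto
      then show ?thesis by (simp add: algebra_simps)
    next
      assume "?m \<ge> ?n + 1"
      then have "of_int ?m \<ge> (of_int ?n + 1 :: real)" by linarith
      then have "\<eta> * of_int ?m \<ge> \<eta> * (of_int ?n + 1)" using \<eta> by (intro mult_left_mono) auto
      then show ?thesis by (simp add: algebra_simps)
    qed
    then show False
      using compress_inner_bounds[OF b \<eta> assms(1), where x = x and e = e] compress_inner_bounds[OF b \<eta> assms(1), where x = x' and e = e] d assms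
      by linarith
  qed
  have 1: "\<bar>x \<bullet> b - x' \<bullet> b\<bar> \<le> \<eta>"
    using floor_cell[OF \<eta>, of "x \<bullet> b"] floor_cell[OF \<eta>, of "x' \<bullet> b"] unfolding nm by linarith
  have 2: "\<bar>x \<bullet> b - x' \<bullet> b\<bar> \<le> 2 * t * \<eta> / r" if "b \<noteq> e"
  proof -
    have "compress \<eta> r e x \<bullet> b - compress \<eta> r e x' \<bullet> b = (r / \<eta>) * (x \<bullet> b - x' \<bullet> b)"
      unfolding compress_inner[OF b] nm using that by (simp add: algebra_simps diff_divide_distrib)
    then have "(r / \<eta>) * \<bar>x \<bullet> b - x' \<bullet> b\<bar> \<le> 2 * t" using d assms(1) \<eta> by (simp add: abs_mult)
    then show ?thesis using assms(1) \<eta> by (simp add: field_simps)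
  qed
  show ?thesis using 1 2 by auto
qed

text \<open>The relation between \<^term>\<open>r\<close> and \<^term>\<open>\<eta>\<close> makes the bounds for small and large radii match.\<close>

lemma compress_frostman:
  fixes e y :: "'a::euclidean_space"
  assumes e: "e \<in> Basis" and r: "0 < r" "r \<le> \<eta> / 2" and \<beta>: "0 < \<beta>" "\<beta> \<le> real DIM('a) - 1"
    and rel: "r powr \<beta> = \<eta> ^ DIM('a) * \<delta> powr (\<beta> - real DIM('a))" and t: "0 < t" "t \<le> \<delta>"
  shows "emeasure lborel {x. norm (compress \<eta> r e x - y) \<le> t}
     \<le> ennreal ((unit_ball_vol (real DIM('a)) * (1 + 4 * real DIM('a)) ^ DIM('a) + 2 ^ DIM('a) * 2 powr \<beta>)
          * (\<delta> powr (real DIM('a) - \<beta>) * t powr \<beta>))"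
proof -
  let ?d = "DIM('a)" let ?\<omega> = "unit_ball_vol (real ?d)"
  let ?V = "{x. norm (compress \<eta> r e x - y) \<le> t}"
  have \<eta>: "\<eta> > 0" and \<delta>: "\<delta> > 0" using r t by linarith+
  have X: "0 \<le> \<delta> powr (real ?d - \<beta>) * t powr \<beta>" by simp
  show ?thesis
  \<comment> \<open>Large radii do not see the flatness: points move by at most
    \<open>DIM('a) * \<eta>\<close>, so the preimage lies in a comparable ball. For small radii the
    preimage sits in a box of half-width \<eta> in direction \<open>e\<close> and \<open>k\<close>
    in the others.\<close>
  proof (cases "\<eta> / 4 \<le> t")
    case True
    have "?V \<subseteq> cball y ((1 + 4 * real ?d) * t)"
    proof
      fix x assume "x \<in> ?V"
      then have "norm (compress \<eta> r e x - y) \<le> t" by simp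
      moreover have "norm (compress \<eta> r e x - x) \<le> real ?d * \<eta>" by (rule norm_compress_diff) (use r \<eta> in auto)
      moreover have "real ?d * \<eta> \<le> real ?d * (4 * t)" using True by (intro mult_left_mono) auto
      moreover have "norm (y - x) \<le> norm (compress \<eta> r e x - x) + norm (compress \<eta> r e x - y)"
        using norm_triangle_ineq4[of "compress \<eta> r e x - x" "compress \<eta> r e x - y"] by simp
      moreover have "(1 + 4 * real ?d) * t = t + real ?d * (4 * t)" by (simp add: algebra_simps)
      ultimately show "x \<in> cball y ((1 + 4 * real ?d) * t)" unfolding mem_cball dist_norm by linarith
    qed
    then have "emeasure lborel ?V \<le> emeasure lborel (cball y ((1 + 4 * real ?d) * t))" by (rule emeasure_mono) simp
    also have "\<dots> = ennreal (?\<omega> * ((1 + 4 * real ?d) * t) ^ ?d)" using t by (simp add: emeasure_cball)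
    also have "\<dots> \<le> ennreal ((?\<omega> * (1 + 4 * real ?d) ^ ?d + 2 ^ ?d * 2 powr \<beta>) * (\<delta> powr (real ?d - \<beta>) * t powr \<beta>))"
    proof (rule ennreal_leI)
      have "t ^ ?d = t powr (real ?d - \<beta>) * t powr \<beta>" using t by (simp add: powr_add[symmetric] powr_realpow)
      also have "\<dots> \<le> \<delta> powr (real ?d - \<beta>) * t powr \<beta>" using t \<beta> by (intro mult_right_mono powr_mono2) auto
      finally have "?\<omega> * (1 + 4 * real ?d) ^ ?d * t ^ ?d \<le> ?\<omega> * (1 + 4 * real ?d) ^ ?d * (\<delta> powr (real ?d - \<beta>) * t powr \<beta>)"
        by (intro mult_left_mono) auto
      also have "\<dots> \<le> (?\<omega> * (1 + 4 * real ?d) ^ ?d + 2 ^ ?d * 2 powr \<beta>) * (\<delta> powr (real ?d - \<beta>) * t powr \<beta>)"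
        by (intro mult_right_mono X) simp
      finally show "?\<omega> * ((1 + 4 * real ?d) * t) ^ ?d \<le> (?\<omega> * (1 + 4 * real ?d) ^ ?d + 2 ^ ?d * 2 powr \<beta>) * (\<delta> powr (real ?d - \<beta>) * t powr \<beta>)"
        by (simp add: power_mult_distrib mult.assoc)
    qed
    finally show ?thesis .
  next
    case False
    show ?thesis
    proof (cases "?V = {}")
      case True then show ?thesis by (simp only: emeasure_empty) simp
    next
      case ne: False
      then obtain x' where x': "norm (compress \<eta> r e x' - y) \<le> t" by auto
      define k where "k = min \<eta> (2 * t * \<eta> / r)"
      have k: "k > 0" using \<eta> r t by (simp add: k_def)
      define w where "w = (\<Sum>b\<in>Basis. (if b = e then \<eta> else k) *\<^sub>R b)"
      have w: "w \<bullet> b = (if b = e then \<eta> else k)" if "b \<in> Basis" for b using that by (simp add: w_def)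
      have "?V \<subseteq> cbox (x' - w) (x' + w)"
      proof
        fix x assume "x \<in> ?V"
        then have x: "norm (compress \<eta> r e x - y) \<le> t" by simp
        show "x \<in> cbox (x' - w) (x' + w)"
          unfolding mem_box
        proof
          fix b :: 'a assume b: "b \<in> Basis"
          have "\<bar>x \<bullet> b - x' \<bullet> b\<bar> \<le> w \<bullet> b"
            using compress_fiber_box[OF r _ b x x'] False unfolding w[OF b] k_def by simp
          then show "(x' - w) \<bullet> b \<le> x \<bullet> b \<and> x \<bullet> b \<le> (x' + w) \<bullet> b"
            by (simp add: inner_diff_left inner_add_left abs_le_iff)
        qed
      qed
      then have "emeasure lborel ?V \<le> emeasure lborel (cbox (x' - w) (x' + w))" by (rule emeasure_mono) simp
      also have "\<dots> = ennreal (\<Prod>b\<in>Basis. ((x' + w) - (x' - w)) \<bullet> b)"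
        by (rule emeasure_lborel_cbox) (use w \<eta> k in \<open>auto simp: inner_diff_left inner_add_left\<close>)
      also have "(\<Prod>b\<in>Basis. ((x' + w) - (x' - w)) \<bullet> b) = (\<Prod>b\<in>Basis. 2 * (if b = e then \<eta> else k))"
        using w by (intro prod.cong) (auto simp: inner_diff_left inner_add_left)
      also have "\<dots> = 2 * \<eta> * (\<Prod>b\<in>Basis - {e}. 2 * k)"
        by (subst prod.remove[OF finite_Basis e]) auto
      also have "\<dots> = 2 * \<eta> * (2 * k) ^ (?d - 1)" using e by (simp add: card_Diff_singleton)
      also have "\<dots> \<le> 2 ^ ?d * 2 powr \<beta> * (\<delta> powr (real ?d - \<beta>) * t powr \<beta>)"
      proof -
        \<comment> \<open>The exponent drops from \<open>d - 1\<close> to \<beta> because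
          \<open>q \<le> 1\<close>; only afterwards is \<open>q\<close> replaced by
          \<open>2 * t / r\<close>, since that quotient may exceed 1.\<close>
        define q where "q = min 1 (2 * t / r)"
        have q: "0 < q" "q \<le> 1" "q \<le> 2 * t / r" using t r by (auto simp: q_def)
        have kq: "k = \<eta> * q" using \<eta> by (simp add: k_def q_def min_mult_distrib_left mult_ac)
        have d1: "?d = Suc (?d - 1)" using DIM_positive[where 'a = 'a] by simp
        have "q ^ (?d - 1) = q powr (real ?d - 1)"
          using q DIM_positive[where 'a = 'a] by (subst powr_realpow[symmetric]) (auto simp: of_nat_diff)
        also have "\<dots> \<le> q powr \<beta>" using q \<beta> by (intro powr_mono') auto
        also have "\<dots> \<le> (2 * t / r) powr \<beta>" using q \<beta> by (intro powr_mono2) auto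
        also have "\<dots> = 2 powr \<beta> * t powr \<beta> / r powr \<beta>" using t r by (simp add: powr_mult powr_divide)
        finally have qq: "q ^ (?d - 1) \<le> 2 powr \<beta> * t powr \<beta> / r powr \<beta>" .
        have "2 * \<eta> * (2 * k) ^ (?d - 1) = 2 ^ ?d * \<eta> ^ ?d * q ^ (?d - 1)"
        proof -
          have "2 * \<eta> * (2 * (\<eta> * q)) ^ n = 2 ^ Suc n * \<eta> ^ Suc n * q ^ n" for n
            by (simp add: power_mult_distrib mult_ac)
          from this[of "?d - 1"] show ?thesis unfolding kq d1[symmetric] .
        qed
        also have "\<dots> \<le> 2 ^ ?d * \<eta> ^ ?d * (2 powr \<beta> * t powr \<beta> / r powr \<beta>)"
          using \<eta> by (intro mult_left_mono qq) auto
        also have "\<dots> = 2 ^ ?d * 2 powr \<beta> * (\<eta> ^ ?d / r powr \<beta>) * t powr \<beta>" by simp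
        also have "\<eta> ^ ?d / r powr \<beta> = \<delta> powr (real ?d - \<beta>)"
          unfolding rel using \<eta> \<delta> by (simp add: powr_diff divide_simps)
        finally show ?thesis by (simp add: mult.assoc)
      qed
      also have "\<dots> \<le> (?\<omega> * (1 + 4 * real ?d) ^ ?d + 2 ^ ?d * 2 powr \<beta>) * (\<delta> powr (real ?d - \<beta>) * t powr \<beta>)"
        by (intro mult_right_mono X) auto
      finally show ?thesis by (simp add: ennreal_leI)
    qed
  qed
qed

lemma cell_corner_eqI:
  fixes x w :: "'a::euclidean_space"
  assumes "0 < \<eta>" "w \<in> box (cell_corner \<eta> x) (cell_corner \<eta> x + \<eta> *\<^sub>R One)"
  shows "cell_corner \<eta> w = cell_corner \<eta> x"
proof (rule euclidean_eqI)
  fix b :: 'a assume b: "b \<in> Basis"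
  let ?n = "\<lfloor>(x \<bullet> b) / \<eta>\<rfloor>"
  have "\<eta> * of_int ?n < w \<bullet> b" "w \<bullet> b < \<eta> * of_int ?n + \<eta>"
    using assms(2) b by (auto simp: mem_box cell_corner_inner inner_add_left)
  then have "of_int ?n \<le> (w \<bullet> b) / \<eta>" "(w \<bullet> b) / \<eta> < of_int ?n + 1"
    using assms(1) by (auto simp: field_simps)
  then have "\<lfloor>(w \<bullet> b) / \<eta>\<rfloor> = ?n" by (simp add: floor_eq_iff)
  then show "cell_corner \<eta> w \<bullet> b = cell_corner \<eta> x \<bullet> b" by (simp add: cell_corner_inner[OF b])
qed

text \<open>The open cells are disjoint and, by \<open>4 * DIM('a) * \<eta> \<le> \<delta>\<close>,
  contained in \<open>U\<close>. Comparing volumes bounds every finite set of corners, which also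
  proves finiteness.\<close>

lemma card_cells_le:
  fixes U :: "'a::euclidean_space set"
  assumes U: "open U" "bounded U" and \<eta>: "0 < \<eta>" "4 * real DIM('a) * \<eta> \<le> \<delta>"
  defines "Z \<equiv> cell_corner \<eta> ` {x. cball x (\<delta> / 2) \<subseteq> U}"
  shows "finite Z" and "real (card Z) * \<eta> ^ DIM('a) \<le> measure lborel U"
proof -
  let ?d = "DIM('a)"
  define B where "B z = box z (z + \<eta> *\<^sub>R (One::'a))" for z
  have Ufin: "emeasure lborel U < \<infinity>" using emeasure_bounded_finite[OF U(2)] .
  have main: "real (card Z') * \<eta> ^ ?d \<le> measure lborel U" if Z': "Z' \<subseteq> Z" "finite Z'" for Z'
  proof -
    have Bs: "B z \<in> sets lborel" for z by (simp add: B_def)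
    have BE: "emeasure lborel (B z) = ennreal (\<eta> ^ ?d)" for z
    proof -
      have "emeasure lborel (B z) = ennreal (\<Prod>b\<in>Basis. (z + \<eta> *\<^sub>R (One::'a) - z) \<bullet> b)"
        unfolding B_def by (rule emeasure_lborel_box) (use \<eta> in \<open>auto simp: inner_add_left\<close>)
      also have "(\<Prod>b\<in>Basis. (z + \<eta> *\<^sub>R (One::'a) - z) \<bullet> b) = (\<Prod>b\<in>(Basis::'a set). \<eta>)"
        by (intro prod.cong) auto
      finally show ?thesis by simp
    qed
    have "disjoint_family_on B Z'"
      unfolding disjoint_family_on_def
    proof (intro ballI impI equals0I)
      fix z z' w assume z: "z \<in> Z'" "z' \<in> Z'" "z \<noteq> z'" "w \<in> B z \<inter> B z'"
      then obtain x x' where "z = cell_corner \<eta> x" "z' = cell_corner \<eta> x'" using Z'(1) unfolding Z_def by blast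
      then show False using cell_corner_eqI[OF \<eta>(1), of w x] cell_corner_eqI[OF \<eta>(1), of w x'] z by (auto simp: B_def)
    qed
    then have "(\<Sum>z\<in>Z'. emeasure lborel (B z)) = emeasure lborel (\<Union>z\<in>Z'. B z)"
      using Z'(2) Bs by (intro sum_emeasure) auto
    also have "\<dots> \<le> emeasure lborel U"
    proof (rule emeasure_mono)
      show "(\<Union>z\<in>Z'. B z) \<subseteq> U"
      proof
        fix w assume "w \<in> (\<Union>z\<in>Z'. B z)"
        then obtain x where x: "cball x (\<delta> / 2) \<subseteq> U" "w \<in> B (cell_corner \<eta> x)" using Z'(1) unfolding Z_def by blast
        have "norm (w - cell_corner \<eta> x) \<le> real ?d * \<eta>"
          using x(2) by (intro norm_le_DIM_mult) (force simp: B_def mem_box inner_diff_left inner_add_left abs_le_iff less_imp_le)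
        moreover have "norm (cell_corner \<eta> x - x) \<le> real ?d * \<eta>" by (rule norm_cell_corner_diff[OF \<eta>(1)])
        ultimately have "norm (w - x) \<le> \<delta> / 2"
          using norm_triangle_ineq[of "w - cell_corner \<eta> x" "cell_corner \<eta> x - x"] \<eta>(2) by simp
        then have "w \<in> cball x (\<delta> / 2)" by (simp add: dist_norm norm_minus_commute)
        then show "w \<in> U" using x(1) by blast
      qed
    qed (use U in auto)
    finally have "of_nat (card Z') * ennreal (\<eta> ^ ?d) \<le> emeasure lborel U" by (simp add: BE)
    then have "ennreal (real (card Z') * \<eta> ^ ?d) \<le> ennreal (measure lborel U)"
      using Ufin \<eta> by (simp add: emeasure_eq_ennreal_measure ennreal_mult ennreal_of_nat_eq_real_of_nat)
    then show ?thesis by (simp add: ennreal_le_iff)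
  qed
  have "finite Z \<and> card Z \<le> nat \<lfloor>measure lborel U / \<eta> ^ ?d\<rfloor>"
  proof (rule finite_if_finite_subsets_card_bdd)
    fix G assume "G \<subseteq> Z" "finite G"
    from main[OF this] have "real (card G) \<le> measure lborel U / \<eta> ^ ?d" using \<eta> by (simp add: field_simps)
    then show "card G \<le> nat \<lfloor>measure lborel U / \<eta> ^ ?d\<rfloor>" by (simp add: le_nat_iff le_floor_iff)
  qed
  then show "finite Z" ..
  then show "real (card Z) * \<eta> ^ DIM('a) \<le> measure lborel U" by (intro main) auto
qed

text \<open>The required relation forces \<open>r = \<eta> powr p * \<delta> powr (1 - p)\<close>
  with \<open>p = d / \<beta>\<close>. As \<eta> tends to 0, so does \<open>r / \<eta>\<close>
  because \<open>p > 1\<close>, and so does \<open>r ^ (d - 1) / \<eta> ^ d\<close> because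
  \<open>p * (d - 1) > d\<close>, which is \<open>\<beta> < d - 1\<close> again.\<close>

lemma lattice_parameters:
  fixes d :: nat and \<beta> \<delta> c \<epsilon> :: real
  assumes d: "2 \<le> d" and \<beta>: "0 < \<beta>" "\<beta> < real d - 1" and "0 < \<delta>" "0 < c" "0 < \<epsilon>"
  obtains \<eta> r where "0 < \<eta>" "\<eta> < c" "0 < r" "r \<le> \<eta> / 2" "r powr \<beta> = \<eta> ^ d * \<delta> powr (\<beta> - real d)"
    "r ^ (d - 1) \<le> \<epsilon> * \<eta> ^ d"
proof -
  define p where "p = real d / \<beta>"
  define R where "R l = l powr p * \<delta> powr (1 - p)" for l
  have p1: "p * (real d - 1) > real d" using mult_strict_left_mono[OF \<beta>(2), of "real d"] \<beta>(1) d by (simp add: p_def pos_less_divide_eq)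
  have p2: "p > 1" using \<beta> by (simp add: p_def field_simps)
  have lim: "((\<lambda>l. C * l powr s) \<longlongrightarrow> 0) (at_right (0::real))" if "s > 0" for s C :: real
  proof -
    have "((\<lambda>l. l powr s) \<longlongrightarrow> 0) (at_right (0::real))"
      by (rule tendsto_zero_powrI) (use that in \<open>auto intro!: tendsto_ident_at eventually_mono[OF eventually_at_right_less]\<close>)
    from tendsto_mult_left[OF this, of C] show ?thesis by simp
  qed
  have l1: "eventually (\<lambda>l. \<delta> powr (1 - p) * l powr (p - 1) < 1 / 2) (at_right (0::real))"
    by (rule order_tendstoD(2)[OF lim]) (use p2 in auto)
  have l2: "eventually (\<lambda>l. (\<delta> powr (1 - p)) ^ (d - 1) * l powr (p * (real d - 1) - real d) < \<epsilon>) (at_right (0::real))"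
    by (rule order_tendstoD(2)[OF lim]) (use p1 assms in auto)
  have l3: "eventually (\<lambda>l. 0 < l \<and> l < c) (at_right (0::real))"
    using eventually_at_right[of 0 c "\<lambda>l. 0 < l \<and> l < c"] assms(5) by auto
  have "eventually (\<lambda>l. 0 < l \<and> l < c \<and> \<delta> powr (1 - p) * l powr (p - 1) < 1 / 2 \<and>
     (\<delta> powr (1 - p)) ^ (d - 1) * l powr (p * (real d - 1) - real d) < \<epsilon>) (at_right (0::real))"
    using l1 l2 l3 by eventually_elim auto
  then obtain l where l: "0 < l" "l < c" "\<delta> powr (1 - p) * l powr (p - 1) < 1 / 2"
     "(\<delta> powr (1 - p)) ^ (d - 1) * l powr (p * (real d - 1) - real d) < \<epsilon>"
    using eventually_happens[of _ "at_right (0::real)"] by auto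
  show ?thesis
  proof (rule that[OF l(1,2), of "R l"])
    show "0 < R l" using l assms by (simp add: R_def)
    have "R l = l * (\<delta> powr (1 - p) * l powr (p - 1))" using l by (simp add: R_def powr_diff)
    also have "\<dots> \<le> l * (1 / 2)" using l by (intro mult_left_mono) auto
    finally show "R l \<le> l / 2" by simp
    have "R l powr \<beta> = l powr (p * \<beta>) * \<delta> powr ((1 - p) * \<beta>)" by (simp add: R_def powr_mult powr_powr)
    also have "p * \<beta> = real d" using \<beta> by (simp add: p_def)
    also have "(1 - p) * \<beta> = \<beta> - real d" using \<beta> by (simp add: p_def algebra_simps)
    finally show "R l powr \<beta> = l ^ d * \<delta> powr (\<beta> - real d)" using l by (simp add: powr_realpow)
    have "(l powr p) ^ (d - 1) = l powr (p * (real d - 1))"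
      using d l by (simp add: powr_realpow[symmetric] powr_powr of_nat_diff)
    also have "\<dots> = l powr (p * (real d - 1) - real d) * l ^ d"
      using l by (simp add: powr_realpow[symmetric] powr_add[symmetric])
    finally have "R l ^ (d - 1) = (\<delta> powr (1 - p)) ^ (d - 1) * l powr (p * (real d - 1) - real d) * l ^ d"
      by (simp add: R_def power_mult_distrib)
    also have "\<dots> \<le> \<epsilon> * l ^ d" using l by (intro mult_right_mono) auto
    finally show "R l ^ (d - 1) \<le> \<epsilon> * l ^ d" .
  qed
qed

section \<open>Riesz energies\<close>

lemma min_riesz_energy_le:
  assumes "sets \<mu> = sets borel" "emeasure \<mu> A = 1"
  shows "min_riesz_energy \<alpha> A \<le> riesz_energy \<alpha> \<mu>"
  unfolding min_riesz_energy_def by (rule INF_lower) (use assms in auto)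

lemma measurable_potential:
  fixes \<mu> :: "'a::euclidean_space measure"
  assumes "sets \<mu> = sets borel" "finite_measure \<mu>"
  shows "(\<lambda>x. \<integral>\<^sup>+y. riesz_kernel \<alpha> (x - y) \<partial>\<mu>) \<in> borel_measurable borel"
proof -
  interpret finite_measure \<mu> by (rule assms)
  note [measurable_cong] = assms(1)
  have "(\<lambda>(x, y). riesz_kernel \<alpha> (x - y)) \<in> borel_measurable (borel \<Otimes>\<^sub>M \<mu>)" by measurable
  then show ?thesis by (rule borel_measurable_nn_integral)
qed

text \<open>Admissible measures may be infinite outside \<^term>\<open>A\<close>; the restriction is finite, so Tonelli applies to it.\<close>

lemma restricted_riesz_energy:
  fixes \<mu> :: "'a::euclidean_space measure"
  assumes A: "A \<in> sets borel" and \<mu>: "sets \<mu> = sets borel" "emeasure \<mu> A = 1"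
  defines "\<nu> \<equiv> density \<mu> (indicator A)"
  shows "sets \<nu> = sets borel" "emeasure \<nu> A = 1" "emeasure \<nu> (space \<nu>) = 1" "riesz_energy \<alpha> \<nu> \<le> riesz_energy \<alpha> \<mu>"
    and "AE x in \<nu>. x \<in> A"
proof -
  have A\<mu>: "A \<in> sets \<mu>" using A \<mu> by simp
  have sp: "space \<mu> = UNIV" using sets_eq_imp_space_eq[OF \<mu>(1)] by simp
  show s\<nu>: "sets \<nu> = sets borel" by (simp add: \<nu>_def \<mu>)
  have em: "emeasure \<nu> B = emeasure \<mu> (A \<inter> B)" if "B \<in> sets borel" for B
    unfolding \<nu>_def using that A\<mu> \<mu>(1) by (simp add: emeasure_density indicator_inter_arith[symmetric] nn_integral_indicator)
  show "emeasure \<nu> A = 1" using em[OF A] \<mu>(2) by simp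
  show e1: "emeasure \<nu> (space \<nu>) = 1" using em[of UNIV] \<mu>(2) sp by (simp add: \<nu>_def)
  show "AE x in \<nu>. x \<in> A" unfolding \<nu>_def using A\<mu> by (subst AE_density) (auto simp: indicator_def)
  have fin: "finite_measure \<nu>" by (rule finite_measureI) (simp add: e1)
  let ?k = "\<lambda>x y. riesz_kernel \<alpha> (x - y) :: ennreal"
  have inner: "(\<integral>\<^sup>+y. ?k x y \<partial>\<nu>) \<le> (\<integral>\<^sup>+y. ?k x y \<partial>\<mu>)" for x
  proof -
    have "(\<lambda>y. riesz_kernel \<alpha> (x - y)) \<in> borel_measurable borel" by measurable
    then have "(\<lambda>y. riesz_kernel \<alpha> (x - y)) \<in> borel_measurable \<mu>"
      using measurable_cong_sets[OF \<mu>(1) refl] by blast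
    then have "(\<integral>\<^sup>+y. ?k x y \<partial>\<nu>) = (\<integral>\<^sup>+y. indicator A y * ?k x y \<partial>\<mu>)"
      unfolding \<nu>_def using A\<mu> by (subst nn_integral_density) auto
    also have "\<dots> \<le> (\<integral>\<^sup>+y. ?k x y \<partial>\<mu>)" by (intro nn_integral_mono) (auto simp: indicator_def)
    finally show ?thesis .
  qed
  have "(\<lambda>x. \<integral>\<^sup>+y. ?k x y \<partial>\<nu>) \<in> borel_measurable \<mu>"
    using measurable_potential[OF s\<nu> fin] measurable_cong_sets[OF \<mu>(1) refl] by blast
  then have "riesz_energy \<alpha> \<nu> = (\<integral>\<^sup>+x. indicator A x * (\<integral>\<^sup>+y. ?k x y \<partial>\<nu>) \<partial>\<mu>)"
    unfolding riesz_energy_eq by (subst (1) \<nu>_def) (use A\<mu> in \<open>auto intro!: nn_integral_density\<close>)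
  also have "\<dots> \<le> (\<integral>\<^sup>+x. (\<integral>\<^sup>+y. ?k x y \<partial>\<mu>) \<partial>\<mu>)"
    using inner by (intro nn_integral_mono) (auto simp: indicator_def)
  finally show "riesz_energy \<alpha> \<nu> \<le> riesz_energy \<alpha> \<mu>" by (simp add: riesz_energy_eq)
qed

text \<open>An admissible measure for \<open>A\<close> may charge \<open>B - A\<close>, so it need
  not be admissible for \<open>B\<close>; its restriction to \<open>A\<close> is, with no larger
  energy.\<close>

lemma min_riesz_energy_antimono:
  fixes A B :: "'a::euclidean_space set"
  assumes "A \<in> sets borel" "B \<in> sets borel" "A \<subseteq> B"
  shows "min_riesz_energy \<alpha> B \<le> min_riesz_energy \<alpha> A"
  unfolding min_riesz_energy_def[of \<alpha> A]
proof (rule INF_greatest)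
  fix \<mu> :: "'a measure" assume "\<mu> \<in> {\<mu>. sets \<mu> = sets borel \<and> emeasure \<mu> A = 1}"
  then have \<mu>: "sets \<mu> = sets borel" "emeasure \<mu> A = 1" by auto
  define \<nu> where "\<nu> = density \<mu> (indicator A :: 'a \<Rightarrow> ennreal)"
  note \<nu> = restricted_riesz_energy[OF assms(1) \<mu>, folded \<nu>_def]
  have "emeasure \<nu> B = 1"
  proof (rule antisym)
    have sB: "B \<in> sets \<nu>" using \<nu>(1) assms(2) by simp
    show "1 \<le> emeasure \<nu> B" using emeasure_mono[OF assms(3) sB] \<nu>(2) by simp
    show "emeasure \<nu> B \<le> 1" using emeasure_space[of \<nu> B] \<nu>(3) by simp
  qed
  then show "min_riesz_energy \<alpha> B \<le> riesz_energy \<alpha> \<mu>"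
    using min_riesz_energy_le[OF \<nu>(1), of B \<alpha>] \<nu>(4) by (meson order_trans)
qed

text \<open>At scale \<^term>\<open>\<delta>\<close> the kernel is truncated near the diagonal, and its argument is perturbed by at
  most \<^term>\<open>D * \<delta>\<close> away from it.\<close>

definition truncated_kernel :: "real \<Rightarrow> real \<Rightarrow> real \<Rightarrow> real \<Rightarrow> 'a::euclidean_space \<Rightarrow> ennreal" where
  "truncated_kernel \<alpha> D C \<delta> z = (if 2 * D * \<delta> \<le> norm z then ennreal ((norm z - D * \<delta>) powr - \<alpha>) else ennreal (C * \<delta> powr - \<alpha>))"

lemma measurable_truncated_kernel [measurable]: "truncated_kernel \<alpha> D C \<delta> \<in> borel_measurable borel"
  unfolding truncated_kernel_def[abs_def] by measurable

text \<open>Finite energy puts no product mass on the diagonal, where the kernel is infinite. Off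
  the diagonal the truncation is eventually inactive and the perturbed argument converges, while a
  constant multiple of the Riesz kernel is an integrable majorant.\<close>

lemma truncated_energy_limit:
  fixes \<mu> :: "'a::euclidean_space measure"
  assumes \<mu>: "sets \<mu> = sets borel" "finite_measure \<mu>" and fin: "riesz_energy \<alpha> \<mu> < \<infinity>"
    and \<alpha>: "0 < \<alpha>" and D: "0 < D" and C: "0 \<le> C"
  shows "(\<lambda>n. \<integral>\<^sup>+x. \<integral>\<^sup>+y. truncated_kernel \<alpha> D C (inverse (real (Suc n))) (x - y) \<partial>\<mu> \<partial>\<mu>) \<longlonglongrightarrow> riesz_energy \<alpha> \<mu>"
proof -
  interpret finite_measure \<mu> by (rule \<mu>(2))
  note [measurable_cong] = \<mu>(1)
  let ?\<delta> = "\<lambda>n. inverse (real (Suc n))"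
  let ?M = "\<mu> \<Otimes>\<^sub>M \<mu>"
  have m1: "(\<lambda>z. truncated_kernel \<alpha> D C \<delta> (fst z - snd z)) \<in> borel_measurable ?M" for \<delta> by measurable
  have m2: "(\<lambda>z. riesz_kernel \<alpha> (fst z - snd z)) \<in> borel_measurable ?M" by measurable
  have e1: "(\<integral>\<^sup>+x. \<integral>\<^sup>+y. truncated_kernel \<alpha> D C \<delta> (x - y) \<partial>\<mu> \<partial>\<mu>) = (\<integral>\<^sup>+z. truncated_kernel \<alpha> D C \<delta> (fst z - snd z) \<partial>?M)" for \<delta>
    using nn_integral_fst[OF m1] by simp
  have e2: "riesz_energy \<alpha> \<mu> = (\<integral>\<^sup>+z. riesz_kernel \<alpha> (fst z - snd z) \<partial>?M)"
    using nn_integral_fst[OF m2] by (simp add: riesz_energy_eq)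
  have off: "AE z in ?M. fst z \<noteq> snd z"
  proof -
    have "AE z in ?M. riesz_kernel \<alpha> (fst z - snd z) \<noteq> \<infinity>"
      by (rule nn_integral_noteq_infinite[OF m2]) (use fin e2 in auto)
    then show ?thesis by eventually_elim (auto simp: riesz_kernel_0)
  qed
  \<comment> \<open>The first constant comes from
    \<open>norm z - D * \<delta> \<ge> norm z / 2\<close> away from the diagonal, the second from
    \<open>\<delta> > norm z / (2 * D)\<close> near it.\<close>
  define B where "B = max (2 powr \<alpha>) (C * (2 * D) powr \<alpha>)"
  have B: "B \<ge> 0" "2 powr \<alpha> \<le> B" "C * (2 * D) powr \<alpha> \<le> B" by (auto simp: B_def le_max_iff_disj)
  have dom: "truncated_kernel \<alpha> D C \<delta> z \<le> ennreal B * riesz_kernel \<alpha> z" if "z \<noteq> 0" "\<delta> > 0" for \<delta> and z :: 'a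
  proof -
    have nz: "norm z > 0" using that by simp
    have rk: "ennreal B * riesz_kernel \<alpha> z = ennreal (B * norm z powr - \<alpha>)"
      using that B by (simp add: riesz_kernel_eq ennreal_mult)
    show ?thesis
    proof (cases "2 * D * \<delta> \<le> norm z")
      case True
      then have "(norm z - D * \<delta>) powr - \<alpha> \<le> (norm z / 2) powr - \<alpha>"
        using \<alpha> nz by (intro powr_mono2') auto
      also have "\<dots> = 2 powr \<alpha> * norm z powr - \<alpha>" using nz by (simp add: powr_divide powr_minus divide_simps)
      also have "\<dots> \<le> B * norm z powr - \<alpha>" using B by (intro mult_right_mono) auto
      finally show ?thesis unfolding rk using True by (simp add: truncated_kernel_def ennreal_leI)
    next
      case False
      have "\<delta> powr - \<alpha> \<le> (norm z / (2 * D)) powr - \<alpha>"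
        using False \<alpha> nz D by (intro powr_mono2') (auto simp: field_simps)
      also have "\<dots> = (2 * D) powr \<alpha> * norm z powr - \<alpha>" using nz D by (simp add: powr_divide powr_minus divide_simps)
      finally have "C * \<delta> powr - \<alpha> \<le> C * ((2 * D) powr \<alpha> * norm z powr - \<alpha>)" using C by (intro mult_left_mono)
      also have "\<dots> \<le> B * norm z powr - \<alpha>" unfolding mult.assoc[symmetric] using B by (intro mult_right_mono) auto
      finally show ?thesis unfolding rk using False by (simp add: truncated_kernel_def ennreal_leI)
    qed
  qed
  have lim: "(\<lambda>n. truncated_kernel \<alpha> D C (?\<delta> n) z) \<longlonglongrightarrow> riesz_kernel \<alpha> z" if z: "z \<noteq> 0" for z :: 'a
  proof -
    have "(\<lambda>n. norm z - D * ?\<delta> n) \<longlonglongrightarrow> norm z - D * 0"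
      by (intro tendsto_intros LIMSEQ_inverse_real_of_nat)
    then have "(\<lambda>n. (norm z - D * ?\<delta> n) powr - \<alpha>) \<longlonglongrightarrow> norm z powr - \<alpha>"
      using z by (intro tendsto_powr tendsto_const) auto
    then have "(\<lambda>n. ennreal ((norm z - D * ?\<delta> n) powr - \<alpha>)) \<longlonglongrightarrow> riesz_kernel \<alpha> z"
      unfolding riesz_kernel_eq[OF z] by (rule tendsto_ennrealI)
    moreover have "eventually (\<lambda>n. ennreal ((norm z - D * ?\<delta> n) powr - \<alpha>) = truncated_kernel \<alpha> D C (?\<delta> n) z) sequentially"
    proof -
      have "eventually (\<lambda>n. ?\<delta> n < norm z / (2 * D)) sequentially"
        by (rule order_tendstoD(2)[OF LIMSEQ_inverse_real_of_nat]) (use z D in auto)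
      then show ?thesis
      proof eventually_elim
        case (elim n)
        then have "2 * D * ?\<delta> n \<le> norm z" using D by (simp add: field_simps)
        then show ?case by (simp add: truncated_kernel_def)
      qed
    qed
    ultimately show ?thesis by (rule Lim_transform_eventually)
  qed
  have "(\<lambda>n. \<integral>\<^sup>+z. truncated_kernel \<alpha> D C (?\<delta> n) (fst z - snd z) \<partial>?M) \<longlonglongrightarrow> (\<integral>\<^sup>+z. riesz_kernel \<alpha> (fst z - snd z) \<partial>?M)"
  proof (rule nn_integral_dominated_convergence[where w = "\<lambda>z. ennreal B * riesz_kernel \<alpha> (fst z - snd z)"])
    show "AE z in ?M. truncated_kernel \<alpha> D C (?\<delta> n) (fst z - snd z) \<le> ennreal B * riesz_kernel \<alpha> (fst z - snd z)" for n
      using off by eventually_elim (rule dom, auto)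
    show "AE z in ?M. (\<lambda>n. truncated_kernel \<alpha> D C (?\<delta> n) (fst z - snd z)) \<longlonglongrightarrow> riesz_kernel \<alpha> (fst z - snd z)"
      using off by eventually_elim (rule lim, auto)
    show "(\<integral>\<^sup>+z. ennreal B * riesz_kernel \<alpha> (fst z - snd z) \<partial>?M) < \<infinity>"
      using fin m2 unfolding e2 by (simp add: nn_integral_cmult ennreal_mult_less_top)
  qed (use m1 m2 in auto)
  then show ?thesis unfolding e1 e2 .
qed

text \<open>A dense sequence provides candidate centres, and the least admissible index is a
  measurable choice. Centres are hit only up to an error \<delta>, hence radius
  \<open>2 * \<delta>\<close> in the hypothesis and \<delta> in the conclusion.\<close>

lemma measurable_corkscrew_selection:
  fixes U :: "'a::euclidean_space set"
  assumes ck: "\<And>x. x \<in> closure U \<Longrightarrow> \<exists>q. norm (q - x) \<le> A * (2 * \<delta>) \<and> cball q (2 * \<delta>) \<subseteq> U"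
    and \<delta>: "0 < \<delta>" and ne: "closure U \<noteq> {}"
  obtains T where "T \<in> borel_measurable borel" "\<And>x. x \<in> closure U \<Longrightarrow> norm (T x - x) \<le> (2 * A + 1) * \<delta>"
    "\<And>x. cball (T x) \<delta> \<subseteq> U"
proof -
  obtain S :: "'a set" where S: "countable S" "\<And>X. open X \<Longrightarrow> X \<noteq> {} \<Longrightarrow> \<exists>d\<in>S. d \<in> X"
    by (rule countable_dense_setE) (rule that; assumption)
  then have "S \<noteq> {}" by blast
  define s where "s = from_nat_into S"
  have rs: "range s = S" unfolding s_def using S(1) \<open>S \<noteq> {}\<close> by (rule range_from_nat_into[rotated])
  define Q where "Q x n \<longleftrightarrow> norm (s n - x) < (2 * A + 1) * \<delta> \<and> cball (s n) \<delta> \<subseteq> U" for x n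
  have Qex: "\<exists>n. Q x n" if x: "x \<in> closure U" for x
  proof -
    obtain q where q: "norm (q - x) \<le> A * (2 * \<delta>)" "cball q (2 * \<delta>) \<subseteq> U" using ck[OF x] by blast
    obtain d where "d \<in> S" "d \<in> ball q \<delta>" using S(2)[of "ball q \<delta>"] \<delta> by auto
    then obtain n where n: "s n \<in> ball q \<delta>" using rs by blast
    have "norm (s n - x) \<le> norm (s n - q) + norm (q - x)" by (metis diff_add_cancel add_diff_eq norm_triangle_ineq)
    also have "\<dots> < \<delta> + A * (2 * \<delta>)" using n q(1) by (simp add: dist_norm norm_minus_commute add_less_le_mono)
    finally have 1: "norm (s n - x) < (2 * A + 1) * \<delta>" by (simp add: algebra_simps)
    have "cball (s n) \<delta> \<subseteq> cball q (2 * \<delta>)"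
    proof
      fix y assume "y \<in> cball (s n) \<delta>"
      then show "y \<in> cball q (2 * \<delta>)" using n dist_triangle[of q y "s n"] by simp
    qed
    then show ?thesis using 1 q(2) unfolding Q_def by blast
  qed
  obtain x0 where "x0 \<in> closure U" using ne ex_in_conv[of "closure U"] by metis
  then obtain n0 where n0: "cball (s n0) \<delta> \<subseteq> U" using Qex unfolding Q_def by blast
  \<comment> \<open>Where no candidate exists \<open>T\<close> takes a fixed good value, so that the
    inclusion of the ball holds for every \<open>x\<close>.\<close>
  define T where "T x = (if \<exists>n. Q x n then s (LEAST n. Q x n) else s n0)" for x
  have [measurable]: "Measurable.pred borel (\<lambda>x. Q x n)" for n unfolding Q_def by measurable
  have mL: "(\<lambda>x. LEAST n. Q x n) \<in> measurable borel (count_space UNIV)" by measurable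
  have "(\<lambda>x. s (LEAST n. Q x n)) \<in> borel_measurable borel"
    by (rule measurable_compose[OF mL]) simp
  then have "T \<in> borel_measurable borel" unfolding T_def by measurable
  moreover have "norm (T x - x) \<le> (2 * A + 1) * \<delta>" if "x \<in> closure U" for x
    using Qex[OF that] LeastI_ex[OF Qex[OF that]] unfolding T_def by (simp add: Q_def[of x "LEAST n. Q x n"])
  moreover have "cball (T x) \<delta> \<subseteq> U" for x
    using LeastI_ex[of "Q x"] n0 unfolding T_def by (simp add: Q_def[of x "LEAST n. Q x n"])
  ultimately show ?thesis by (rule that)
qed

text \<open>The bracket is the constant of \<open>compress_frostman\<close>. The factor
  \<open>2 ^ d / unit_ball_vol (real d)\<close> comes from dividing by the volume of the ball of
  radius \<open>\<delta> / 2\<close>; the remaining powers of \<delta> combine with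
  \<open>t powr \<beta>\<close> to \<open>(t / \<delta>) powr \<beta>\<close>.\<close>

definition frostman_const :: "nat \<Rightarrow> real \<Rightarrow> real" where
  "frostman_const d \<beta> = (unit_ball_vol (real d) * (1 + 4 * real d) ^ d + 2 ^ d * 2 powr \<beta>) * 2 ^ d / unit_ball_vol (real d)"

definition potential_const :: "nat \<Rightarrow> real \<Rightarrow> real \<Rightarrow> real" where
  "potential_const d \<alpha> \<beta> = 1 + frostman_const d \<beta> * 2 powr \<alpha> / (1 - 2 powr (\<alpha> - \<beta>))"

lemma frostman_const_nonneg: "0 \<le> frostman_const d \<beta>"
  unfolding frostman_const_def by (intro divide_nonneg_nonneg mult_nonneg_nonneg add_nonneg_nonneg) auto

lemma potential_const_nonneg: "\<alpha> < \<beta> \<Longrightarrow> 0 \<le> potential_const d \<alpha> \<beta>"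
  unfolding potential_const_def using frostman_const_nonneg[of d \<beta>]
  by (intro add_nonneg_nonneg divide_nonneg_nonneg mult_nonneg_nonneg) (auto simp: powr_less_one less_imp_le)

lemma emeasure_uniform_ball:
  fixes A :: "'a::euclidean_space set"
  assumes "0 < \<rho>"
  shows "A \<in> sets borel \<Longrightarrow> emeasure (uniform_measure lborel (ball 0 \<rho>)) A = emeasure lborel (ball 0 \<rho> \<inter> A) / ennreal (unit_ball_vol (real DIM('a)) * \<rho> ^ DIM('a))"
    and "emeasure (uniform_measure lborel (ball (0::'a) \<rho>)) UNIV = 1"
    and "AE v in uniform_measure lborel (ball (0::'a) \<rho>). v \<in> ball 0 \<rho>"
proof -
  let ?m = "unit_ball_vol (real DIM('a)) * \<rho> ^ DIM('a)"
  have m: "emeasure lborel (ball (0::'a) \<rho>) = ennreal ?m" using assms by (simp add: emeasure_ball)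
  have m0: "?m > 0" using assms by simp
  show "A \<in> sets borel \<Longrightarrow> emeasure (uniform_measure lborel (ball 0 \<rho>)) A = emeasure lborel (ball 0 \<rho> \<inter> A) / ennreal ?m"
    using m by (simp add: emeasure_uniform_measure)
  show "emeasure (uniform_measure lborel (ball (0::'a) \<rho>)) UNIV = 1"
  proof -
    have "?m / ?m = 1" by (rule divide_self) (use m0 in linarith)
    then have "ennreal ?m / ennreal ?m = 1" using divide_ennreal[of ?m ?m] m0 by simp
    then show ?thesis using m by (simp add: emeasure_uniform_measure)
  qed
  show "AE v in uniform_measure lborel (ball (0::'a) \<rho>). v \<in> ball 0 \<rho>"
    by (rule AE_uniform_measureI) auto
qed

text \<open>The image of the uniform ball measure satisfies a Frostman condition whose constant
  depends on the dimension and \<beta> only. Neither \<open>q\<close> nor \<open>Y\<close> enters,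
  since Lebesgue measure is translation invariant and the bound on preimages holds around every
  point.\<close>

lemma compress_potential_le:
  fixes e q Y :: "'a::euclidean_space"
  assumes e: "e \<in> Basis" and r: "0 < r" "r \<le> \<eta> / 2" and \<alpha>: "0 < \<alpha>" "\<alpha> < \<beta>" and \<beta>: "\<beta> \<le> real DIM('a) - 1" and \<delta>: "0 < \<delta>"
    and rel: "r powr \<beta> = \<eta> ^ DIM('a) * \<delta> powr (\<beta> - real DIM('a))"
  shows "(\<integral>\<^sup>+v. riesz_kernel \<alpha> (Y - compress \<eta> r e (q + v)) \<partial>uniform_measure lborel (ball 0 (\<delta> / 2)))
     \<le> ennreal (potential_const DIM('a) \<alpha> \<beta> * \<delta> powr - \<alpha>)"
proof -
  let ?d = "DIM('a)" let ?\<omega> = "unit_ball_vol (real ?d)"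
  let ?\<nu> = "uniform_measure lborel (ball (0::'a) (\<delta> / 2))"
  define f where "f v = compress \<eta> r e (q + v)" for v
  have [measurable]: "f \<in> borel_measurable borel" unfolding f_def by measurable
  define s where "s = distr ?\<nu> borel f"
  have sb: "sets s = sets borel" by (simp add: s_def)
  have \<delta>2: "0 < \<delta> / 2" using \<delta> by simp
  have s1: "emeasure s (space s) = 1"
    unfolding s_def using emeasure_uniform_ball(2)[OF \<delta>2, where 'a = 'a] by (simp add: emeasure_distr)
  define K where "K = ?\<omega> * (1 + 4 * real ?d) ^ ?d + 2 ^ ?d * 2 powr \<beta>"
  have K: "K \<ge> 0" by (simp add: K_def)
  have fc: "frostman_const ?d \<beta> = K * 2 ^ ?d / ?\<omega>" by (simp only: frostman_const_def K_def)
  have frost: "emeasure s (cball Y t) \<le> ennreal (frostman_const ?d \<beta> * (t / \<delta>) powr \<beta>)" if t: "0 < t" "t \<le> \<delta>" for t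
  proof -
    let ?V = "{x. norm (compress \<eta> r e x - Y) \<le> t}" and ?m = "?\<omega> * (\<delta> / 2) ^ ?d"
    have Vb: "?V \<in> sets borel" by measurable
    have pre: "f -` cball Y t = (\<lambda>x. x + (- q)) ` ?V"
      by (auto simp: f_def dist_norm norm_minus_commute image_iff intro!: exI[of _ "q + _"])
    have fb: "f -` cball Y t \<in> sets borel" using measurable_sets_borel[of f borel "cball Y t"] by simp
    have "emeasure s (cball Y t) = emeasure ?\<nu> (f -` cball Y t)"
      unfolding s_def by (subst emeasure_distr) auto
    also have "\<dots> = emeasure lborel (ball 0 (\<delta> / 2) \<inter> f -` cball Y t) / ennreal ?m"
      by (rule emeasure_uniform_ball(1)[OF \<delta>2 fb])
    also have "\<dots> \<le> emeasure lborel (f -` cball Y t) / ennreal ?m"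
      using fb by (intro divide_right_mono_ennreal emeasure_mono) auto
    also have "emeasure lborel (f -` cball Y t) = emeasure lborel ?V"
      unfolding pre by (rule emeasure_lborel_translate[OF Vb])
    also have "emeasure lborel ?V / ennreal ?m \<le> ennreal (K * (\<delta> powr (real ?d - \<beta>) * t powr \<beta>)) / ennreal ?m"
      unfolding K_def using \<alpha> by (intro divide_right_mono_ennreal compress_frostman[OF e r _ \<beta> rel t]) auto
    also have "\<dots> = ennreal (K * (\<delta> powr (real ?d - \<beta>) * t powr \<beta>) / ?m)"
      using K \<delta> by (intro divide_ennreal) auto
    also have "K * (\<delta> powr (real ?d - \<beta>) * t powr \<beta>) / ?m = frostman_const ?d \<beta> * (t / \<delta>) powr \<beta>"
      using \<delta> t by (simp add: fc powr_diff powr_divide powr_realpow power_divide mult_ac)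
    finally show ?thesis .
  qed
  have "(\<integral>\<^sup>+v. riesz_kernel \<alpha> (Y - f v) \<partial>?\<nu>) = (\<integral>\<^sup>+x. riesz_kernel \<alpha> (Y - x) \<partial>s)"
    unfolding s_def by (subst nn_integral_distr) auto
  also have "\<dots> \<le> ennreal (potential_const ?d \<alpha> \<beta> * \<delta> powr - \<alpha>)"
    unfolding potential_const_def by (rule potential_le[OF s1 sb \<alpha> \<delta> frostman_const_nonneg frost])
  finally show ?thesis unfolding f_def .
qed

text \<open>The competitor is the law of \<open>compress \<eta> r e (T x + v)\<close> with
  \<open>x\<close> distributed by \<open>\<mu>\<close> and \<open>v\<close> uniform in a ball. For a
  fixed pair \<open>x\<close>, \<open>y\<close> its interaction is compared with the truncated
  kernel. Far apart, the triangle inequality suffices; close together, averaging over the second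
  \<open>v\<close> alone gives the potential estimate, uniformly in the first point.\<close>

lemma spread_energy_le:
  fixes \<mu> :: "'a::euclidean_space measure"
  assumes e: "e \<in> Basis" and r: "0 < r" "r \<le> \<eta> / 2" and \<alpha>: "0 < \<alpha>" "\<alpha> < \<beta>" and \<beta>: "\<beta> \<le> real DIM('a) - 1" and \<delta>: "0 < \<delta>"
    and rel: "r powr \<beta> = \<eta> ^ DIM('a) * \<delta> powr (\<beta> - real DIM('a))" and \<eta>: "4 * real DIM('a) * \<eta> \<le> \<delta>"
    and \<mu>: "sets \<mu> = sets borel" "emeasure \<mu> (space \<mu>) = 1" "AE x in \<mu>. x \<in> V"
    and T: "T \<in> borel_measurable borel" "\<And>x. x \<in> V \<Longrightarrow> norm (T x - x) \<le> A * \<delta>" and A: "0 \<le> A"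
    and N: "N \<in> sets borel" "\<And>x v. v \<in> ball 0 (\<delta> / 2) \<Longrightarrow> compress \<eta> r e (T x + v) \<in> N"
  shows "min_riesz_energy \<alpha> N \<le> (\<integral>\<^sup>+x. \<integral>\<^sup>+y. truncated_kernel \<alpha> (2 * (A + 1)) (potential_const DIM('a) \<alpha> \<beta>) \<delta> (x - y) \<partial>\<mu> \<partial>\<mu>)"
proof -
  define \<nu> where "\<nu> = uniform_measure lborel (ball (0::'a) (\<delta> / 2))"
  let ?g = "truncated_kernel \<alpha> (2 * (A + 1)) (potential_const DIM('a) \<alpha> \<beta>) \<delta> :: 'a \<Rightarrow> ennreal"
  have \<delta>2: "0 < \<delta> / 2" using \<delta> by simp
  have sp: "space \<mu> = UNIV" using sets_eq_imp_space_eq[OF \<mu>(1)] by simp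
  have \<nu>1: "emeasure \<nu> (space \<nu>) = 1"
    unfolding \<nu>_def using emeasure_uniform_ball(2)[OF \<delta>2, where 'a = 'a] by simp
  have \<nu>b: "sets \<nu> = sets borel" by (simp add: \<nu>_def)
  have sp\<nu>: "space \<nu> = UNIV" by (simp add: \<nu>_def)
  interpret m: finite_measure \<mu> by (rule finite_measureI) (simp add: \<mu>)
  interpret n: finite_measure \<nu> by (rule finite_measureI) (simp add: \<nu>1)
  note [measurable_cong] = \<mu>(1) \<nu>b
  note [measurable] = T(1)
  let ?P = "\<mu> \<Otimes>\<^sub>M \<nu>"
  define f where "f z = compress \<eta> r e (T (fst z) + snd z)" for z
  have fm[measurable]: "f \<in> borel_measurable ?P" unfolding f_def by measurable
  have P1: "emeasure ?P (space ?P) = 1"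
    unfolding space_pair_measure by (subst n.emeasure_pair_measure_Times) (auto simp: \<mu>(2) \<nu>1)
  interpret p: finite_measure ?P by (rule finite_measureI) (simp add: P1)
  define \<sigma> where "\<sigma> = distr ?P borel f"
  have \<sigma>b: "sets \<sigma> = sets borel" by (simp add: \<sigma>_def)
  have AEball: "AE v in \<nu>. v \<in> ball 0 (\<delta> / 2)" unfolding \<nu>_def by (rule emeasure_uniform_ball(3)[OF \<delta>2])
  have \<sigma>N: "emeasure \<sigma> N = 1"
  proof -
    have fN: "f -` N \<inter> space ?P \<in> sets ?P" using N(1) by (intro measurable_sets[OF fm]) auto
    have "emeasure \<sigma> N = emeasure ?P (f -` N \<inter> space ?P)"
      unfolding \<sigma>_def by (rule emeasure_distr[OF fm]) (use N in auto)
    also have "\<dots> = (\<integral>\<^sup>+x. emeasure \<nu> (Pair x -` (f -` N \<inter> space ?P)) \<partial>\<mu>)"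
      by (rule n.emeasure_pair_measure_alt[OF fN])
    also have "\<dots> = (\<integral>\<^sup>+x. 1 \<partial>\<mu>)"
    proof (rule nn_integral_cong)
      fix x
      have "emeasure \<nu> (Pair x -` (f -` N \<inter> space ?P)) = emeasure \<nu> (space \<nu>)"
      proof (rule emeasure_eq_AE)
        show "AE v in \<nu>. v \<in> Pair x -` (f -` N \<inter> space ?P) \<longleftrightarrow> v \<in> space \<nu>"
          using AEball by eventually_elim (use N(2) in \<open>auto simp: f_def space_pair_measure sp sp\<nu>\<close>)
      qed (use sets_Pair1[OF fN, of x] in auto)
      then show "emeasure \<nu> (Pair x -` (f -` N \<inter> space ?P)) = 1" using \<nu>1 by simp
    qed
    also have "\<dots> = 1" using \<mu>(2) by simp
    finally show ?thesis .
  qed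
  have \<sigma>fin: "finite_measure \<sigma>" unfolding \<sigma>_def by (rule p.finite_measure_distr[OF fm])
  define h where "h X = (\<integral>\<^sup>+y. \<integral>\<^sup>+v. riesz_kernel \<alpha> (X - f (y, v)) \<partial>\<nu> \<partial>\<mu>)" for X
  have inner: "(\<integral>\<^sup>+Y. riesz_kernel \<alpha> (X - Y) \<partial>\<sigma>) = h X" for X
  proof -
    have "(\<integral>\<^sup>+Y. riesz_kernel \<alpha> (X - Y) \<partial>\<sigma>) = (\<integral>\<^sup>+z. riesz_kernel \<alpha> (X - f z) \<partial>?P)"
      unfolding \<sigma>_def by (rule nn_integral_distr[OF fm]) measurable
    also have "\<dots> = h X"
      unfolding h_def by (rule n.nn_integral_fst[symmetric]) measurable
    finally show ?thesis .
  qed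
  have hm[measurable]: "h \<in> borel_measurable borel"
    using measurable_potential[OF \<sigma>b \<sigma>fin, of \<alpha>] unfolding inner .
  have "riesz_energy \<alpha> \<sigma> = (\<integral>\<^sup>+X. h X \<partial>\<sigma>)" unfolding riesz_energy_eq inner ..
  also have "\<dots> = (\<integral>\<^sup>+z. h (f z) \<partial>?P)"
    unfolding \<sigma>_def by (rule nn_integral_distr[OF fm]) measurable
  also have "\<dots> = (\<integral>\<^sup>+x. \<integral>\<^sup>+u. h (f (x, u)) \<partial>\<nu> \<partial>\<mu>)"
    by (rule n.nn_integral_fst[symmetric]) measurable
  also have "\<dots> \<le> (\<integral>\<^sup>+x. \<integral>\<^sup>+y. ?g (x - y) \<partial>\<mu> \<partial>\<mu>)"
  proof (rule nn_integral_mono_AE)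
    \<comment> \<open>The displacement budget: \<open>A * \<delta>\<close> from \<open>T\<close>,
      \<open>\<delta> / 2\<close> from \<open>v\<close>, and at most \<open>\<delta> / 4\<close>
      from the compression. Two such displacements explain the \<open>2 * (A + 1)\<close> in the
      truncated kernel.\<close>
    have f_near: "norm (f (x, u) - x) \<le> (A + 1) * \<delta>" if "x \<in> V" "u \<in> ball 0 (\<delta> / 2)" for x u
    proof -
      have "norm (f (x, u) - x) \<le> norm (f (x, u) - (T x + u)) + norm (T x - x) + norm u"
        using norm_triangle_ineq[of "f (x, u) - (T x + u)" "(T x - x) + u"] norm_triangle_ineq[of "T x - x" u]
        by (simp add: algebra_simps)
      also have "norm (f (x, u) - (T x + u)) \<le> real DIM('a) * \<eta>"
        unfolding f_def using r by (simp add: norm_compress_diff)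
      also have "norm (T x - x) \<le> A * \<delta>" by (rule T(2)[OF that(1)])
      finally show ?thesis using that(2) \<eta> \<delta> by (simp add: algebra_simps)
    qed
    show "AE x in \<mu>. (\<integral>\<^sup>+u. h (f (x, u)) \<partial>\<nu>) \<le> (\<integral>\<^sup>+y. ?g (x - y) \<partial>\<mu>)"
      using \<mu>(3)
    proof eventually_elim
      case (elim x)
      have "(\<integral>\<^sup>+u. h (f (x, u)) \<partial>\<nu>) \<le> (\<integral>\<^sup>+u. (\<integral>\<^sup>+y. ?g (x - y) \<partial>\<mu>) \<partial>\<nu>)"
      proof (rule nn_integral_mono_AE)
        show "AE u in \<nu>. h (f (x, u)) \<le> (\<integral>\<^sup>+y. ?g (x - y) \<partial>\<mu>)"
          using AEball
        proof eventually_elim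
          case (elim u)
          note u = elim
          show ?case
            unfolding h_def
          proof (rule nn_integral_mono_AE)
            show "AE y in \<mu>. (\<integral>\<^sup>+v. riesz_kernel \<alpha> (f (x, u) - f (y, v)) \<partial>\<nu>) \<le> ?g (x - y)"
              using \<mu>(3)
            proof eventually_elim
              case (elim y)
              show ?case
              proof (cases "2 * (2 * (A + 1)) * \<delta> \<le> norm (x - y)")
                case True
                let ?t = "norm (x - y) - 2 * (A + 1) * \<delta>"
                have "(A + 1) * \<delta> > 0" using A \<delta> by simp
                then have t: "?t > 0" using True by (simp add: algebra_simps)
                have "(\<integral>\<^sup>+v. riesz_kernel \<alpha> (f (x, u) - f (y, v)) \<partial>\<nu>) \<le> (\<integral>\<^sup>+v. ennreal (?t powr - \<alpha>) \<partial>\<nu>)"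
                proof (rule nn_integral_mono_AE)
                  show "AE v in \<nu>. riesz_kernel \<alpha> (f (x, u) - f (y, v)) \<le> ennreal (?t powr - \<alpha>)"
                    using AEball
                  proof eventually_elim
                    case (elim v)
                    have "norm (x - y) \<le> norm (f (x, u) - f (y, v)) + norm (f (x, u) - x) + norm (f (y, v) - y)"
                      using norm_triangle_ineq[of "(f (x, u) - f (y, v)) - (f (x, u) - x)" "f (y, v) - y"]
                        norm_triangle_ineq4[of "f (x, u) - f (y, v)" "f (x, u) - x"] by simp
                    then have "?t \<le> norm (f (x, u) - f (y, v))"
                      using f_near[OF \<open>x \<in> V\<close> u] f_near[OF \<open>y \<in> V\<close> elim] by (simp add: algebra_simps)
                    then show ?case by (rule riesz_kernel_le[OF t _ \<alpha>(1)])
                  qed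
                qed
                also have "\<dots> = ennreal (?t powr - \<alpha>)" using \<nu>1 by simp
                also have "\<dots> = ?g (x - y)" using True by (simp add: truncated_kernel_def)
                finally show ?thesis .
              next
                case False
                have "(\<integral>\<^sup>+v. riesz_kernel \<alpha> (f (x, u) - f (y, v)) \<partial>\<nu>) \<le> ennreal (potential_const DIM('a) \<alpha> \<beta> * \<delta> powr - \<alpha>)"
                  using compress_potential_le[OF e r \<alpha> \<beta> \<delta> rel, of "f (x, u)" "T y", folded \<nu>_def] by (simp add: f_def)
                also have "\<dots> = ?g (x - y)" using False by (simp add: truncated_kernel_def)
                finally show ?thesis .
              qed
            qed
          qed
        qed
      qed
      also have "\<dots> = (\<integral>\<^sup>+y. ?g (x - y) \<partial>\<mu>)" using \<nu>1 by simp
      finally show ?case .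
    qed
  qed
  finally show ?thesis using min_riesz_energy_le[OF \<sigma>b \<sigma>N, of \<alpha>] by (rule order_trans[rotated])
qed

text \<open>\<open>N\<close> will carry the charge, and \<open>W\<close> is the cheap open set that
  puts \<open>N\<close> inside a competitor. Compactness of \<open>N\<close> keeps a competitor open
  when \<open>N\<close> is removed from it.\<close>

lemma flat_cubes:
  fixes U :: "'a::euclidean_space set"
  assumes U: "open U" "bounded U" and d: "2 \<le> DIM('a)" and \<beta>: "0 < \<beta>" "\<beta> < real DIM('a) - 1" and \<delta>: "0 < \<delta>" and \<epsilon>: "0 < \<epsilon>"
    and e: "e \<in> Basis"
  obtains \<eta> r N W where "0 < r" "r \<le> \<eta> / 2" "r powr \<beta> = \<eta> ^ DIM('a) * \<delta> powr (\<beta> - real DIM('a))" "4 * real DIM('a) * \<eta> \<le> \<delta>"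
    "compact N" "N \<in> null_sets lborel" "open W" "N \<subseteq> W" "W \<subseteq> U" "per_bound W \<epsilon>" "emeasure lborel W \<le> ennreal \<epsilon>"
    "\<And>x. cball x (\<delta> / 2) \<subseteq> U \<Longrightarrow> compress \<eta> r e x \<in> N"
proof -
  let ?d = "DIM('a)" let ?\<omega> = "unit_ball_vol (real ?d)"
  obtain Cb where Cb: "Cb \<ge> 0" "\<And>(x::'a) r. r > 0 \<Longrightarrow> per_bound (ball x r) (Cb * r ^ (?d - 1))"
    by (rule per_bound_ball) (rule that; assumption)
  define MU where "MU = measure lborel U"
  \<comment> \<open>A cube of side \<open>r\<close> reaches at most \<open>DIM('a) * r\<close> from
    its corner, so a ball of radius \<open>k * r\<close> contains it.\<close>
  define k where "k = real ?d + 1"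
  have k: "k > 0" by (simp add: k_def)
  \<comment> \<open>\<open>X\<close> collects the factors in the perimeter and in the volume of
    \<open>W\<close>, so that one smallness condition on \<open>r ^ (d - 1) / \<eta> ^ d\<close>
    serves both; the 1 keeps it positive.\<close>
  define X where "X = MU * (Cb * k ^ (?d - 1)) + MU * (?\<omega> * k ^ (?d - 1) * \<delta>) + 1"
  have X: "X > 0" "MU * (Cb * k ^ (?d - 1)) \<le> X" "MU * (?\<omega> * k ^ (?d - 1) * \<delta>) \<le> X"
  proof -
    have "0 \<le> MU * (Cb * k ^ (?d - 1))" "0 \<le> MU * (?\<omega> * k ^ (?d - 1) * \<delta>)"
      using Cb k \<delta> by (simp_all add: MU_def)
    then show "X > 0" "MU * (Cb * k ^ (?d - 1)) \<le> X" "MU * (?\<omega> * k ^ (?d - 1) * \<delta>) \<le> X" unfolding X_def by linarith+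
  qed
  have c: "0 < \<delta> / (4 * k)" "0 < \<epsilon> / X" using \<delta> k \<epsilon> X by auto
  obtain \<eta> r where \<eta>: "0 < \<eta>" "\<eta> < \<delta> / (4 * k)" and r: "0 < r" "r \<le> \<eta> / 2" and rel: "r powr \<beta> = \<eta> ^ ?d * \<delta> powr (\<beta> - real ?d)"
    and small: "r ^ (?d - 1) \<le> \<epsilon> / X * \<eta> ^ ?d"
    by (rule lattice_parameters[OF d \<beta> \<delta> c]) (rule that; assumption)
  have k\<eta>: "4 * (k * \<eta>) \<le> \<delta>" using \<eta>(2) k by (simp add: field_simps)
  then have d\<eta>: "4 * real ?d * \<eta> \<le> \<delta>" using \<eta>(1) by (simp add: k_def algebra_simps)
  have kr: "4 * (k * r) \<le> \<delta>"
  proof -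
    have "k * r \<le> k * \<eta>" using r \<eta> k by (intro mult_left_mono) auto
    then show ?thesis using k\<eta> by linarith
  qed
  define Z where "Z = cell_corner \<eta> ` {x::'a. cball x (\<delta> / 2) \<subseteq> U}"
  have Z: "finite Z" "real (card Z) * \<eta> ^ ?d \<le> MU"
    unfolding Z_def MU_def using card_cells_le[OF U \<eta>(1) d\<eta>] by auto
  define cube where "cube z = cbox z (z + r *\<^sub>R (One - e))" for z :: 'a
  define N where "N = (\<Union>z\<in>Z. cube z)"
  define W where "W = (\<Union>z\<in>Z. ball z (k * r))"
  have cubeW: "cube z \<subseteq> ball z (k * r)" for z
  proof
    fix x assume x: "x \<in> cube z"
    have "norm (x - z) \<le> real ?d * r"
    proof (rule norm_le_DIM_mult)
      fix b :: 'a assume b: "b \<in> Basis"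
      have "(One - e) \<bullet> b \<le> 1" using b e by (simp add: inner_diff_left inner_Basis)
      then have "r * ((One - e) \<bullet> b) \<le> r * 1" using r by (intro mult_left_mono) auto
      then show "\<bar>(x - z) \<bullet> b\<bar> \<le> r"
        using x b unfolding cube_def mem_box by (auto simp: inner_diff_left inner_add_left abs_le_iff dest!: bspec[OF _ b])
    qed
    also have "\<dots> < k * r" using r by (simp add: k_def)
    finally show "x \<in> ball z (k * r)" by (simp add: dist_norm norm_minus_commute)
  qed
  have cube0: "cube z \<in> null_sets lborel" for z
  proof -
    have ee: "(One - e) \<bullet> b = (if b = e then 0 else 1)" if "b \<in> Basis" for b
      using that e by (auto simp: inner_diff_left inner_Basis)
    have "emeasure lborel (cube z) = ennreal (\<Prod>b\<in>Basis. (z + r *\<^sub>R (One - e) - z) \<bullet> b)"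
      unfolding cube_def by (rule emeasure_lborel_cbox) (use ee r in \<open>auto simp: inner_add_left\<close>)
    also have "(\<Prod>b\<in>Basis. (z + r *\<^sub>R (One - e) - z) \<bullet> b) = 0"
      by (rule prod_zero[OF finite_Basis]) (use e ee[OF e] in \<open>auto intro!: bexI[of _ e]\<close>)
    finally show ?thesis by (simp add: null_sets_def cube_def)
  qed
  have card_small: "real (card Z) * r ^ (?d - 1) \<le> \<epsilon> / X * MU"
  proof -
    have "real (card Z) * r ^ (?d - 1) \<le> real (card Z) * (\<epsilon> / X * \<eta> ^ ?d)" by (intro mult_left_mono small) auto
    also have "\<dots> = \<epsilon> / X * (real (card Z) * \<eta> ^ ?d)" by simp
    also have "\<dots> \<le> \<epsilon> / X * MU" using Z(2) c by (intro mult_left_mono) auto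
    finally show ?thesis .
  qed
  have scaled: "real (card Z) * (Q * r ^ (?d - 1)) \<le> \<epsilon>" if "0 \<le> Q" "MU * Q \<le> X" for Q
  proof -
    have "real (card Z) * (Q * r ^ (?d - 1)) = Q * (real (card Z) * r ^ (?d - 1))" by simp
    also have "\<dots> \<le> Q * (\<epsilon> / X * MU)" using that by (intro mult_left_mono card_small)
    also have "\<dots> = \<epsilon> / X * (MU * Q)" by simp
    also have "\<dots> \<le> \<epsilon> / X * X" using that c by (intro mult_left_mono) auto
    also have "\<dots> = \<epsilon>" using X by simp
    finally show ?thesis .
  qed
  show ?thesis
  proof (rule that[OF r rel d\<eta>, of N W])
    show "compact N" unfolding N_def cube_def using Z(1) by (intro compact_UN) auto
    show "N \<in> null_sets lborel" unfolding N_def using Z(1) cube0 by (intro null_sets.finite_UN) auto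
    show "open W" unfolding W_def by auto
    show "N \<subseteq> W" unfolding N_def W_def using cubeW by blast
    show "W \<subseteq> U"
    proof
      fix w assume "w \<in> W"
      then obtain x where x: "cball x (\<delta> / 2) \<subseteq> U" "w \<in> ball (cell_corner \<eta> x) (k * r)" unfolding W_def Z_def by blast
      have "norm (cell_corner \<eta> x - x) \<le> real ?d * \<eta>" by (rule norm_cell_corner_diff[OF \<eta>(1)])
      then have "dist x (cell_corner \<eta> x) \<le> \<delta> / 4" using d\<eta> by (simp add: dist_norm norm_minus_commute)
      then have "dist x w \<le> \<delta> / 2" using x(2) kr dist_triangle[of x w "cell_corner \<eta> x"] by simp
      then show "w \<in> U" using x(1) by auto
    qed
    have kr0: "k * r > 0" using k r by simp
    show "per_bound W \<epsilon>"
    proof (rule per_bound_mono)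
      show "per_bound W (real (card Z) * (Cb * (k * r) ^ (?d - 1)))"
        unfolding W_def using Z(1) by (intro per_bound_UN Cb(2) kr0) auto
      show "real (card Z) * (Cb * (k * r) ^ (?d - 1)) \<le> \<epsilon>"
        using scaled[of "Cb * k ^ (?d - 1)"] Cb k X(2) by (simp add: power_mult_distrib mult.assoc)
    qed
    have "emeasure lborel W \<le> (\<Sum>z\<in>Z. emeasure lborel (ball z (k * r)))"
      unfolding W_def using Z(1) by (intro emeasure_subadditive_finite) auto
    also have "\<dots> = (\<Sum>z\<in>Z. ennreal (?\<omega> * (k * r) ^ ?d))" using kr0 by (simp add: emeasure_ball)
    also have "\<dots> = ennreal (real (card Z) * (?\<omega> * (k * r) ^ ?d))"
      using kr0 by (simp add: ennreal_mult ennreal_of_nat_eq_real_of_nat)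
    also have "\<dots> \<le> ennreal \<epsilon>"
    proof (rule ennreal_leI)
      have "(k * r) ^ ?d = (k * r) * (k * r) ^ (?d - 1)" using DIM_positive[where 'a = 'a] by (simp add: power_eq_if)
      also have "\<dots> \<le> \<delta> * (k * r) ^ (?d - 1)" using kr kr0 by (intro mult_right_mono) auto
      finally have "?\<omega> * (k * r) ^ ?d \<le> ?\<omega> * (\<delta> * (k * r) ^ (?d - 1))" by (intro mult_left_mono) auto
      then have "real (card Z) * (?\<omega> * (k * r) ^ ?d) \<le> real (card Z) * (?\<omega> * (\<delta> * (k * r) ^ (?d - 1)))"
        by (intro mult_left_mono) auto
      also have "\<dots> = real (card Z) * ((?\<omega> * k ^ (?d - 1) * \<delta>) * r ^ (?d - 1))" by (simp add: power_mult_distrib)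
      also have "\<dots> \<le> \<epsilon>" using k \<delta> X(3) by (intro scaled) auto
      finally show "real (card Z) * (?\<omega> * (k * r) ^ ?d) \<le> \<epsilon>" .
    qed
    finally show "emeasure lborel W \<le> ennreal \<epsilon>" .
    fix x :: 'a assume x: "cball x (\<delta> / 2) \<subseteq> U"
    have "compress \<eta> r e x \<in> cube (cell_corner \<eta> x)"
      unfolding cube_def by (rule compress_mem_flat_cube[OF r(1) \<eta>(1) e])
    then show "compress \<eta> r e x \<in> N" unfolding N_def Z_def using x by blast
  qed
qed

section \<open>Near-optimal open sets\<close>

text \<open>A measure whose energy is strictly below the target is restricted to the closure, where
  it is finite. Its truncated energies converge to its energy, so at a small enough scale \<delta>
  they are below the target too, and they bound the energy of the measure moved onto the
  cubes.\<close>

lemma capacity_carrier: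
  fixes U :: "'a::euclidean_space set"
  assumes U: "open_smooth_boundary U" "bounded U" "U \<noteq> {}" and d: "2 \<le> DIM('a)" and \<alpha>: "0 < \<alpha>" "\<alpha> < real DIM('a) - 1"
    and fin: "min_riesz_energy \<alpha> (closure U) < \<infinity>" and \<epsilon>: "0 < \<epsilon>"
  obtains N W where "compact N" "N \<in> null_sets lborel" "open W" "N \<subseteq> W" "W \<subseteq> U" "per_bound W \<epsilon>"
    "emeasure lborel W \<le> ennreal \<epsilon>" "min_riesz_energy \<alpha> N \<le> min_riesz_energy \<alpha> (closure U) + ennreal \<epsilon>"
proof -
  let ?I = "min_riesz_energy \<alpha> (closure U)"
  have oU: "open U" using U(1) by (simp add: open_smooth_boundary_def)
  have "?I < ?I + ennreal \<epsilon>" using fin \<epsilon> by (cases ?I) (auto simp flip: ennreal_plus intro!: ennreal_lessI)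
  then obtain \<mu>0 where \<mu>0: "sets \<mu>0 = sets borel" "emeasure \<mu>0 (closure U) = 1" "riesz_energy \<alpha> \<mu>0 < ?I + ennreal \<epsilon>"
    unfolding min_riesz_energy_def INF_less_iff by auto
  define \<mu> where "\<mu> = density \<mu>0 (indicator (closure U) :: 'a \<Rightarrow> ennreal)"
  have clb: "closure U \<in> sets borel" by simp
  note \<mu> = restricted_riesz_energy[OF clb \<mu>0(1,2), folded \<mu>_def]
  have \<mu>e: "riesz_energy \<alpha> \<mu> < ?I + ennreal \<epsilon>" using \<mu>(4) \<mu>0(3) by (rule le_less_trans)
  then have \<mu>fin: "riesz_energy \<alpha> \<mu> < \<infinity>" by (metis infinity_ennreal_def less_top_ennreal not_less_iff_gr_or_eq order_less_trans top.not_eq_extremum)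
  have fm: "finite_measure \<mu>" by (rule finite_measureI) (simp add: \<mu>)
  obtain A0 d0 where A0: "A0 > 0" "d0 > 0"
    "\<And>x \<delta>. 0 < \<delta> \<Longrightarrow> \<delta> < d0 \<Longrightarrow> x \<in> closure U \<Longrightarrow> \<exists>q. norm (q - x) \<le> A0 * \<delta> \<and> cball q \<delta> \<subseteq> U"
    by (rule interior_corkscrew[OF U(1,2)]) (rule that; assumption)
  define A where "A = 2 * A0 + 1"
  have A: "0 \<le> A" using A0 by (simp add: A_def)
  \<comment> \<open>Any exponent strictly between \<alpha> and \<open>d - 1\<close> would do; the
    midpoint is taken.\<close>
  define \<beta> where "\<beta> = (\<alpha> + (real DIM('a) - 1)) / 2"
  have \<beta>: "\<alpha> < \<beta>" "\<beta> < real DIM('a) - 1" "0 < \<beta>" using \<alpha> by (auto simp: \<beta>_def)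
  define C where "C = potential_const DIM('a) \<alpha> \<beta>"
  have C: "0 \<le> C" unfolding C_def by (rule potential_const_nonneg[OF \<beta>(1)])
  let ?\<delta> = "\<lambda>n. inverse (real (Suc n))"
  have D: "0 < 2 * (A + 1)" using A by simp
  have "eventually (\<lambda>n. (\<integral>\<^sup>+x. \<integral>\<^sup>+y. truncated_kernel \<alpha> (2 * (A + 1)) C (?\<delta> n) (x - y) \<partial>\<mu> \<partial>\<mu>) < ?I + ennreal \<epsilon>) sequentially"
    by (rule order_tendstoD(2)[OF truncated_energy_limit[OF \<mu>(1) fm \<mu>fin \<alpha>(1) D C] \<mu>e])
  moreover have "eventually (\<lambda>n. ?\<delta> n < d0 / 2) sequentially"
    by (rule order_tendstoD(2)[OF LIMSEQ_inverse_real_of_nat]) (use A0 in auto)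
  ultimately have "eventually (\<lambda>n. (\<integral>\<^sup>+x. \<integral>\<^sup>+y. truncated_kernel \<alpha> (2 * (A + 1)) C (?\<delta> n) (x - y) \<partial>\<mu> \<partial>\<mu>) < ?I + ennreal \<epsilon> \<and> ?\<delta> n < d0 / 2) sequentially"
    by eventually_elim auto
  then obtain n where n: "(\<integral>\<^sup>+x. \<integral>\<^sup>+y. truncated_kernel \<alpha> (2 * (A + 1)) C (?\<delta> n) (x - y) \<partial>\<mu> \<partial>\<mu>) < ?I + ennreal \<epsilon>" "?\<delta> n < d0 / 2"
    using eventually_happens'[OF sequentially_bot] by blast
  define \<delta> where "\<delta> = ?\<delta> n"
  have \<delta>: "0 < \<delta>" "2 * \<delta> < d0" using n(2) by (auto simp: \<delta>_def)
  \<comment> \<open>The measurable selection halves the radius, so inner balls are requested at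
    scale \<open>2 * \<delta>\<close>.\<close>
  have ck: "\<exists>q. norm (q - x) \<le> A0 * (2 * \<delta>) \<and> cball q (2 * \<delta>) \<subseteq> U" if "x \<in> closure U" for x
    using A0(3)[of "2 * \<delta>" x] \<delta> that by simp
  have ne: "closure U \<noteq> {}" using U(3) by simp
  obtain T where T: "T \<in> borel_measurable borel" "\<And>x. x \<in> closure U \<Longrightarrow> norm (T x - x) \<le> (2 * A0 + 1) * \<delta>"
    "\<And>x. cball (T x) \<delta> \<subseteq> U"
    by (rule measurable_corkscrew_selection[OF ck \<delta>(1) ne]) (assumption, (rule that; assumption))
  obtain e :: 'a where e: "e \<in> Basis" using nonempty_Basis by blast
  obtain \<eta> r N W where NW: "0 < r" "r \<le> \<eta> / 2" "r powr \<beta> = \<eta> ^ DIM('a) * \<delta> powr (\<beta> - real DIM('a))" "4 * real DIM('a) * \<eta> \<le> \<delta>"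
    "compact N" "N \<in> null_sets lborel" "open W" "N \<subseteq> W" "W \<subseteq> U" "per_bound W \<epsilon>" "emeasure lborel W \<le> ennreal \<epsilon>"
    "\<And>x. cball x (\<delta> / 2) \<subseteq> U \<Longrightarrow> compress \<eta> r e x \<in> N"
    by (rule flat_cubes[OF oU U(2) d \<beta>(3,2) \<delta>(1) \<epsilon> e]) (rule that; assumption)
  have "min_riesz_energy \<alpha> N \<le> (\<integral>\<^sup>+x. \<integral>\<^sup>+y. truncated_kernel \<alpha> (2 * (A + 1)) C \<delta> (x - y) \<partial>\<mu> \<partial>\<mu>)"
    unfolding C_def
  proof (rule spread_energy_le[OF e NW(1,2) \<alpha>(1) \<beta>(1) less_imp_le[OF \<beta>(2)] \<delta>(1) NW(3,4) \<mu>(1,3,5) T(1) _ A])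
    show "norm (T x - x) \<le> A * \<delta>" if "x \<in> closure U" for x using T(2)[OF that] by (simp add: A_def)
    show "N \<in> sets borel" using NW(6) by auto
    fix x v :: 'a assume v: "v \<in> ball 0 (\<delta> / 2)"
    have "cball (T x + v) (\<delta> / 2) \<subseteq> cball (T x) \<delta>"
    proof
      fix w assume "w \<in> cball (T x + v) (\<delta> / 2)"
      then show "w \<in> cball (T x) \<delta>" using v dist_triangle[of "T x" w "T x + v"] by (simp add: dist_norm)
    qed
    then show "compress \<eta> r e (T x + v) \<in> N" using NW(12) T(3)[of x] by blast
  qed
  then have "min_riesz_energy \<alpha> N \<le> ?I + ennreal \<epsilon>" using n(1) unfolding \<delta>_def by (rule order_trans[OF _ less_imp_le])
  then show ?thesis using that[OF NW(5-11)] by blast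
qed

section \<open>Volume adjustment by small balls\<close>

lemma point_of_positive_measure:
  fixes A :: "'a::euclidean_space set"
  assumes A: "A \<in> sets borel" "bounded A" "0 < measure lborel A"
  obtains x where "x \<in> A" "\<And>r. r > 0 \<Longrightarrow> 0 < measure lborel (A \<inter> ball x r)"
proof -
  have fin: "emeasure lborel (A \<inter> B) < \<infinity>" for B
    using emeasure_bounded_finite[of "A \<inter> B"] A(2) by (auto intro: bounded_subset)
  have "\<not> negligible A"
  proof
    assume "negligible A"
    then have "emeasure lborel A = 0" using A(1) by (simp add: negligible_iff_emeasure0)
    then show False using A(3) by (simp add: measure_def)
  qed
  then obtain x where x: "x \<in> A" "\<And>V. openin (top_of_set A) V \<Longrightarrow> x \<in> V \<Longrightarrow> \<not> negligible V"
    using locally_negligible_alt[of A] by blast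
  have "0 < measure lborel (A \<inter> ball x r)" if "r > 0" for r
  proof (rule ccontr)
    assume "\<not> ?thesis"
    then have "measure lborel (A \<inter> ball x r) = 0" using measure_nonneg[of lborel "A \<inter> ball x r"] by linarith
    then have "emeasure lborel (A \<inter> ball x r) = 0"
      using fin[of "ball x r"] by (simp add: emeasure_eq_ennreal_measure)
    then have "negligible (A \<inter> ball x r)" using A(1) by (simp add: negligible_iff_emeasure0)
    moreover have "openin (top_of_set A) (A \<inter> ball x r)" by (simp add: openin_open_Int)
    ultimately show False using x that by auto
  qed
  with x(1) show ?thesis by (rule that)
qed

lemma bounded_fmeasurable:
  fixes S :: "'a::euclidean_space set"
  assumes "S \<in> sets borel" "bounded S"
  shows "S \<in> fmeasurable lborel"
  by (rule fmeasurableI) (use assms emeasure_bounded_finite[OF assms(2)] in auto)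

lemma emeasure_eq_measure_bounded:
  fixes S :: "'a::euclidean_space set"
  assumes "bounded S"
  shows "emeasure lborel S = ennreal (measure lborel S)"
  by (rule emeasure_eq_ennreal_measure) (use emeasure_bounded_finite[OF assms] in auto)

lemma measure_ball_eq:
  "0 \<le> r \<Longrightarrow> measure lborel (ball (x::'a::euclidean_space) r) = unit_ball_vol (real DIM('a)) * r ^ DIM('a)"
  by (simp add: measure_def emeasure_ball)

text \<open>The volume of the union grows with the radius by no more than the volume of the ball
  does, hence continuously, and the intermediate value theorem gives the radius.\<close>

lemma exists_ball_with_volume:
  fixes E :: "'a::euclidean_space set"
  assumes E: "E \<in> sets borel" "bounded E" and m: "measure lborel E < m" "m \<le> measure lborel (E \<union> ball y R)" and R: "0 < R"
  obtains \<rho> where "0 < \<rho>" "\<rho> \<le> R" "measure lborel (E \<union> ball y \<rho>) = m"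
proof -
  define g where "g \<rho> = measure lborel (E \<union> ball y \<rho>)" for \<rho>
  define h where "h \<rho> = unit_ball_vol (real DIM('a)) * \<rho> ^ DIM('a)" for \<rho> :: real
  have fE: "E \<in> fmeasurable lborel" by (rule bounded_fmeasurable[OF E])
  have fB: "ball y \<rho> \<in> fmeasurable lborel" for \<rho> by (rule bounded_fmeasurable) auto
  have step: "g a \<le> g b \<and> g b - g a \<le> h b - h a" if "0 \<le> a" "a \<le> b" for a b
  proof
    show "g a \<le> g b" unfolding g_def
      by (rule measure_mono_fmeasurable) (use that fE fB in \<open>auto intro: fmeasurable.Un simp: E\<close>)
    have sub: "ball y a \<subseteq> ball y b" using that by auto
    have "g b \<le> measure lborel ((E \<union> ball y a) \<union> (ball y b - ball y a))"
      unfolding g_def by (rule measure_mono_fmeasurable) (use fE fB in \<open>auto intro!: fmeasurable.Un fmeasurable.Diff simp: E\<close>)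
    also have "\<dots> \<le> g a + measure lborel (ball y b - ball y a)"
      unfolding g_def by (rule measure_Un_le) (auto simp: E)
    also have "measure lborel (ball y b - ball y a) = h b - h a"
      using measurable_measure_Diff[OF fB _ sub] that by (simp add: measure_ball_eq h_def)
    finally show "g b - g a \<le> h b - h a" by simp
  qed
  have dist_le: "\<bar>g a - g b\<bar> \<le> \<bar>h a - h b\<bar>" if "0 \<le> a" "0 \<le> b" for a b
    using step[of a b] step[of b a] that by (cases "a \<le> b") auto
  have ch: "continuous_on {0..R} h" unfolding h_def by (intro continuous_intros)
  have "continuous_on {0..R} g"
    unfolding continuous_on_iff
  proof (intro ballI allI impI)
    fix a e :: real assume a: "a \<in> {0..R}" and "e > 0"
    then obtain d where d: "d > 0" "\<And>b. b \<in> {0..R} \<Longrightarrow> dist b a < d \<Longrightarrow> dist (h b) (h a) < e"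
      using ch unfolding continuous_on_iff by metis
    have "dist (g b) (g a) < e" if "b \<in> {0..R}" "dist b a < d" for b
      using d(2)[OF that] dist_le[of b a] that a by (simp add: dist_real_def)
    then show "\<exists>d>0. \<forall>b\<in>{0..R}. dist b a < d \<longrightarrow> dist (g b) (g a) < e" using d(1) by blast
  qed
  moreover have "g 0 \<le> m" "m \<le> g R" using m by (auto simp: g_def)
  ultimately obtain \<rho> where \<rho>: "0 \<le> \<rho>" "\<rho> \<le> R" "g \<rho> = m" using IVT'[of g 0 m R] R by auto
  have "\<rho> \<noteq> 0" using \<rho>(3) m(1) by (auto simp: g_def)
  then show ?thesis using that[of \<rho>] \<rho> by (simp add: g_def)
qed

text \<open>The order of the choices matters. The deficit is created first, by removing a ball
  around a point of \<open>E0\<close>, and the place of the filling ball is fixed where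
  \<open>U - E0\<close> has positive volume. Only then is the error \<kappa> chosen, small against
  both. The filling ball is added last, so that it also absorbs the volume changes caused by the
  approximation and by \<open>W\<close>.\<close>

lemma near_optimal_set:
  fixes U E0 :: "'a::euclidean_space set"
  assumes U: "open_smooth_boundary U" "bounded U" and d: "2 \<le> DIM('a)" and \<alpha>: "0 < \<alpha>" "\<alpha> < real DIM('a) - 1"
    and fin: "min_riesz_energy \<alpha> (closure U) < \<infinity>" and \<epsilon>: "0 < \<epsilon>"
    and E0: "E0 \<in> sets borel" "E0 \<subseteq> closure U" "per_bound E0 c" "measure lborel E0 = m"
    and m: "0 < m" "m < measure lborel (closure U)"
  obtains E N where "open E" "E \<subseteq> U" "measure lborel E = m" "per_bound E (c + 4 * \<epsilon>)"
    "compact N" "N \<in> null_sets lborel" "N \<subseteq> E" "min_riesz_energy \<alpha> N \<le> min_riesz_energy \<alpha> (closure U) + ennreal \<epsilon>"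
proof -
  let ?\<mu> = "measure lborel" and ?d = "DIM('a)" and ?\<omega> = "unit_ball_vol (real DIM('a))"
  have oU: "open U" using U(1) by (simp add: open_smooth_boundary_def)
  have U0: "U \<noteq> {}" using m by auto
  have fU: "U \<in> fmeasurable lborel" by (rule bounded_fmeasurable) (use oU U in auto)
  have E0bd: "bounded E0" using E0(2) U(2) by (meson bounded_closure bounded_subset)
  have fE0: "E0 \<in> fmeasurable lborel" by (rule bounded_fmeasurable[OF E0(1) E0bd])
  have clU: "?\<mu> (closure U) = ?\<mu> U"
  proof -
    have "closure U = U \<union> frontier U" using oU closure_Un_frontier by blast
    then show ?thesis using frontier_null[OF U(1,2)] oU by (simp add: measure_Un_null_set)
  qed
  obtain Cb where Cb: "Cb \<ge> 0" "\<And>(x::'a) r. r > 0 \<Longrightarrow> per_bound (ball x r) (Cb * r ^ (?d - 1))"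
    by (rule per_bound_ball) (rule that; assumption)
  \<comment> \<open>In dimension at least 2 the power \<open>r ^ (d - 1)\<close> is at most
    \<open>r\<close> for \<open>r \<le> 1\<close>, so small balls have small perimeter.\<close>
  have ball_small: "per_bound (ball x r) \<epsilon>" if "0 < r" "r \<le> 1" "r \<le> \<epsilon> / (Cb + 1)" for x :: 'a and r
  proof (rule per_bound_mono[OF Cb(2)[OF that(1)]])
    have "r ^ (?d - 1) \<le> r ^ 1" using that d by (intro power_decreasing) auto
    then have "Cb * r ^ (?d - 1) \<le> Cb * (\<epsilon> / (Cb + 1))" using that Cb(1) by (intro mult_left_mono) auto
    also have "\<dots> \<le> \<epsilon>" using Cb(1) \<epsilon> by (simp add: divide_simps)
    finally show "Cb * r ^ (?d - 1) \<le> \<epsilon>" .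
  qed
  define A where "A = U - E0"
  have fA: "A \<in> fmeasurable lborel" by (rule bounded_fmeasurable) (use oU E0(1) U(2) in \<open>auto simp: A_def intro: bounded_subset\<close>)
  have Ab: "A \<in> sets borel" "bounded A" using oU E0(1) U(2) by (auto simp: A_def intro: bounded_subset)
  have pos: "0 < ?\<mu> A"
  proof -
    have "?\<mu> U \<le> ?\<mu> (E0 \<union> A)" using fE0 fA oU by (intro measure_mono_fmeasurable fmeasurable.Un) (auto simp: A_def)
    also have "\<dots> \<le> ?\<mu> E0 + ?\<mu> A" using fE0 fA by (intro measure_Un_le) (auto intro: fmeasurableD)
    finally show ?thesis using m clU E0(4) by simp
  qed
  obtain y0 where y0: "y0 \<in> A" "\<And>r. r > 0 \<Longrightarrow> 0 < ?\<mu> (A \<inter> ball y0 r)"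
    by (rule point_of_positive_measure[OF Ab pos]) (rule that; assumption)
  obtain rU where rU: "rU > 0" "ball y0 rU \<subseteq> U" using y0(1) oU openE unfolding A_def by blast
  define R where "R = min rU (min 1 (\<epsilon> / (Cb + 1)))"
  have R: "0 < R" "R \<le> 1" "R \<le> \<epsilon> / (Cb + 1)" "ball y0 R \<subseteq> U"
    using rU Cb(1) \<epsilon> by (auto simp: R_def)
  \<comment> \<open>The volume that the largest filling ball is certain to add to \<open>E0\<close>;
    the ball removed below takes at most \<open>\<tau> / 4\<close>.\<close>
  define \<tau> where "\<tau> = ?\<mu> (A \<inter> ball y0 R)"
  have \<tau>: "\<tau> > 0" unfolding \<tau>_def by (rule y0(2)[OF R(1)])
  have posE0: "0 < ?\<mu> E0" using E0(4) m(1) by simp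
  obtain x0 where x0: "x0 \<in> E0" "\<And>r. r > 0 \<Longrightarrow> 0 < ?\<mu> (E0 \<inter> ball x0 r)"
    by (rule point_of_positive_measure[OF E0(1) E0bd posE0]) (rule that; assumption)
  define s where "s = min (min 1 (\<epsilon> / (Cb + 1))) (\<tau> / (4 * (?\<omega> + 1)))"
  have s: "0 < s" "s \<le> 1" "s \<le> \<epsilon> / (Cb + 1)" "s \<le> \<tau> / (4 * (?\<omega> + 1))"
    using Cb(1) \<epsilon> \<tau> by (auto simp: s_def add_nonneg_pos)
  have ball_s: "?\<mu> (ball x0 s) \<le> \<tau> / 4"
  proof -
    have "s ^ ?d \<le> s ^ 1" using s d by (intro power_decreasing) auto
    then have "?\<omega> * s ^ ?d \<le> ?\<omega> * (\<tau> / (4 * (?\<omega> + 1)))" using s(4) by (intro mult_left_mono) auto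
    also have "\<dots> \<le> \<tau> / 4"
    proof -
      have "?\<omega> / (?\<omega> + 1) \<le> 1" using unit_ball_vol_nonneg[of "real ?d"] by (simp add: divide_le_eq_1 add_nonneg_pos)
      from mult_left_mono[OF this, of "\<tau> / 4"] show ?thesis using \<tau> by (simp add: mult_ac)
    qed
    finally show ?thesis using s by (simp add: measure_ball_eq)
  qed
  define E1 where "E1 = E0 - ball x0 s"
  have E1: "E1 \<in> sets borel" "E1 \<subseteq> closure U" using E0 by (auto simp: E1_def)
  have E1bd: "bounded E1" using E0bd by (rule bounded_subset) (auto simp: E1_def)
  have fE1: "E1 \<in> fmeasurable lborel" by (rule bounded_fmeasurable[OF E1(1) E1bd])
  have pE1: "per_bound E1 (c + \<epsilon>)"
    unfolding E1_def by (rule per_bound_Diff[OF E0(1) E0bd E0(3) _ _ ball_small[OF s(1-3)]]) auto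
  have E1m: "?\<mu> E1 = m - ?\<mu> (E0 \<inter> ball x0 s)"
  proof -
    have "E1 = E0 - (E0 \<inter> ball x0 s)" by (auto simp: E1_def)
    then show ?thesis using measurable_measure_Diff[OF fE0, of "E0 \<inter> ball x0 s"] E0 by simp
  qed
  have E1lt: "?\<mu> E1 < m" using E1m x0(2)[OF s(1)] by simp
  have E1ge: "m - \<tau> / 4 \<le> ?\<mu> E1"
  proof -
    have "?\<mu> (E0 \<inter> ball x0 s) \<le> ?\<mu> (ball x0 s)"
      using E0(1) by (intro measure_mono_fmeasurable bounded_fmeasurable) auto
    then show ?thesis using E1m ball_s by linarith
  qed
  \<comment> \<open>Three \<kappa> fit into the deficit, and the approximation and \<open>W\<close>
    use at most two, so the volume stays strictly below \<open>m\<close>. The bound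
    \<open>\<tau> / 8\<close> ensures that the largest filling ball reaches at least
    \<open>m\<close>.\<close>
  define \<kappa> where "\<kappa> = min \<epsilon> (min ((m - ?\<mu> E1) / 3) (\<tau> / 8))"
  have \<kappa>: "0 < \<kappa>" "\<kappa> \<le> \<epsilon>" "3 * \<kappa> \<le> m - ?\<mu> E1" "\<kappa> \<le> \<tau> / 8"
    using \<epsilon> E1lt \<tau> by (auto simp: \<kappa>_def min_def)
  obtain E2 where E2: "open E2" "E2 \<subseteq> U" "per_bound E2 (c + \<epsilon> + \<kappa>)" "emeasure lborel ((E2 - E1) \<union> (E1 - E2)) \<le> ennreal \<kappa>"
    by (rule open_approximation[OF U E1 pE1 \<kappa>(1)])
  obtain N W where NW: "compact N" "N \<in> null_sets lborel" "open W" "N \<subseteq> W" "W \<subseteq> U" "per_bound W \<kappa>"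
    "emeasure lborel W \<le> ennreal \<kappa>" "min_riesz_energy \<alpha> N \<le> min_riesz_energy \<alpha> (closure U) + ennreal \<kappa>"
    by (rule capacity_carrier[OF U U0 d \<alpha> fin \<kappa>(1)])
  have bd: "bounded S" if "S \<subseteq> U" for S using U(2) that by (rule bounded_subset)
  have fE2: "E2 \<in> fmeasurable lborel" and fW: "W \<in> fmeasurable lborel"
    using E2 NW by (auto intro!: bounded_fmeasurable bd)
  have mW: "?\<mu> W \<le> \<kappa>" using NW(7) \<kappa>(1) by (simp add: measure_def enn2real_leI)
  define \<Delta> where "\<Delta> = (E2 - E1) \<union> (E1 - E2)"
  have fS: "\<Delta> \<in> fmeasurable lborel" unfolding \<Delta>_def using fE1 fE2 by (auto intro!: fmeasurable.Un fmeasurable.Diff)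
  have mS: "?\<mu> \<Delta> \<le> \<kappa>" unfolding \<Delta>_def using E2(4) \<kappa>(1) by (simp add: measure_def enn2real_leI)
  define E3 where "E3 = E2 \<union> W"
  have oE3: "open E3" and E3U: "E3 \<subseteq> U" using E2 NW by (auto simp: E3_def)
  have fE3: "E3 \<in> fmeasurable lborel" using fE2 fW by (auto simp: E3_def)
  have E3lt: "?\<mu> E3 < m"
  proof -
    have "?\<mu> E3 \<le> ?\<mu> ((E1 \<union> \<Delta>) \<union> W)"
      using fE1 fS fW fE3 by (intro measure_mono_fmeasurable fmeasurable.Un) (auto simp: E3_def \<Delta>_def)
    also have "\<dots> \<le> ?\<mu> (E1 \<union> \<Delta>) + ?\<mu> W"
      using fE1 fS fW by (intro measure_Un_le fmeasurableD fmeasurable.Un)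
    also have "?\<mu> (E1 \<union> \<Delta>) \<le> ?\<mu> E1 + ?\<mu> \<Delta>"
      using fE1 fS by (intro measure_Un_le fmeasurableD)
    finally show ?thesis using mS mW \<kappa> by linarith
  qed
  have fB: "ball y0 r \<in> fmeasurable lborel" for r by (rule bounded_fmeasurable) auto
  have big: "m \<le> ?\<mu> (E3 \<union> ball y0 R)"
  proof -
    have fAB: "A \<inter> ball y0 R \<in> fmeasurable lborel" by (rule bounded_fmeasurable) (use Ab in \<open>auto intro: bounded_subset\<close>)
    have "E1 \<inter> (A \<inter> ball y0 R) = {}" by (auto simp: E1_def A_def)
    then have "?\<mu> E1 + \<tau> = ?\<mu> (E1 \<union> (A \<inter> ball y0 R))"
      unfolding \<tau>_def using measure_Un3[OF fE1 fAB] by simp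
    also have "\<dots> \<le> ?\<mu> ((E3 \<union> ball y0 R) \<union> \<Delta>)"
      using fE1 fAB fE3 fB fS by (intro measure_mono_fmeasurable fmeasurable.Un) (auto simp: E3_def \<Delta>_def dest: fmeasurableD intro!: sets.Un)
    also have "\<dots> \<le> ?\<mu> (E3 \<union> ball y0 R) + ?\<mu> \<Delta>"
      using fE3 fB fS by (intro measure_Un_le fmeasurableD fmeasurable.Un)
    finally show ?thesis using mS E1ge \<kappa> \<tau> by linarith
  qed
  obtain \<rho> where \<rho>: "0 < \<rho>" "\<rho> \<le> R" "?\<mu> (E3 \<union> ball y0 \<rho>) = m"
    by (rule exists_ball_with_volume[OF _ bd[OF E3U] E3lt big R(1)]) (use oE3 in auto)
  have pB: "per_bound (ball y0 \<rho>) \<epsilon>" by (rule ball_small) (use \<rho> R in auto)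
  \<comment> \<open>The four contributions are the removed ball, the approximation, \<open>W\<close>
    and the added ball; the middle two cost at most \<kappa> each.\<close>
  have "per_bound (E3 \<union> ball y0 \<rho>) ((c + \<epsilon> + \<kappa>) + \<kappa> + \<epsilon>)"
    unfolding E3_def using E2 NW pB by (intro per_bound_Un) (auto intro!: bd)
  then have pE: "per_bound (E3 \<union> ball y0 \<rho>) (c + 4 * \<epsilon>)" by (rule per_bound_mono) (use \<kappa> in auto)
  show ?thesis
  proof (rule that[OF _ _ \<rho>(3) pE NW(1,2)])
    show "open (E3 \<union> ball y0 \<rho>)" using oE3 by auto
    have "ball y0 \<rho> \<subseteq> ball y0 R" using \<rho> by auto
    then show "E3 \<union> ball y0 \<rho> \<subseteq> U" using E3U R(4) by blast
    show "N \<subseteq> E3 \<union> ball y0 \<rho>" using NW(4) by (auto simp: E3_def)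
    show "min_riesz_energy \<alpha> N \<le> min_riesz_energy \<alpha> (closure U) + ennreal \<epsilon>"
      using NW(8) \<kappa>(2) by (meson add_left_mono ennreal_leI order_trans)
  qed
qed

section \<open>Changes on null sets and the two infima\<close>

lemma perimeter_cong_null:
  assumes "N \<in> null_sets lborel" "\<And>x. x \<notin> N \<Longrightarrow> x \<in> E \<longleftrightarrow> x \<in> F" "E \<in> sets lebesgue" "F \<in> sets lebesgue"
  shows "perimeter E = perimeter F"
proof -
  have "N \<in> null_sets lebesgue" using assms(1) by (rule null_sets_completionI)
  from AE_not_in[OF this] have ae: "AE x in lebesgue. x \<in> E \<longleftrightarrow> x \<in> F"
    by eventually_elim (use assms(2) in auto)
  have "(LINT x:E|lebesgue. divergence \<phi> x) = (LINT x:F|lebesgue. divergence \<phi> x)" if "\<phi> \<in> admissible_fields" for \<phi>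
    unfolding set_lebesgue_integral_def
  proof (rule integral_cong_AE)
    have "divergence \<phi> \<in> borel_measurable lebesgue"
      using borel_measurable_divergence[OF that] by (simp add: measurable_completion)
    then show "(\<lambda>x. indicator E x *\<^sub>R divergence \<phi> x) \<in> borel_measurable lebesgue" "(\<lambda>x. indicator F x *\<^sub>R divergence \<phi> x) \<in> borel_measurable lebesgue"
      using assms(3,4) by auto
    show "AE x in lebesgue. indicator E x *\<^sub>R divergence \<phi> x = indicator F x *\<^sub>R divergence \<phi> x"
      using ae by eventually_elim (simp add: indicator_def)
  qed
  then show ?thesis unfolding perimeter_def by (intro SUP_cong) auto
qed

text \<open>A null set contains no ball, so every ball in \<open>E\<close> around a point of
  \<open>N\<close> meets \<open>E - N\<close>.\<close>

lemma frontier_Diff_null: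
  fixes E N :: "'a::euclidean_space set"
  assumes "open E" "N \<subseteq> E" "N \<in> null_sets lborel" "open (E - N)"
  shows "N \<subseteq> frontier (E - N)"
proof
  fix x assume x: "x \<in> N"
  have "x \<in> closure (E - N)"
  proof (rule ccontr)
    assume "x \<notin> closure (E - N)"
    then have "x \<in> E \<inter> - closure (E - N)" using x assms(2) by auto
    moreover have "open (E \<inter> - closure (E - N))" using assms(1) by auto
    ultimately obtain r where r: "r > 0" "ball x r \<subseteq> E \<inter> - closure (E - N)" using openE by blast
    then have "ball x r \<subseteq> N" using r(2) closure_subset[of "E - N"] by blast
    then have "ball x r \<in> null_sets lborel" using assms(3) by (rule null_sets_subset[rotated 2]) simp
    then have "measure lborel (ball x r) = 0" by (simp add: measure_eq_0_null_sets)
    then show False using content_ball_pos[OF r(1), of x] by simp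
  qed
  then show "x \<in> frontier (E - N)" using x assms(4) by (auto simp: frontier_def interior_open)
qed

theorem theorem3p4:
  fixes \<Omega> E\<^sub>0 :: "'a::euclidean_space set" and m \<alpha> Q :: real
  assumes "DIM('a) \<ge> 2"
    and "compact_smooth_boundary \<Omega>"
    and "0 < m" and "ennreal m < emeasure lebesgue \<Omega>"
    and "isoperimetric_solution \<Omega> m E\<^sub>0"
    and "0 < \<alpha>" and "\<alpha> < real DIM('a) - 1"
    and "0 < Q"
  shows "(INF E\<in>open_competitors \<Omega> m. F_energy \<alpha> Q E)
           = (INF E\<in>open_competitors \<Omega> m. G_energy \<alpha> Q E)
         \<and> (INF E\<in>open_competitors \<Omega> m. G_energy \<alpha> Q E)
           = perimeter E\<^sub>0 + ennreal (Q\<^sup>2) * min_riesz_energy \<alpha> \<Omega>"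
proof -
  let ?I = "min_riesz_energy \<alpha> \<Omega>" and ?P = "perimeter E\<^sub>0" and ?O = "open_competitors \<Omega> m"
  let ?V = "?P + ennreal (Q\<^sup>2) * ?I"
  obtain U where U: "bounded U" "open_smooth_boundary U" "\<Omega> = closure U"
    using assms(2) unfolding compact_smooth_boundary_def by blast
  have E0: "E\<^sub>0 \<in> sets lebesgue" "E\<^sub>0 \<subseteq> \<Omega>" "emeasure lebesgue E\<^sub>0 = ennreal m"
    and E0min: "\<And>E. E \<in> sets lebesgue \<Longrightarrow> E \<subseteq> \<Omega> \<Longrightarrow> emeasure lebesgue E = ennreal m \<Longrightarrow> ?P \<le> perimeter E"
    using assms(5) unfolding isoperimetric_solution_def is_arg_min_def by (blast intro: leI)+
  have comp: "open E" "E \<subseteq> \<Omega>" "frontier E \<subseteq> \<Omega>" "?P \<le> perimeter E" if "E \<in> ?O" for E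
  proof -
    have E: "open E" "E \<subseteq> \<Omega>" "emeasure lebesgue E = ennreal m" using that by (auto simp: open_competitors_def)
    then show "open E" "E \<subseteq> \<Omega>" "?P \<le> perimeter E" using E0min by auto
    show "frontier E \<subseteq> \<Omega>" using closure_minimal[OF E(2)] U(3) by (auto simp: frontier_def)
  qed
  have \<Omega>b: "\<Omega> \<in> sets borel" using U(3) by simp
  \<comment> \<open>\<Omega> is closed, so it contains the frontier of a competitor as well, and
    monotonicity bounds both energy terms.\<close>
  have lowF: "?V \<le> F_energy \<alpha> Q E" and lowG: "?V \<le> G_energy \<alpha> Q E" if "E \<in> ?O" for E
    unfolding F_energy_def G_energy_def using comp[OF that] \<Omega>b
    by (auto intro!: add_mono mult_left_mono min_riesz_energy_antimono)
  have upper: "(INF E\<in>?O. F_energy \<alpha> Q E) \<le> ?V \<and> (INF E\<in>?O. G_energy \<alpha> Q E) \<le> ?V"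
  proof (cases "?P = top \<or> ?I = top")
    case True
    \<comment> \<open>As \<open>Q > 0\<close>, an infinite energy of \<Omega> also makes the
      right-hand side infinite, and nothing remains to be shown.\<close>
    then have V: "?V = top" using assms(8) by (auto simp: ennreal_mult_top)
    show ?thesis unfolding V by simp
  next
    case False
    define c where "c = enn2real ?P"
    have c: "?P = ennreal c" "0 \<le> c" using False by (auto simp: c_def less_top)
    \<comment> \<open>\<open>E\<^sub>0\<close> is only Lebesgue measurable, while the approximation
      works with Borel sets; \<open>S\<close> differs from it by a null set.\<close>
    obtain S N0 N1 where S: "E\<^sub>0 = S \<union> N0" "N0 \<subseteq> N1" "N1 \<in> null_sets lborel" "S \<in> sets lborel"
      using E0(1) by (auto elim: sets_completionE)
    have Sb: "S \<in> sets borel" using S(4) by simp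
    have "perimeter S = ?P" by (rule perimeter_cong_null[OF S(3)]) (use S E0 in auto)
    then have pS: "per_bound S c" using perimeter_le_iff[OF Sb c(2)] c(1) by simp
    have mS: "measure lborel S = m"
    proof -
      have "emeasure lebesgue E\<^sub>0 = emeasure lborel S"
      proof -
        have "N0 \<in> null_sets lebesgue" by (rule null_sets_completion_subset[OF S(2) null_sets_completionI[OF S(3)]])
        then have "emeasure lebesgue (S \<union> N0) = emeasure lebesgue S" using Sb by (intro emeasure_Un_null_set) auto
        then show ?thesis using S Sb by simp
      qed
      then show ?thesis using E0(3) assms(3) by (simp add: measure_def)
    qed
    have m2: "m < measure lborel (closure U)"
    proof -
      have "emeasure lborel (closure U) = ennreal (measure lborel (closure U))"
        by (rule emeasure_eq_measure_bounded) (rule bounded_closure[OF U(1)])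
      then show ?thesis using assms(3,4) U(3) by (simp add: ennreal_less_iff)
    qed
    have close: "(INF E\<in>?O. F_energy \<alpha> Q E) \<le> ?V + ennreal e \<and> (INF E\<in>?O. G_energy \<alpha> Q E) \<le> ?V + ennreal e" if e: "e > 0" for e
    proof -
      \<comment> \<open>The perimeter loses \<open>4 * \<epsilon>\<close> and the energy term
        \<open>Q\<^sup>2 * \<epsilon>\<close>, together exactly \<open>e\<close>.\<close>
      define \<epsilon> where "\<epsilon> = e / (4 + Q\<^sup>2)"
      have q: "4 + Q\<^sup>2 > 0" by (intro add_pos_nonneg) auto
      have \<epsilon>: "\<epsilon> > 0" "4 * \<epsilon> + Q\<^sup>2 * \<epsilon> = e"
        unfolding distrib_right[symmetric] using e q by (simp_all add: \<epsilon>_def)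
      have fin: "min_riesz_energy \<alpha> (closure U) < \<infinity>" using False U(3) by (simp add: less_top)
      have SU: "S \<subseteq> closure U" using S(1) E0(2) U(3) by auto
      obtain E N where E: "open E" "E \<subseteq> U" "measure lborel E = m" "per_bound E (c + 4 * \<epsilon>)"
        and N: "compact N" "N \<in> null_sets lborel" "N \<subseteq> E" "min_riesz_energy \<alpha> N \<le> ?I + ennreal \<epsilon>"
        by (rule near_optimal_set[OF U(2,1) assms(1,6,7) fin \<epsilon>(1) Sb SU pS mS assms(3) m2, folded U(3)]) (rule that; assumption)
      have EU: "E \<subseteq> \<Omega>" using E(2) U(3) closure_subset by blast
      have Ebd: "bounded E" using U(1) E(2) by (rule bounded_subset)
      have Eb: "E \<in> sets borel" using E(1) by simp
      have Nb: "N \<in> sets borel" using N(2) by auto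
      have Em: "emeasure lborel E = ennreal m"
        using emeasure_eq_measure_bounded[OF Ebd] E(3) by simp
      have oD: "open (E - N)" using E(1) compact_imp_closed[OF N(1)] by (rule open_Diff)
      have fr: "N \<subseteq> frontier (E - N)" by (rule frontier_Diff_null[OF E(1) N(3,2) oD])
      have Dm: "emeasure lborel (E - N) = ennreal m" using emeasure_Diff_null_set[OF N(2)] Eb Em by simp
      \<comment> \<open>\<open>E\<close> serves the first infimum, as it contains \<open>N\<close>;
        \<open>E - N\<close> serves the second, as its frontier contains \<open>N\<close>.\<close>
      have O: "E \<in> ?O" "E - N \<in> ?O" using E EU Em Dm oD by (auto simp: open_competitors_def)
      have PE: "perimeter E \<le> ennreal (c + 4 * \<epsilon>)" using perimeter_le_iff[OF Eb, of "c + 4 * \<epsilon>"] E(4) c(2) \<epsilon>(1) by (simp del: ennreal_plus)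
      have "perimeter (E - N) = perimeter E" by (rule perimeter_cong_null[OF N(2)]) (use Eb Nb in auto)
      then have PD: "perimeter (E - N) \<le> ennreal (c + 4 * \<epsilon>)" using PE by simp
      have IE: "min_riesz_energy \<alpha> E \<le> ?I + ennreal \<epsilon>"
        using min_riesz_energy_antimono[OF Nb Eb N(3)] N(4) by (rule order_trans)
      have ID: "min_riesz_energy \<alpha> (frontier (E - N)) \<le> ?I + ennreal \<epsilon>"
        using min_riesz_energy_antimono[OF Nb _ fr] N(4) by (rule order_trans) simp
      have tot: "ennreal (c + 4 * \<epsilon>) + ennreal (Q\<^sup>2) * (?I + ennreal \<epsilon>) = ?V + ennreal e"
      proof -
        have "ennreal (c + 4 * \<epsilon>) + ennreal (Q\<^sup>2) * (?I + ennreal \<epsilon>)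
           = (ennreal c + ennreal (Q\<^sup>2) * ?I) + (ennreal (4 * \<epsilon>) + ennreal (Q\<^sup>2) * ennreal \<epsilon>)"
          using c \<epsilon> by (simp add: ennreal_plus distrib_left add_ac)
        also have "ennreal (4 * \<epsilon>) + ennreal (Q\<^sup>2) * ennreal \<epsilon> = ennreal (4 * \<epsilon> + Q\<^sup>2 * \<epsilon>)"
          using \<epsilon>(1) by (simp add: ennreal_mult)
        finally show ?thesis using \<epsilon>(2) c by simp
      qed
      have "F_energy \<alpha> Q E \<le> ?V + ennreal e"
        unfolding F_energy_def tot[symmetric] by (intro add_mono PE mult_left_mono IE) auto
      moreover have "G_energy \<alpha> Q (E - N) \<le> ?V + ennreal e"
        unfolding G_energy_def tot[symmetric] by (intro add_mono PD mult_left_mono ID) auto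
      ultimately show ?thesis using O by (meson INF_lower2)
    qed
    show ?thesis by (intro conjI; rule ennreal_le_epsilon) (use close in auto)
  qed
  have "(INF E\<in>?O. F_energy \<alpha> Q E) = ?V"
    by (rule antisym) (use upper lowF in \<open>auto intro: INF_greatest\<close>)
  moreover have "(INF E\<in>?O. G_energy \<alpha> Q E) = ?V"
    by (rule antisym) (use upper lowG in \<open>auto intro: INF_greatest\<close>)
  ultimately show ?thesis by simp
qed

end
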